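(* Let $M^n$ be a complete hypersurface with constant weighted mean curvature $\lambda$ properly immersed in the Gaussian space $\mathbb{R}^{n+1}$. Suppose that the image of the Gauss map $N: M \to S^n$ is contained in the closed hemisphere $\{x \in S^n : x_{n+1}\ge 0\}$. Then either (i) $M$ is a hyperplane, or (ii) $M$ splits isometrically as $M^n=\tilde{M}^{n-1}\times \mathbb{R}$, where $\tilde{M}^{n-1}$ is a hypersurface with constant weighted mean curvature $\lambda$ in the Gaussian space $\mathbb{R}^n\times\{0\}$.
   Context: The Gaussian space $\mathbb{R}^{m}$ is $\mathbb{R}^{m}$ with its canonical metric and the weight function $f(x)=|x|^2/4$ (weighted measure $e^{-f}\,d\mathrm{vol}$); $\mathbb{R}^n\times\{0\}\subset\mathbb{R}^{n+1}$ is identified with the Gaussian space $\mathbb{R}^n$. Hypersurfaces are smooth, connected, immersed, and carry a smooth unit normal field $N$; the map $N: M\to S^n$ is the Gauss map. "Complete" refers to the induced metric. "Hyperplane" means affine hyperplane (not necessarily through the origin). With $\bar\nabla$ the flat connection, the mean curvature is the trace of the second fundamental form, $H=\sum_i\langle\bar\nabla_{e_i}e_i,N\rangle$ for a local orthonormal frame $e_1,\dots,e_n$ of $TM$. The hypersurface has constant weighted mean curvature $\lambda$ (with $\lambda\in\mathbb{R}$ constant) if $H+\frac12\langle x,N\rangle=\lambda$ on $M$, where $x$ is the position vector. The same definition is used for $\tilde M$ in $\mathbb{R}^n$, with respect to a suitable unit normal field of $\tilde M$. The splitting in (ii) is understood as a splitting of the hypersurface inside $\mathbb{R}^{n+1}=\mathbb{R}^n\times\mathbb{R}$: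 $M$ is the generalized cylinder over $\tilde M\subset\mathbb{R}^n\times\{0\}$ whose factor $\mathbb{R}$ consists of the lines parallel to the $x_{n+1}$-axis. *)

theory Defs
  imports "HOL-Analysis.Analysis"
begin

section \<open>Smooth maps on open subsets of a linear subspace\<close>

text \<open>
  Manifolds are modelled on a linear subspace \<open>S\<close> of a Euclidean space, so that every dimension,
  including 0, is available without a separate type for it. Accordingly \<open>V\<close> below is meant to be
  open relative to \<open>S\<close>, and only derivatives in directions of \<open>S\<close> are taken: \<open>f\<close> is of class
  \<open>C\<^sup>k\<close> iff its iterated directional derivatives up to order \<open>k\<close> exist and are continuous.
\<close>

primrec Ck_on ::
  "nat \<Rightarrow> 'm::real_normed_vector set \<Rightarrow> 'm set \<Rightarrow> ('m \<Rightarrow> 'b::real_normed_vector) \<Rightarrow> bool" where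
  "Ck_on 0 S V f \<longleftrightarrow> continuous_on V f"
| "Ck_on (Suc k) S V f \<longleftrightarrow> continuous_on V f \<and>
     (\<forall>v\<in>S. \<exists>g. Ck_on k S V g \<and>
        (\<forall>x\<in>V. ((\<lambda>t::real. f (x + t *\<^sub>R v)) has_vector_derivative g x) (at 0)))"

definition smooth_on ::
  "'m::real_normed_vector set \<Rightarrow> 'm set \<Rightarrow> ('m \<Rightarrow> 'b::real_normed_vector) \<Rightarrow> bool" where
  "smooth_on S V f \<longleftrightarrow> (\<forall>k. Ck_on k S V f)"


section \<open>Smooth manifolds\<close>

text \<open>A chart is a pair of its domain and its coordinate map.\<close>

type_synonym ('p, 'm) chart = "'p set \<times> ('p \<Rightarrow> 'm)"

definition chart_inv :: "('p, 'm) chart \<Rightarrow> 'm \<Rightarrow> 'p" where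
  "chart_inv c = inv_into (fst c) (snd c)"

definition is_chart :: "'m::euclidean_space set \<Rightarrow> 'p topology \<Rightarrow> ('p, 'm) chart \<Rightarrow> bool" where
  "is_chart S M c \<longleftrightarrow>
     openin M (fst c) \<and>
     openin (top_of_set S) (snd c ` fst c) \<and>
     homeomorphic_map (subtopology M (fst c)) (top_of_set (snd c ` fst c)) (snd c)"

definition smooth_atlas :: "'m::euclidean_space set \<Rightarrow> 'p topology \<Rightarrow> ('p, 'm) chart set \<Rightarrow> bool" where
  "smooth_atlas S M A \<longleftrightarrow>
     (\<forall>c\<in>A. is_chart S M c) \<and>
     (\<Union>c\<in>A. fst c) = topspace M \<and>
     (\<forall>c\<in>A. \<forall>c'\<in>A. smooth_on S (snd c ` (fst c \<inter> fst c')) (snd c' \<circ> chart_inv c))"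

text \<open>The dimension of the manifold is \<open>dim S\<close>.\<close>

definition smooth_manifold ::
  "'m::euclidean_space set \<Rightarrow> 'p topology \<Rightarrow> ('p, 'm) chart set \<Rightarrow> bool" where
  "smooth_manifold S M A \<longleftrightarrow>
     subspace S \<and> Hausdorff_space M \<and> second_countable M \<and> smooth_atlas S M A"

definition smooth_vector_map ::
  "'m::euclidean_space set \<Rightarrow> ('p, 'm) chart set \<Rightarrow> ('p \<Rightarrow> 'e::real_normed_vector) \<Rightarrow> bool" where
  "smooth_vector_map S A f \<longleftrightarrow> (\<forall>c\<in>A. smooth_on S (snd c ` fst c) (f \<circ> chart_inv c))"

definition smooth_manifold_map ::
  "'m::euclidean_space set \<Rightarrow> 'p topology \<Rightarrow> ('p, 'm) chart set \<Rightarrow>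
   'k::euclidean_space set \<Rightarrow> 'q topology \<Rightarrow> ('q, 'k) chart set \<Rightarrow> ('p \<Rightarrow> 'q) \<Rightarrow> bool" where
  "smooth_manifold_map S M A S' M' A' f \<longleftrightarrow>
     continuous_map M M' f \<and>
     (\<forall>c\<in>A. \<forall>c'\<in>A'. smooth_on S (snd c ` {p \<in> fst c. f p \<in> fst c'}) (snd c' \<circ> f \<circ> chart_inv c))"

definition diffeomorphism ::
  "'m::euclidean_space set \<Rightarrow> 'p topology \<Rightarrow> ('p, 'm) chart set \<Rightarrow>
   'k::euclidean_space set \<Rightarrow> 'q topology \<Rightarrow> ('q, 'k) chart set \<Rightarrow> ('p \<Rightarrow> 'q) \<Rightarrow> bool" where
  "diffeomorphism S M A S' M' A' f \<longleftrightarrow>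
     (\<exists>g. homeomorphic_maps M M' f g \<and>
        smooth_manifold_map S M A S' M' A' f \<and> smooth_manifold_map S' M' A' S M A g)"

text \<open>
  The differential at \<open>p\<close> of a vector-valued map, applied to the tangent vector which has the
  coordinates \<open>v \<in> S\<close> in the chart \<open>c\<close>. For vector fields along the manifold with values in a
  Euclidean space this is the flat covariant derivative.
\<close>

definition differential ::
  "('p, 'm::euclidean_space) chart \<Rightarrow> ('p \<Rightarrow> 'e::real_normed_vector) \<Rightarrow> 'p \<Rightarrow> 'm \<Rightarrow> 'e" where
  "differential c f p v =
     vector_derivative (\<lambda>t::real. f (chart_inv c (snd c p + t *\<^sub>R v))) (at 0)"

text \<open>The product with the real line, modelled on \<open>S \<times> UNIV\<close>.\<close>

definition line_product_atlas :: "('p, 'm) chart set \<Rightarrow> ('p \<times> real, 'm \<times> real) chart set" where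
  "line_product_atlas A = (\<lambda>c. (fst c \<times> UNIV, map_prod (snd c) id)) ` A"


section \<open>Immersed hypersurfaces\<close>

definition immersion ::
  "'m::euclidean_space set \<Rightarrow> ('p, 'm) chart set \<Rightarrow> ('p \<Rightarrow> 'e::real_normed_vector) \<Rightarrow> bool" where
  "immersion S A F \<longleftrightarrow>
     smooth_vector_map S A F \<and> (\<forall>c\<in>A. \<forall>p\<in>fst c. inj_on (differential c F p) S)"

definition unit_normal_field ::
  "'m::euclidean_space set \<Rightarrow> ('p, 'm) chart set \<Rightarrow> ('p \<Rightarrow> 'e::euclidean_space) \<Rightarrow> ('p \<Rightarrow> 'e) \<Rightarrow> bool" where
  "unit_normal_field S A F N \<longleftrightarrow>
     smooth_vector_map S A N \<and>
     (\<forall>c\<in>A. \<forall>p\<in>fst c. norm (N p) = 1 \<and> (\<forall>v\<in>S. differential c F p v \<bullet> N p = 0))"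

definition hypersurface ::
  "'m::euclidean_space set \<Rightarrow> 'p topology \<Rightarrow> ('p, 'm) chart set \<Rightarrow>
   ('p \<Rightarrow> 'e::euclidean_space) \<Rightarrow> ('p \<Rightarrow> 'e) \<Rightarrow> bool" where
  "hypersurface S M A F N \<longleftrightarrow>
     smooth_manifold S M A \<and> dim S + 1 = DIM('e) \<and>
     topspace M \<noteq> {} \<and> connected_space M \<and>
     immersion S A F \<and> unit_normal_field S A F N"

definition induced_metric ::
  "('p, 'm::euclidean_space) chart \<Rightarrow> ('p \<Rightarrow> 'e::euclidean_space) \<Rightarrow> 'p \<Rightarrow> 'm \<Rightarrow> 'm \<Rightarrow> real" where
  "induced_metric c F p v w = differential c F p v \<bullet> differential c F p w"

text \<open>
  The Riemannian distance of the induced metric is the infimum of the lengths of piecewise \<open>C\<^sup>1\<close>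
  curves. Since \<open>F\<close> is an immersion, a continuous curve \<open>\<gamma>\<close> in the manifold is \<open>C\<^sup>1\<close> in charts
  wherever \<open>F \<circ> \<gamma>\<close> is \<open>C\<^sup>1\<close>. Finite length has to be demanded, because \<^const>\<open>valid_path\<close>
  does not bound the derivative near the exceptional points.
\<close>

definition curve_of_length ::
  "'p topology \<Rightarrow> ('p \<Rightarrow> 'e::euclidean_space) \<Rightarrow> (real \<Rightarrow> 'p) \<Rightarrow> real \<Rightarrow> bool" where
  "curve_of_length M F \<gamma> l \<longleftrightarrow>
     pathin M \<gamma> \<and> valid_path (F \<circ> \<gamma>) \<and>
     ((\<lambda>t. norm (vector_derivative (F \<circ> \<gamma>) (at t))) has_integral l) {0..1}"

definition induced_distance :: "'p topology \<Rightarrow> ('p \<Rightarrow> 'e::euclidean_space) \<Rightarrow> 'p \<Rightarrow> 'p \<Rightarrow> real" where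
  "induced_distance M F p q = Inf {l. \<exists>\<gamma>. curve_of_length M F \<gamma> l \<and> \<gamma> 0 = p \<and> \<gamma> 1 = q}"

definition complete_hypersurface :: "'p topology \<Rightarrow> ('p \<Rightarrow> 'e::euclidean_space) \<Rightarrow> bool" where
  "complete_hypersurface M F \<longleftrightarrow> Metric_space.mcomplete (topspace M) (induced_distance M F)"

text \<open>
  A diffeomorphism that pulls the metric induced by \<open>F'\<close> back to the one induced by \<open>F\<close>; the
  differential of \<open>F' \<circ> f\<close> is that of \<open>F'\<close> after that of \<open>f\<close>.
\<close>

definition riemannian_isometry ::
  "'m::euclidean_space set \<Rightarrow> 'p topology \<Rightarrow> ('p, 'm) chart set \<Rightarrow> ('p \<Rightarrow> 'e::euclidean_space) \<Rightarrow>
   'k::euclidean_space set \<Rightarrow> 'q topology \<Rightarrow> ('q, 'k) chart set \<Rightarrow> ('q \<Rightarrow> 'd::euclidean_space) \<Rightarrow>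
   ('p \<Rightarrow> 'q) \<Rightarrow> bool" where
  "riemannian_isometry S M A F S' M' A' F' f \<longleftrightarrow>
     diffeomorphism S M A S' M' A' f \<and>
     (\<forall>c\<in>A. \<forall>p\<in>fst c. \<forall>v\<in>S. \<forall>w\<in>S.
        induced_metric c (F' \<circ> f) p v w = induced_metric c F p v w)"


section \<open>Weighted mean curvature in Gaussian space\<close>

text \<open>
  The tangent vector \<open>w\<close> is extended to the vector field with constant coordinates in the chart,
  and then differentiated in the direction \<open>v\<close>. The normal component does not depend on the
  extension.
\<close>

definition second_fundamental_form ::
  "('p, 'm::euclidean_space) chart \<Rightarrow> ('p \<Rightarrow> 'e::euclidean_space) \<Rightarrow> ('p \<Rightarrow> 'e) \<Rightarrow>
   'p \<Rightarrow> 'm \<Rightarrow> 'm \<Rightarrow> real" where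
  "second_fundamental_form c F N p v w =
     differential c (\<lambda>q. differential c F q w) p v \<bullet> N p"

definition orthonormal_tangent_basis ::
  "'m::euclidean_space set \<Rightarrow> ('p, 'm) chart \<Rightarrow> ('p \<Rightarrow> 'e::euclidean_space) \<Rightarrow> 'p \<Rightarrow> 'm set \<Rightarrow> bool" where
  "orthonormal_tangent_basis S c F p B \<longleftrightarrow>
     B \<subseteq> S \<and> finite B \<and> card B = dim S \<and>
     (\<forall>v\<in>B. \<forall>w\<in>B. induced_metric c F p v w = (if v = w then 1 else 0))"

text \<open>
  The mean curvature is the trace of the second fundamental form with respect to the induced
  metric, computed in the chart \<open>c\<close> with the orthonormal basis \<open>B\<close>. Its value does not depend on
  \<open>c\<close> and \<open>B\<close>, so the next definition quantifies over all of them.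
\<close>

definition mean_curvature ::
  "('p, 'm::euclidean_space) chart \<Rightarrow> 'm set \<Rightarrow> ('p \<Rightarrow> 'e::euclidean_space) \<Rightarrow> ('p \<Rightarrow> 'e) \<Rightarrow> 'p \<Rightarrow> real" where
  "mean_curvature c B F N p = (\<Sum>v\<in>B. second_fundamental_form c F N p v v)"

definition constant_weighted_mean_curvature ::
  "'m::euclidean_space set \<Rightarrow> ('p, 'm) chart set \<Rightarrow> ('p \<Rightarrow> 'e::euclidean_space) \<Rightarrow> ('p \<Rightarrow> 'e) \<Rightarrow>
   real \<Rightarrow> bool" where
  "constant_weighted_mean_curvature S A F N lam \<longleftrightarrow>
     (\<forall>c\<in>A. \<forall>p\<in>fst c. \<forall>B. orthonormal_tangent_basis S c F p B \<longrightarrow>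
        mean_curvature c B F N p + (1/2) * (F p \<bullet> N p) = lam)"


section \<open>The two alternatives\<close>

text \<open>
  An injective immersion that is a homeomorphism onto its image is an embedding, hence an isometry
  onto the image.
\<close>

definition is_hyperplane :: "'p topology \<Rightarrow> ('p \<Rightarrow> 'e::euclidean_space) \<Rightarrow> bool" where
  "is_hyperplane M F \<longleftrightarrow>
     (\<exists>a b. a \<noteq> 0 \<and> homeomorphic_map M (top_of_set {x. a \<bullet> x = b}) F)"

text \<open>
  The product \<open>M' \<times> \<real>\<close> carries the product metric, which is the metric induced by the immersion
  \<open>F' \<times> id\<close>. The last conjunct says that the splitting takes place inside the ambient space:
  the lines \<open>{q} \<times> \<real>\<close> go to lines parallel to the last axis, over the points of \<open>M'\<close>.
\<close>

definition splits_off_vertical_line ::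
  "'m::euclidean_space set \<Rightarrow> 'p topology \<Rightarrow> ('p, 'm) chart set \<Rightarrow>
   ('p \<Rightarrow> 'e::euclidean_space \<times> real) \<Rightarrow>
   'k::euclidean_space set \<Rightarrow> 'q topology \<Rightarrow> ('q, 'k) chart set \<Rightarrow> ('q \<Rightarrow> 'e) \<Rightarrow> bool" where
  "splits_off_vertical_line S M A F S' M' A' F' \<longleftrightarrow>
     (\<exists>f. riemannian_isometry
            (S' \<times> UNIV) (prod_topology M' euclideanreal) (line_product_atlas A') (map_prod F' id)
            S M A F f \<and>
          (\<forall>q\<in>topspace M'. \<forall>t. F (f (q, t)) = (F' q, t)))"

end

theory Submission
  imports Defs
begin

text \<open>
  Let \<open>e\<close> be the last unit vector and \<open>\<alpha> = N \<bullet> e\<close>, which is nonnegative by assumption. Differentiating the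
  equation for the mean curvature shows that the Gauss map satisfies \<open>L N = - |A|\<^sup>2 N\<close>, where
  \<open>L u = \<Delta> u - \<langle>x, \<nabla>u\<rangle>/2\<close> is the drift Laplacian of the Gaussian weight. Hence \<open>L \<alpha> = - |A|\<^sup>2 \<alpha> \<le> 0\<close>. On the
  other hand \<open>L |x|\<^sup>2 = 2n + 2 lam \<langle>x, N\<rangle> - |x|\<^sup>2\<close> is negative outside a compact set, because the immersion
  is proper. Comparison with small multiples of \<open>|x|\<^sup>2\<close> shows that \<open>\<alpha>\<close> attains its minimum
  (\<open>angle_attains_min\<close>), and the strong maximum principle then makes it constant (\<open>angle_constant\<close>), say
  equal to \<open>m\<close>. It follows that \<open>|A|\<^sup>2 m = 0\<close>.

  If \<open>m > 0\<close>, then \<open>A = 0\<close>, the normal is constant and the immersion is a proper local homeomorphism to a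
  hyperplane, which has a global section because lines can be lifted (\<open>flat_imp_hyperplane\<close>).

  If \<open>m = 0\<close>, then \<open>e\<close> is tangent everywhere. Properness allows vertical lines to be lifted for all times, and
  the lifts form a flow on \<open>M\<close>. The flow identifies \<open>M\<close> with the product of its slice at height 0 and the line
  (\<open>splits\<close>). The slice inherits the equation for the mean curvature, because the vertical direction is flat
  (\<open>slice_cwmc\<close>).

  All local computations are done in parametrizations that invert a linear projection \<open>\<Lambda>\<close> of the ambient space
  (\<open>patch\<close>). There the mean curvature is minus the divergence of \<open>\<Lambda> \<circ> N\<close>, and neither the inverse metric nor
  Christoffel symbols occur. The maximum principles are applied to functions \<open>\<alpha> + \<phi>(|x - a|\<^sup>2)\<close>, for which the
  test at a local minimum is \<open>local_min_inequality\<close>.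
\<close>

section \<open>Directional derivatives and maps of class C^k\<close>

definition dderiv :: "('m::real_normed_vector \<Rightarrow> 'b::real_normed_vector) \<Rightarrow> 'm \<Rightarrow> 'm \<Rightarrow> 'b" where
  "dderiv f v x = vector_derivative (\<lambda>t::real. f (x + t *\<^sub>R v)) (at 0)"

lemma dderiv_eq:
  "((\<lambda>t::real. f (x + t *\<^sub>R v)) has_vector_derivative d) (at 0) \<Longrightarrow> dderiv f v x = d"
  unfolding dderiv_def by (rule vector_derivative_at)

lemma line_eventually_in:
  fixes S :: "'m::real_normed_vector set"
  assumes "subspace S" "openin (top_of_set S) V" "x \<in> V" "v \<in> S"
  shows "\<forall>\<^sub>F t::real in nhds 0. x + t *\<^sub>R v \<in> V"
proof -
  obtain T where T: "open T" "V = S \<inter> T"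
    using assms(2) by (auto simp: openin_open)
  have S: "x + t *\<^sub>R v \<in> S" for t
    using assms T by (auto intro: subspace_add subspace_scale)
  have "((\<lambda>t. x + t *\<^sub>R v) \<longlongrightarrow> x + 0 *\<^sub>R v) (nhds 0)"
    by (intro tendsto_intros) (auto simp: filterlim_ident)
  then have "\<forall>\<^sub>F t in nhds 0. x + t *\<^sub>R v \<in> T"
    using T assms(3) by (auto dest!: topological_tendstoD)
  then show ?thesis
    by eventually_elim (use S T in auto)
qed

lemma has_dderiv_cong:
  fixes S :: "'m::real_normed_vector set"
  assumes "subspace S" "openin (top_of_set S) V" "x \<in> V" "v \<in> S" "\<And>y. y \<in> V \<Longrightarrow> f y = g y"
    and "((\<lambda>t::real. f (x + t *\<^sub>R v)) has_vector_derivative d) (at 0)"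
  shows "((\<lambda>t::real. g (x + t *\<^sub>R v)) has_vector_derivative d) (at 0)"
proof -
  have "\<forall>\<^sub>F t::real in nhds 0. f (x + t *\<^sub>R v) = g (x + t *\<^sub>R v)"
    using line_eventually_in[OF assms(1-4)] by eventually_elim (use assms(5) in auto)
  then show ?thesis
    using assms(6) has_vector_derivative_cong_ev[of UNIV "\<lambda>t. f (x + t *\<^sub>R v)" "\<lambda>t. g (x + t *\<^sub>R v)" 0 d]
    by (auto dest: eventually_nhds_x_imp_x)
qed

lemma dderiv_cong:
  fixes S :: "'m::real_normed_vector set"
  assumes "subspace S" "openin (top_of_set S) V" "x \<in> V" "v \<in> S" "\<And>y. y \<in> V \<Longrightarrow> f y = g y"
  shows "dderiv f v x = dderiv g v x"
proof -
  have "\<forall>\<^sub>F t::real in nhds 0. f (x + t *\<^sub>R v) = g (x + t *\<^sub>R v)"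
    using line_eventually_in[OF assms(1-4)] by eventually_elim (use assms(5) in auto)
  then show ?thesis
    unfolding dderiv_def by (intro vector_derivative_cong_eq) auto
qed

lemma Ck_on_cong:
  fixes S :: "'m::real_normed_vector set"
  assumes "subspace S" "openin (top_of_set S) V" "\<And>y. y \<in> V \<Longrightarrow> f y = g y" "Ck_on k S V f"
  shows "Ck_on k S V g"
proof (cases k)
  case 0
  then show ?thesis using assms by (auto cong: continuous_on_cong)
next
  case (Suc j)
  have "continuous_on V g"
    using assms(3,4) Suc by (auto cong: continuous_on_cong)
  then show ?thesis
    using assms(4) Suc has_dderiv_cong[OF assms(1,2) _ _ assms(3)] by fastforce
qed

lemma Ck_on_continuous: "Ck_on k S V f \<Longrightarrow> continuous_on V f"
  by (cases k) auto

lemma Ck_on_subset: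
  "Ck_on k S V f \<Longrightarrow> V' \<subseteq> V \<Longrightarrow> S' \<subseteq> S \<Longrightarrow> Ck_on k S' V' f"
proof (induction k arbitrary: f)
  case 0
  then show ?case by (auto intro: continuous_on_subset)
next
  case (Suc k)
  then show ?case by simp (meson continuous_on_subset subsetD)
qed

lemma Ck_on_pred: "Ck_on (Suc k) S V f \<Longrightarrow> Ck_on k S V f"
proof (induction k arbitrary: f)
  case (Suc k)
  have "continuous_on V f" using Suc.prems by simp
  moreover have "\<exists>g. Ck_on k S V g \<and> (\<forall>x\<in>V. ((\<lambda>t::real. f (x + t *\<^sub>R v)) has_vector_derivative g x) (at 0))"
    if "v \<in> S" for v
    using Suc.prems that Suc.IH unfolding Ck_on.simps(2)[of "Suc k"] by blast
  ultimately show ?case unfolding Ck_on.simps(2)[of k] by blast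
qed simp

text \<open>
  A directional derivative is unique, so the witness in the definition of \<^const>\<open>Ck_on\<close> can be
  replaced by \<^const>\<open>dderiv\<close>. Openness of \<open>V\<close> in \<open>S\<close> makes the derivative at a point of \<open>V\<close>
  depend on the values on \<open>V\<close> only.
\<close>
lemma Ck_on_SucD:
  fixes S :: "'m::real_normed_vector set"
  assumes "subspace S" "openin (top_of_set S) V" "Ck_on (Suc k) S V f" "v \<in> S"
  shows "Ck_on k S V (dderiv f v)"
    and "x \<in> V \<Longrightarrow> ((\<lambda>t::real. f (x + t *\<^sub>R v)) has_vector_derivative dderiv f v x) (at 0)"
proof -
  obtain g where g: "Ck_on k S V g"
    "\<And>x. x \<in> V \<Longrightarrow> ((\<lambda>t::real. f (x + t *\<^sub>R v)) has_vector_derivative g x) (at 0)"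
    using assms by auto
  have eq: "g x = dderiv f v x" if "x \<in> V" for x
    using dderiv_eq[OF g(2)[OF that]] by simp
  show "Ck_on k S V (dderiv f v)"
    using Ck_on_cong[OF assms(1,2) eq g(1)] by simp
  show "((\<lambda>t::real. f (x + t *\<^sub>R v)) has_vector_derivative dderiv f v x) (at 0)" if "x \<in> V"
    using g(2)[OF that] eq[OF that] by simp
qed

lemma Ck_on_SucI:
  assumes "continuous_on V f"
    and "\<And>v. v \<in> S \<Longrightarrow> Ck_on k S V (g v)"
    and "\<And>v x. v \<in> S \<Longrightarrow> x \<in> V \<Longrightarrow> ((\<lambda>t::real. f (x + t *\<^sub>R v)) has_vector_derivative g v x) (at 0)"
  shows "Ck_on (Suc k) S V f"
  using assms by auto

text \<open>
  Local witnesses agree where they overlap, because derivatives are unique; they glue to a global one.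
\<close>
lemma Ck_on_local:
  fixes S :: "'m::real_normed_vector set"
  assumes "subspace S"
    and "\<And>x. x \<in> V \<Longrightarrow> \<exists>U. openin (top_of_set S) U \<and> x \<in> U \<and> U \<subseteq> V \<and> Ck_on k S U f"
  shows "Ck_on k S V f"
  using assms(2)
proof (induction k arbitrary: f)
  case (0 f)
  have VS: "V \<subseteq> S"
  proof
    fix x assume "x \<in> V"
    then obtain U where "openin (top_of_set S) U" "x \<in> U" using 0 by meson
    then show "x \<in> S" using openin_imp_subset by blast
  qed
  have "continuous (at x within V) f" if "x \<in> V" for x
  proof -
    obtain U where U: "openin (top_of_set S) U" "x \<in> U" "U \<subseteq> V" "continuous_on U f"
      using 0[OF \<open>x \<in> V\<close>] by auto
    obtain T where T: "open T" "U = S \<inter> T" using U by (auto simp: openin_open)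
    have "at x within V = at x within U"
      by (rule at_within_nhd[of x T]) (use T U VS in auto)
    then show ?thesis
      using U(2,4) by (simp add: continuous_on_eq_continuous_within)
  qed
  then show ?case by (simp add: continuous_on_eq_continuous_within)
next
  case (Suc k f)
  have 1: "continuous_on V f"
  proof -
    have "Ck_on k S V f"
    proof (rule Suc.IH)
      fix x assume "x \<in> V"
      then obtain U where "openin (top_of_set S) U" "x \<in> U" "U \<subseteq> V" "Ck_on (Suc k) S U f"
        using Suc.prems by blast
      then show "\<exists>U. openin (top_of_set S) U \<and> x \<in> U \<and> U \<subseteq> V \<and> Ck_on k S U f"
        using Ck_on_pred[of k S U f] by blast
    qed
    then show ?thesis by (rule Ck_on_continuous)
  qed
  show ?case
  proof (rule Ck_on_SucI[OF 1, of _ _ "dderiv f"])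
    fix v assume v: "v \<in> S"
    show "Ck_on k S V (dderiv f v)"
    proof (rule Suc.IH)
      fix x assume "x \<in> V"
      then obtain U where "openin (top_of_set S) U" "x \<in> U" "U \<subseteq> V" "Ck_on (Suc k) S U f"
        using Suc.prems by blast
      then show "\<exists>U. openin (top_of_set S) U \<and> x \<in> U \<and> U \<subseteq> V \<and> Ck_on k S U (dderiv f v)"
        using Ck_on_SucD(1)[OF assms(1) _ _ v] by blast
    qed
    fix x assume "x \<in> V"
    then obtain U where "openin (top_of_set S) U" "x \<in> U" "U \<subseteq> V" "Ck_on (Suc k) S U f"
      using Suc.prems by blast
    then show "((\<lambda>t::real. f (x + t *\<^sub>R v)) has_vector_derivative dderiv f v x) (at 0)"
      using Ck_on_SucD(2)[OF assms(1) _ _ v] by blast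
  qed
qed

lemma Ck_on_const: "Ck_on k S V (\<lambda>x. c)"
proof (induction k arbitrary: c)
  case (Suc k)
  show ?case
    by (rule Ck_on_SucI[where g = "\<lambda>v x. 0"]) (auto intro: Suc)
qed simp

lemma Ck_on_bounded_linear:
  assumes "bounded_linear L"
  shows "Ck_on k S V L"
proof (cases k)
  case 0
  then show ?thesis using assms by (simp add: linear_continuous_on)
next
  case (Suc j)
  interpret bounded_linear L by fact
  show ?thesis unfolding Suc
  proof (rule Ck_on_SucI[where g = "\<lambda>v x. L v"])
    show "continuous_on V L" using assms by (simp add: linear_continuous_on)
    show "((\<lambda>t. L (x + t *\<^sub>R v)) has_vector_derivative L v) (at 0)" for x v
      unfolding add scaleR by (auto intro!: derivative_eq_intros)
  qed (rule Ck_on_const)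
qed

lemma Ck_on_linear_outer:
  assumes "bounded_linear L" "Ck_on k S V f"
  shows "Ck_on k S V (\<lambda>x. L (f x))"
  using assms(2)
proof (induction k arbitrary: f)
  case 0
  then show ?case using bounded_linear.continuous_on[OF assms(1)] by auto
next
  case (Suc k)
  show ?case unfolding Ck_on.simps
  proof (intro conjI ballI)
    show "continuous_on V (\<lambda>x. L (f x))"
      using bounded_linear.continuous_on[OF assms(1) Ck_on_continuous[OF Suc.prems]] .
    fix v assume "v \<in> S"
    then obtain g where "Ck_on k S V g"
        "\<forall>x\<in>V. ((\<lambda>t::real. f (x + t *\<^sub>R v)) has_vector_derivative g x) (at 0)"
      using Suc.prems by auto
    then show "\<exists>h. Ck_on k S V h \<and> (\<forall>x\<in>V. ((\<lambda>t::real. L (f (x + t *\<^sub>R v))) has_vector_derivative h x) (at 0))"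
      using Suc.IH bounded_linear.has_vector_derivative[OF assms(1)] by (intro exI[of _ "\<lambda>x. L (g x)"]) simp
  qed
qed

lemma Ck_on_linear_inner:
  assumes L: "linear L" "continuous_on V0 L" "L ` S0 \<subseteq> S" "L ` V0 \<subseteq> V" "Ck_on k S V f"
  shows "Ck_on k S0 V0 (\<lambda>x. f (L x))"
  using assms(5)
proof (induction k arbitrary: f)
  case 0
  then show ?case using L continuous_on_compose2[of V f V0 L] by auto
next
  case (Suc k)
  show ?case unfolding Ck_on.simps
  proof (intro conjI ballI)
    show "continuous_on V0 (\<lambda>x. f (L x))"
      using Suc.prems L continuous_on_compose2[of V f V0 L] by auto
    fix v assume "v \<in> S0"
    then have "L v \<in> S" using L by auto
    then obtain g where g: "Ck_on k S V g"
        "\<forall>x\<in>V. ((\<lambda>t::real. f (x + t *\<^sub>R L v)) has_vector_derivative g x) (at 0)"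
      using Suc.prems by auto
    have "\<forall>x\<in>V0. ((\<lambda>t::real. f (L (x + t *\<^sub>R v))) has_vector_derivative g (L x)) (at 0)"
      using g(2) L by (auto simp: linear_add linear_scale)
    then show "\<exists>g. Ck_on k S0 V0 g \<and> (\<forall>x\<in>V0. ((\<lambda>t::real. f (L (x + t *\<^sub>R v))) has_vector_derivative g x) (at 0))"
      using Suc.IH[OF g(1)] by blast
  qed
qed

lemma Ck_on_add:
  "Ck_on k S V f \<Longrightarrow> Ck_on k S V g \<Longrightarrow> Ck_on k S V (\<lambda>x. f x + g x)"
proof (induction k arbitrary: f g)
  case 0
  then show ?case by (auto intro: continuous_intros)
next
  case (Suc k)
  show ?case unfolding Ck_on.simps
  proof (intro conjI ballI)
    show "continuous_on V (\<lambda>x. f x + g x)"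
      using Suc.prems by (auto intro: continuous_intros)
    fix v assume "v \<in> S"
    then obtain a b where "Ck_on k S V a" "Ck_on k S V b"
        "\<forall>x\<in>V. ((\<lambda>t::real. f (x + t *\<^sub>R v)) has_vector_derivative a x) (at 0)"
        "\<forall>x\<in>V. ((\<lambda>t::real. g (x + t *\<^sub>R v)) has_vector_derivative b x) (at 0)"
      using Suc.prems unfolding Ck_on.simps by metis
    then show "\<exists>h. Ck_on k S V h \<and> (\<forall>x\<in>V. ((\<lambda>t::real. f (x + t *\<^sub>R v) + g (x + t *\<^sub>R v)) has_vector_derivative h x) (at 0))"
      using Suc.IH by (intro exI[of _ "\<lambda>x. a x + b x"]) (auto intro: has_vector_derivative_add)
  qed
qed

lemma Ck_on_minus: "Ck_on k S V f \<Longrightarrow> Ck_on k S V (\<lambda>x. - f x)"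
  by (rule Ck_on_linear_outer) (rule bounded_linear_minus[OF bounded_linear_ident])

lemma Ck_on_sum:
  "(\<And>i. i \<in> I \<Longrightarrow> Ck_on k S V (f i)) \<Longrightarrow> Ck_on k S V (\<lambda>x. \<Sum>i\<in>I. f i x)"
  by (induction I rule: infinite_finite_induct) (auto intro: Ck_on_const Ck_on_add)

lemma Ck_on_bilinear:
  assumes "bounded_bilinear B"
  shows "Ck_on k S V f \<Longrightarrow> Ck_on k S V g \<Longrightarrow> Ck_on k S V (\<lambda>x. B (f x) (g x))"
proof (induction k arbitrary: f g)
  case 0
  then show ?case using bounded_bilinear.continuous_on[OF assms] by auto
next
  case (Suc k)
  show ?case unfolding Ck_on.simps
  proof (intro conjI ballI)
    show "continuous_on V (\<lambda>x. B (f x) (g x))"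
      using Suc.prems bounded_bilinear.continuous_on[OF assms] by auto
    fix v assume "v \<in> S"
    then obtain a b where ab: "Ck_on k S V a" "Ck_on k S V b"
        "\<forall>x\<in>V. ((\<lambda>t::real. f (x + t *\<^sub>R v)) has_vector_derivative a x) (at 0)"
        "\<forall>x\<in>V. ((\<lambda>t::real. g (x + t *\<^sub>R v)) has_vector_derivative b x) (at 0)"
      using Suc.prems unfolding Ck_on.simps by metis
    have fg: "Ck_on k S V f" "Ck_on k S V g" using Suc.prems Ck_on_pred by auto
    have "((\<lambda>t::real. B (f (x + t *\<^sub>R v)) (g (x + t *\<^sub>R v))) has_vector_derivative
          (B (f x) (b x) + B (a x) (g x))) (at 0)" if "x \<in> V" for x
      using bounded_bilinear.has_vector_derivative[OF assms ab(3)[rule_format, OF that] ab(4)[rule_format, OF that]]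
      by simp
    then show "\<exists>h. Ck_on k S V h \<and> (\<forall>x\<in>V. ((\<lambda>t::real. B (f (x + t *\<^sub>R v)) (g (x + t *\<^sub>R v))) has_vector_derivative h x) (at 0))"
      using Suc.IH ab(1,2) fg
      by (intro exI[of _ "\<lambda>x. B (f x) (b x) + B (a x) (g x)"]) (auto intro: Ck_on_add)
  qed
qed

lemmas Ck_on_scaleR = Ck_on_bilinear[OF bounded_bilinear_scaleR]
lemmas Ck_on_mult = Ck_on_bilinear[OF bounded_bilinear_mult]

lemma Ck_on_prod:
  fixes f :: "'i \<Rightarrow> 'm::real_normed_vector \<Rightarrow> real"
  shows "(\<And>i. i \<in> I \<Longrightarrow> Ck_on k S V (f i)) \<Longrightarrow> Ck_on k S V (\<lambda>x. \<Prod>i\<in>I. f i x)"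
  by (induction I rule: infinite_finite_induct) (auto intro: Ck_on_const Ck_on_mult)

lemma Ck_on_inverse:
  fixes f :: "'m::real_normed_vector \<Rightarrow> real"
  assumes "Ck_on k S V f" "\<And>x. x \<in> V \<Longrightarrow> f x \<noteq> 0"
  shows "Ck_on k S V (\<lambda>x. inverse (f x))"
  using assms(1)
proof (induction k)
  case 0
  then show ?case using assms by (auto intro: continuous_intros)
next
  case (Suc k)
  show ?case unfolding Ck_on.simps
  proof (intro conjI ballI)
    show "continuous_on V (\<lambda>x. inverse (f x))"
      using Suc.prems assms by (auto intro: continuous_intros)
    fix v assume "v \<in> S"
    then obtain a where a: "Ck_on k S V a"
        "\<And>x. x \<in> V \<Longrightarrow> ((\<lambda>t::real. f (x + t *\<^sub>R v)) has_vector_derivative a x) (at 0)"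
      using Suc.prems unfolding Ck_on.simps by metis
    have "((\<lambda>t::real. inverse (f (x + t *\<^sub>R v))) has_vector_derivative
          (- (inverse (f x) * (a x * inverse (f x))))) (at 0)" if "x \<in> V" for x
      using DERIV_inverse'[OF a(2)[OF that, folded has_real_derivative_iff_has_vector_derivative]] assms(2)[OF that]
      by (simp add: has_real_derivative_iff_has_vector_derivative[symmetric] ac_simps)
    moreover have "Ck_on k S V (\<lambda>x. - (inverse (f x) * (a x * inverse (f x))))"
      using Suc.IH[OF Ck_on_pred[OF Suc.prems]] a(1) by (intro Ck_on_minus Ck_on_mult)
    ultimately show "\<exists>h. Ck_on k S V h \<and> (\<forall>x\<in>V. ((\<lambda>t::real. inverse (f (x + t *\<^sub>R v))) has_vector_derivative h x) (at 0))"
      by blast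
  qed
qed

lemma Ck_on_det:
  fixes A :: "'m::real_normed_vector \<Rightarrow> real^'n^'n"
  assumes "\<And>i j. Ck_on k S V (\<lambda>x. A x $ i $ j)"
  shows "Ck_on k S V (\<lambda>x. det (A x))"
  unfolding det_def by (intro Ck_on_sum Ck_on_mult Ck_on_const Ck_on_prod assms)

text \<open>
  By Cramer's rule the solution of a regular linear system is a quotient of determinants, that is, of
  polynomials in the entries of the matrix. The derivative of an inverse map is such a solution.
\<close>
lemma Ck_on_linear_system:
  fixes A :: "'m::real_normed_vector \<Rightarrow> real^'n^'n"
  assumes A: "\<And>i j. Ck_on k S V (\<lambda>x. A x $ i $ j)"
    and det: "\<And>x. x \<in> V \<Longrightarrow> det (A x) \<noteq> 0"
    and S: "subspace S" "openin (top_of_set S) V"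
    and u: "\<And>x. x \<in> V \<Longrightarrow> A x *v u x = b"
  shows "Ck_on k S V u"
proof -
  define w where "w x = (\<Sum>j\<in>UNIV. (det (\<chi> i l. if l = j then b$i else A x $i$l) * inverse (det (A x))) *\<^sub>R axis j (1::real))" for x
  have "Ck_on k S V w"
    unfolding w_def
  proof (intro Ck_on_sum Ck_on_scaleR Ck_on_const Ck_on_mult Ck_on_inverse Ck_on_det A det)
    fix j i l show "Ck_on k S V (\<lambda>x. (\<chi> i l. if l = j then b$i else A x $i$l) $ i $ l)"
      by (cases "l = j") (simp_all add: Ck_on_const A)
  qed
  moreover have "w x = u x" if "x \<in> V" for x
  proof -
    have "u x = (\<chi> j. det(\<chi> i l. if l = j then b$i else A x $i$l) / det (A x))"
      using cramer[OF det[OF that], of "u x" b] u[OF that] by blast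
    then show ?thesis
      unfolding w_def by (simp add: vec_eq_iff axis_def divide_inverse if_distrib cong: if_cong)
  qed
  ultimately show ?thesis
    using Ck_on_cong[OF S] by blast
qed

section \<open>The chain rule and the symmetry of second derivatives\<close>

lemma line_derivative_shift:
  fixes v z :: "'a::real_normed_vector"
  assumes "((\<lambda>t::real. f (z + s *\<^sub>R v + t *\<^sub>R v)) has_vector_derivative d) (at 0)"
  shows "((\<lambda>t. f (z + t *\<^sub>R v)) has_vector_derivative d) (at s)"
proof -
  have "((\<lambda>t. t - s) has_vector_derivative 1) (at s)"
    by (auto intro!: derivative_eq_intros)
  from vector_diff_chain_at[OF this, of "\<lambda>t. f (z + s *\<^sub>R v + t *\<^sub>R v)" d] assms
  have *: "((\<lambda>t. f (z + s *\<^sub>R v + t *\<^sub>R v)) \<circ> (\<lambda>t. t - s) has_vector_derivative d) (at s)"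
    by simp
  have "(\<lambda>t. f (z + s *\<^sub>R v + t *\<^sub>R v)) \<circ> (\<lambda>t. t - s) = (\<lambda>t. f (z + t *\<^sub>R v))"
  proof
    fix t
    have "z + s *\<^sub>R v + (t - s) *\<^sub>R v = z + t *\<^sub>R v"
      by (simp add: scaleR_left_diff_distrib)
    then show "((\<lambda>t. f (z + s *\<^sub>R v + t *\<^sub>R v)) \<circ> (\<lambda>t. t - s)) t = f (z + t *\<^sub>R v)"
      by (simp only: o_apply)
  qed
  with * show ?thesis by simp
qed

text \<open>
  Continuous directional derivatives give a total derivative: an increment is split into increments
  along the basis vectors, and the mean value inequality controls each of them.
\<close>
lemma C1_has_derivative_sum:
  fixes f :: "'a::euclidean_space \<Rightarrow> 'b::real_normed_vector"
  assumes "open U" "x \<in> U" "Ck_on (Suc 0) UNIV U f"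
  shows "(f has_derivative (\<lambda>h. \<Sum>b\<in>Basis. (h \<bullet> b) *\<^sub>R dderiv f b x)) (at x)"
  unfolding has_derivative_at_alt
proof (intro conjI allI impI)
  show "bounded_linear (\<lambda>h. \<Sum>b\<in>Basis. (h \<bullet> b) *\<^sub>R dderiv f b x)"
    by (intro bounded_linear_sum bounded_linear_scaleR_const bounded_linear_inner_left)
  fix e :: real assume e: "e > 0"
  have U: "openin (top_of_set UNIV) U" using assms by simp
  note d = Ck_on_SucD[OF subspace_UNIV U assms(3) UNIV_I]
  define m where "m = real DIM('a)"
  have m: "m > 0" by (simp add: m_def)
  have "\<forall>\<^sub>F y in nhds x. y \<in> U \<and> (\<forall>b\<in>Basis. dist (dderiv f b y) (dderiv f b x) < e / m)"
  proof (intro eventually_conj eventually_ball_finite ballI)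
    show "\<forall>\<^sub>F y in nhds x. y \<in> U" using assms by (simp add: eventually_nhds_in_open)
    fix b :: 'a
    have "continuous_on U (dderiv f b)" using d(1)[of b] by simp
    then have "(dderiv f b \<longlongrightarrow> dderiv f b x) (nhds x)"
      using assms by (simp add: continuous_on_eq_continuous_at isCont_def tendsto_at_iff_tendsto_nhds)
    then show "\<forall>\<^sub>F y in nhds x. dist (dderiv f b y) (dderiv f b x) < e / m"
      using e m by (auto simp: tendsto_iff)
  qed auto
  then obtain \<delta> where \<delta>: "\<delta> > 0" "\<And>y. dist y x < \<delta> \<Longrightarrow> y \<in> U"
      "\<And>y b. dist y x < \<delta> \<Longrightarrow> b \<in> Basis \<Longrightarrow> norm (dderiv f b y - dderiv f b x) < e / m"
    unfolding eventually_nhds_metric dist_norm by blast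
  show "\<exists>da>0. \<forall>y. norm (y - x) < da \<longrightarrow>
     norm (f y - f x - (\<Sum>b\<in>Basis. ((y - x) \<bullet> b) *\<^sub>R dderiv f b x)) \<le> e * norm (y - x)"
  proof (intro exI[of _ "\<delta> / m"] conjI allI impI)
    show "\<delta> / m > 0" using \<delta> m by simp
    fix y assume y: "norm (y - x) < \<delta> / m"
    define h where "h = y - x"
    have sum_small: "(\<Sum>b\<in>B. \<bar>h \<bullet> b\<bar>) \<le> m * norm h" if "B \<subseteq> Basis" for B
    proof -
      have "(\<Sum>b\<in>B. \<bar>h \<bullet> b\<bar>) \<le> (\<Sum>b\<in>Basis. \<bar>h \<bullet> b\<bar>)"
        using that by (intro sum_mono2) auto
      also have "\<dots> \<le> (\<Sum>b\<in>(Basis::'a set). norm h)"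
        by (intro sum_mono Basis_le_norm)
      finally show ?thesis by (simp add: m_def)
    qed
    have mh: "m * norm h < \<delta>" using y m by (simp add: h_def field_simps)
    \<comment> \<open>the coordinates of the increment are switched on one after the other\<close>
    have main: "norm (f (x + (\<Sum>b\<in>B. (h \<bullet> b) *\<^sub>R b)) - f x - (\<Sum>b\<in>B. (h \<bullet> b) *\<^sub>R dderiv f b x))
        \<le> e / m * (\<Sum>b\<in>B. \<bar>h \<bullet> b\<bar>)" if "finite B" "B \<subseteq> Basis" for B
      using that
    proof (induction B rule: finite_induct)
      case (insert b B)
      define z where "z = x + (\<Sum>b\<in>B. (h \<bullet> b) *\<^sub>R b)"
      define \<phi> where "\<phi> s = f (z + s *\<^sub>R b) - s *\<^sub>R dderiv f b x" for s :: real
      have near: "dist (z + s *\<^sub>R b) x < \<delta>" if "s \<in> closed_segment 0 (h \<bullet> b)" for s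
      proof -
        have "\<bar>s\<bar> \<le> \<bar>h \<bullet> b\<bar>" using that by (auto simp: closed_segment_eq_real_ivl split: if_splits)
        moreover have "norm (\<Sum>b\<in>B. (h \<bullet> b) *\<^sub>R b) \<le> (\<Sum>b\<in>B. \<bar>h \<bullet> b\<bar>)"
          using insert.prems by (intro sum_norm_le) auto
        moreover have "norm b = 1" using insert.prems by auto
        moreover have "norm ((\<Sum>b\<in>B. (h \<bullet> b) *\<^sub>R b) + s *\<^sub>R b) \<le> norm (\<Sum>b\<in>B. (h \<bullet> b) *\<^sub>R b) + \<bar>s\<bar> * norm b"
          by (metis norm_scaleR norm_triangle_ineq)
        ultimately have "norm ((\<Sum>b\<in>B. (h \<bullet> b) *\<^sub>R b) + s *\<^sub>R b) \<le> (\<Sum>b\<in>insert b B. \<bar>h \<bullet> b\<bar>)"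
          using insert by simp
        then show ?thesis
          using sum_small[OF insert.prems] mh by (simp add: z_def dist_norm)
      qed
      have "norm (\<phi> (h \<bullet> b) - \<phi> 0) \<le> e / m * norm (h \<bullet> b - 0)"
      proof (rule differentiable_bound[of "closed_segment 0 (h \<bullet> b)"])
        fix s assume s: "s \<in> closed_segment 0 (h \<bullet> b)"
        have "((\<lambda>t. f (z + t *\<^sub>R b)) has_vector_derivative dderiv f b (z + s *\<^sub>R b)) (at s)"
          by (rule line_derivative_shift) (rule d(2)[OF \<delta>(2)[OF near[OF s]]])
        then have "(\<phi> has_vector_derivative (dderiv f b (z + s *\<^sub>R b) - dderiv f b x)) (at s)"
          unfolding \<phi>_def by (auto intro!: derivative_eq_intros)
        then show "(\<phi> has_derivative (\<lambda>t. t *\<^sub>R (dderiv f b (z + s *\<^sub>R b) - dderiv f b x))) (at s within closed_segment 0 (h \<bullet> b))"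
          unfolding has_vector_derivative_def by (rule has_derivative_at_withinI)
        show "onorm (\<lambda>t::real. t *\<^sub>R (dderiv f b (z + s *\<^sub>R b) - dderiv f b x)) \<le> e / m"
        proof (rule onorm_le)
          fix t :: real
          have "norm (dderiv f b (z + s *\<^sub>R b) - dderiv f b x) \<le> e / m"
            using \<delta>(3)[OF near[OF s], of b] insert.prems by simp
          from mult_left_mono[OF this, of "\<bar>t\<bar>"]
          show "norm (t *\<^sub>R (dderiv f b (z + s *\<^sub>R b) - dderiv f b x)) \<le> e / m * norm t"
            by (simp add: mult.commute)
        qed
      qed auto
      then have "norm (f (z + (h \<bullet> b) *\<^sub>R b) - f z - (h \<bullet> b) *\<^sub>R dderiv f b x) \<le> e / m * \<bar>h \<bullet> b\<bar>"
        by (simp add: \<phi>_def algebra_simps)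
      moreover have "norm (f z - f x - (\<Sum>b\<in>B. (h \<bullet> b) *\<^sub>R dderiv f b x)) \<le> e / m * (\<Sum>b\<in>B. \<bar>h \<bullet> b\<bar>)"
        using insert by (simp add: z_def)
      ultimately have "norm ((f (z + (h \<bullet> b) *\<^sub>R b) - f z - (h \<bullet> b) *\<^sub>R dderiv f b x)
            + (f z - f x - (\<Sum>b\<in>B. (h \<bullet> b) *\<^sub>R dderiv f b x)))
          \<le> e / m * \<bar>h \<bullet> b\<bar> + e / m * (\<Sum>b\<in>B. \<bar>h \<bullet> b\<bar>)"
        by (rule norm_triangle_mono)
      then show ?case using insert.hyps by (simp add: z_def algebra_simps)
    qed simp
    have "norm (f (x + h) - f x - (\<Sum>b\<in>Basis. (h \<bullet> b) *\<^sub>R dderiv f b x)) \<le> e / m * (\<Sum>b\<in>Basis. \<bar>h \<bullet> b\<bar>)"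
      using main[of Basis] by (simp add: euclidean_representation)
    also have "\<dots> \<le> e / m * (m * norm h)"
      using sum_small[of Basis] e m by (intro mult_left_mono) auto
    finally show "norm (f y - f x - (\<Sum>b\<in>Basis. ((y - x) \<bullet> b) *\<^sub>R dderiv f b x)) \<le> e * norm (y - x)"
      using m by (simp add: h_def)
  qed
qed

lemma dderiv_eq_derivative:
  assumes "(f has_derivative f') (at x)"
  shows "dderiv f v x = f' v"
proof (rule dderiv_eq)
  have "((\<lambda>t::real. x + t *\<^sub>R v) has_vector_derivative v) (at 0)"
    by (auto intro!: derivative_eq_intros)
  from vector_derivative_diff_chain_within[OF this, of f f'] assms
  show "((\<lambda>t. f (x + t *\<^sub>R v)) has_vector_derivative f' v) (at 0)"
    by (auto simp: o_def intro: has_derivative_at_withinI)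
qed

lemma C1_has_derivative:
  fixes f :: "'a::euclidean_space \<Rightarrow> 'b::real_normed_vector"
  assumes "open U" "x \<in> U" "Ck_on (Suc 0) UNIV U f"
  shows "(f has_derivative (\<lambda>h. dderiv f h x)) (at x)"
proof -
  have "(\<lambda>h. \<Sum>b\<in>Basis. (h \<bullet> b) *\<^sub>R dderiv f b x) = (\<lambda>h. dderiv f h x)"
    by (rule ext) (rule dderiv_eq_derivative[OF C1_has_derivative_sum[OF assms], symmetric])
  with C1_has_derivative_sum[OF assms] show ?thesis by (rule back_subst[where P = "\<lambda>D. (f has_derivative D) (at x)"])
qed

lemma C1_dderiv_sum:
  fixes f :: "'a::euclidean_space \<Rightarrow> 'b::real_normed_vector"
  assumes "open U" "x \<in> U" "Ck_on (Suc 0) UNIV U f"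
  shows "dderiv f h x = (\<Sum>b\<in>Basis. (h \<bullet> b) *\<^sub>R dderiv f b x)"
  by (rule dderiv_eq_derivative[OF C1_has_derivative_sum[OF assms]])

lemma Ck_on_mono: "j \<le> k \<Longrightarrow> Ck_on k S V f \<Longrightarrow> Ck_on j S V f"
proof (induction k)
  case (Suc k)
  then show ?case
    using Ck_on_pred[of k S V f] by (cases "j = Suc k") (auto simp: le_Suc_eq simp del: Ck_on.simps)
qed simp

lemma has_line_derivative_compose:
  fixes f :: "'a::euclidean_space \<Rightarrow> 'b::real_normed_vector" and x v :: "'m::real_normed_vector"
  assumes "open U" "g x \<in> U" "Ck_on (Suc 0) UNIV U f"
    and "((\<lambda>t::real. g (x + t *\<^sub>R v)) has_vector_derivative d) (at 0)"
  shows "((\<lambda>t::real. f (g (x + t *\<^sub>R v))) has_vector_derivative dderiv f d (g x)) (at 0)"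
proof -
  have "(f has_derivative (\<lambda>h. dderiv f h (g x))) (at (g (x + 0 *\<^sub>R v)) within range (\<lambda>t. g (x + t *\<^sub>R v)))"
    using has_derivative_at_withinI[OF C1_has_derivative[OF assms(1-3)]] by simp
  from vector_derivative_diff_chain_within[OF assms(4) this] show ?thesis
    by (simp add: o_def)
qed

text \<open>
  The derivative of the composition is a sum of products of derivatives of \<open>g\<close> with derivatives of
  \<open>f\<close> composed with \<open>g\<close>, to which the induction hypothesis for the smaller order applies.
\<close>
lemma Ck_on_compose:
  fixes f :: "'a::euclidean_space \<Rightarrow> 'b::real_normed_vector" and S :: "'m::real_normed_vector set"
  assumes S: "subspace S" "openin (top_of_set S) V" and U: "open U" and gV: "g ` V \<subseteq> U"
  shows "Ck_on k UNIV U f \<Longrightarrow> Ck_on k S V g \<Longrightarrow> Ck_on k S V (\<lambda>x. f (g x))"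
proof (induction k arbitrary: f)
  case 0
  then show ?case using gV continuous_on_compose2[of U f V g] by simp
next
  case (Suc k)
  have f1: "Ck_on (Suc 0) UNIV U f" by (rule Ck_on_mono[OF _ Suc.prems(1)]) simp
  have UU: "openin (top_of_set UNIV) U" using U by simp
  show ?case
  proof (rule Ck_on_SucI[where g = "\<lambda>v x. \<Sum>b\<in>Basis. (dderiv g v x \<bullet> b) *\<^sub>R dderiv f b (g x)"])
    show "continuous_on V (\<lambda>x. f (g x))"
      using continuous_on_compose2[OF Ck_on_continuous[OF Suc.prems(1)] Ck_on_continuous[OF Suc.prems(2)] gV] .
    fix v assume v: "v \<in> S"
    show "Ck_on k S V (\<lambda>x. \<Sum>b\<in>Basis. (dderiv g v x \<bullet> b) *\<^sub>R dderiv f b (g x))"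
    proof (intro Ck_on_sum Ck_on_scaleR)
      fix b :: 'a assume "b \<in> Basis"
      show "Ck_on k S V (\<lambda>x. dderiv g v x \<bullet> b)"
        by (rule Ck_on_linear_outer[OF bounded_linear_inner_left Ck_on_SucD(1)[OF S Suc.prems(2) v]])
      show "Ck_on k S V (\<lambda>x. dderiv f b (g x))"
        by (rule Suc.IH[OF Ck_on_SucD(1)[OF subspace_UNIV UU Suc.prems(1) UNIV_I] Ck_on_pred[OF Suc.prems(2)]])
    qed
    fix x assume x: "x \<in> V"
    then have gx: "g x \<in> U" using gV by auto
    show "((\<lambda>t. f (g (x + t *\<^sub>R v))) has_vector_derivative
            (\<Sum>b\<in>Basis. (dderiv g v x \<bullet> b) *\<^sub>R dderiv f b (g x))) (at 0)"
      using has_line_derivative_compose[OF U gx f1 Ck_on_SucD(2)[OF S Suc.prems(2) v x]]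
      unfolding C1_dderiv_sum[OF U gx f1, of "dderiv g v x"] .
  qed
qed

lemma smooth_on_cong:
  fixes S :: "'m::real_normed_vector set"
  assumes "subspace S" "openin (top_of_set S) V" "\<And>y. y \<in> V \<Longrightarrow> f y = g y" "smooth_on S V f"
  shows "smooth_on S V g"
  using assms(4) Ck_on_cong[OF assms(1,2), of f g] assms(3) unfolding smooth_on_def by blast

lemma smooth_on_continuous: "smooth_on S V f \<Longrightarrow> continuous_on V f"
  unfolding smooth_on_def using Ck_on_continuous[of 0 S V f] by blast

lemma smooth_on_subset: "smooth_on S V f \<Longrightarrow> V' \<subseteq> V \<Longrightarrow> S' \<subseteq> S \<Longrightarrow> smooth_on S' V' f"
  unfolding smooth_on_def using Ck_on_subset by blast

lemma smooth_on_local: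
  fixes S :: "'m::real_normed_vector set"
  assumes "subspace S"
    and "\<And>x. x \<in> V \<Longrightarrow> \<exists>U. openin (top_of_set S) U \<and> x \<in> U \<and> U \<subseteq> V \<and> smooth_on S U f"
  shows "smooth_on S V f"
  unfolding smooth_on_def
proof
  fix k show "Ck_on k S V f"
  proof (rule Ck_on_local[OF assms(1)])
    fix x assume "x \<in> V"
    then show "\<exists>U. openin (top_of_set S) U \<and> x \<in> U \<and> U \<subseteq> V \<and> Ck_on k S U f"
      using assms(2)[of x] unfolding smooth_on_def by blast
  qed
qed

lemma smooth_on_bounded_linear: "bounded_linear L \<Longrightarrow> smooth_on S V L"
  unfolding smooth_on_def by (blast intro: Ck_on_bounded_linear)

lemma smooth_on_linear_outer: "bounded_linear L \<Longrightarrow> smooth_on S V f \<Longrightarrow> smooth_on S V (\<lambda>x. L (f x))"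
  unfolding smooth_on_def by (blast intro: Ck_on_linear_outer)

lemma smooth_on_linear_inner:
  assumes "linear L" "continuous_on V0 L" "L ` S0 \<subseteq> S" "L ` V0 \<subseteq> V" "smooth_on S V f"
  shows "smooth_on S0 V0 (\<lambda>x. f (L x))"
  using assms(5) Ck_on_linear_inner[OF assms(1-4)] unfolding smooth_on_def by blast

lemma smooth_on_add: "smooth_on S V f \<Longrightarrow> smooth_on S V g \<Longrightarrow> smooth_on S V (\<lambda>x. f x + g x)"
  unfolding smooth_on_def by (blast intro: Ck_on_add)

lemma smooth_on_Pair:
  assumes "smooth_on S V f" "smooth_on S V g"
  shows "smooth_on S V (\<lambda>x. (f x, g x))"
proof -
  have "smooth_on S V (\<lambda>x. (f x, 0) + (0, g x))"
    by (intro smooth_on_add smooth_on_linear_outer[OF _ assms(1)] smooth_on_linear_outer[OF _ assms(2)])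
      (auto intro!: bounded_linear_Pair bounded_linear_ident bounded_linear_zero)
  then show ?thesis by simp
qed

lemma smooth_on_compose:
  fixes f :: "'a::euclidean_space \<Rightarrow> 'b::real_normed_vector" and S :: "'m::real_normed_vector set"
  assumes "subspace S" "openin (top_of_set S) V" "open U" "g ` V \<subseteq> U"
    and "smooth_on UNIV U f" "smooth_on S V g"
  shows "smooth_on S V (\<lambda>x. f (g x))"
  using assms(5,6) Ck_on_compose[OF assms(1-4)] unfolding smooth_on_def by blast

lemma smooth_on_dderiv:
  fixes S :: "'m::real_normed_vector set"
  assumes "subspace S" "openin (top_of_set S) V" "smooth_on S V f" "v \<in> S"
  shows "smooth_on S V (dderiv f v)"
  using assms Ck_on_SucD(1)[OF assms(1,2)] unfolding smooth_on_def by blast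

lemma smooth_on_has_dderiv:
  fixes S :: "'m::real_normed_vector set"
  assumes "subspace S" "openin (top_of_set S) V" "smooth_on S V f" "v \<in> S" "x \<in> V"
  shows "((\<lambda>t::real. f (x + t *\<^sub>R v)) has_vector_derivative dderiv f v x) (at 0)"
  using assms Ck_on_SucD(2)[OF assms(1,2)] unfolding smooth_on_def by blast

lemma smooth_on_has_derivative:
  fixes f :: "'a::euclidean_space \<Rightarrow> 'b::real_normed_vector"
  assumes "open U" "smooth_on UNIV U f" "x \<in> U"
  shows "(f has_derivative (\<lambda>h. dderiv f h x)) (at x)"
  using assms C1_has_derivative unfolding smooth_on_def by blast

lemma smooth_on_dderiv_linear:
  fixes f :: "'a::euclidean_space \<Rightarrow> 'b::real_normed_vector"
  assumes "open U" "smooth_on UNIV U f" "x \<in> U"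
  shows "linear (\<lambda>h. dderiv f h x)"
  using smooth_on_has_derivative[OF assms] by (rule has_derivative_linear)

text \<open>
  The second difference is symmetric in \<open>v\<close> and \<open>w\<close>, but applying the mean value theorem first in
  one and then in the other direction expresses it by the mixed derivative taken in this order. Comparing
  the two orders for small \<open>s\<close> shows that mixed derivatives commute.
\<close>
lemma second_difference_mean_value:
  fixes f :: "'a::euclidean_space \<Rightarrow> real"
  assumes "open U" "smooth_on UNIV U f" "s > 0"
    and U: "\<And>a b. 0 \<le> a \<Longrightarrow> a \<le> s \<Longrightarrow> 0 \<le> b \<Longrightarrow> b \<le> s \<Longrightarrow> x + a *\<^sub>R v + b *\<^sub>R w \<in> U"
  obtains a b where "0 \<le> a" "a \<le> s" "0 \<le> b" "b \<le> s"
    "f (x + s *\<^sub>R v + s *\<^sub>R w) - f (x + s *\<^sub>R v) - f (x + s *\<^sub>R w) + f x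
      = s * s * dderiv (dderiv f v) w (x + a *\<^sub>R v + b *\<^sub>R w)"
proof -
  have UU: "openin (top_of_set UNIV) U" using assms by simp
  note d = smooth_on_has_dderiv[OF subspace_UNIV UU _ UNIV_I]
  have fv: "smooth_on UNIV U (dderiv f v)"
    by (rule smooth_on_dderiv[OF subspace_UNIV UU assms(2) UNIV_I])
  have D1: "((\<lambda>a. f (x + b *\<^sub>R w + a *\<^sub>R v)) has_vector_derivative dderiv f v (x + b *\<^sub>R w + a *\<^sub>R v)) (at a)"
    if "0 \<le> a" "a \<le> s" "0 \<le> b" "b \<le> s" for a b
    by (rule line_derivative_shift, rule d[OF assms(2)]) (use U[OF that] in \<open>simp add: ac_simps\<close>)
  have D2: "((\<lambda>b. dderiv f v (x + a *\<^sub>R v + b *\<^sub>R w)) has_vector_derivative dderiv (dderiv f v) w (x + a *\<^sub>R v + b *\<^sub>R w)) (at b)"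
    if "0 \<le> a" "a \<le> s" "0 \<le> b" "b \<le> s" for a b
    by (rule line_derivative_shift, rule d[OF fv]) (use U[OF that] in \<open>simp add: ac_simps\<close>)
  define \<phi> where "\<phi> a = f (x + s *\<^sub>R w + a *\<^sub>R v) - f (x + 0 *\<^sub>R w + a *\<^sub>R v)" for a
  have "\<exists>a>0. a < s \<and> \<phi> s - \<phi> 0 = (s - 0) * (dderiv f v (x + s *\<^sub>R w + a *\<^sub>R v) - dderiv f v (x + 0 *\<^sub>R w + a *\<^sub>R v))"
  proof (rule MVT2[OF assms(3)])
    fix a assume "0 \<le> a" "a \<le> s"
    then show "(\<phi> has_real_derivative (dderiv f v (x + s *\<^sub>R w + a *\<^sub>R v) - dderiv f v (x + 0 *\<^sub>R w + a *\<^sub>R v))) (at a)"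
      unfolding \<phi>_def has_real_derivative_iff_has_vector_derivative
      using D1[of a s] D1[of a 0] assms(3) by (intro has_vector_derivative_diff) auto
  qed
  then obtain a where a: "0 < a" "a < s"
    "\<phi> s - \<phi> 0 = s * (dderiv f v (x + a *\<^sub>R v + s *\<^sub>R w) - dderiv f v (x + a *\<^sub>R v + 0 *\<^sub>R w))"
    by (auto simp: ac_simps)
  have "\<exists>b>0. b < s \<and> dderiv f v (x + a *\<^sub>R v + s *\<^sub>R w) - dderiv f v (x + a *\<^sub>R v + 0 *\<^sub>R w)
      = (s - 0) * dderiv (dderiv f v) w (x + a *\<^sub>R v + b *\<^sub>R w)"
    using D2[of a] a by (intro MVT2[OF assms(3)]) (auto simp: has_real_derivative_iff_has_vector_derivative)
  then obtain b where b: "0 < b" "b < s" "dderiv f v (x + a *\<^sub>R v + s *\<^sub>R w) - dderiv f v (x + a *\<^sub>R v + 0 *\<^sub>R w)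
      = s * dderiv (dderiv f v) w (x + a *\<^sub>R v + b *\<^sub>R w)" by auto
  show ?thesis
    by (rule that[of a b]) (use a b in \<open>auto simp: \<phi>_def ac_simps\<close>)
qed

lemma dderiv_commute_real:
  fixes f :: "'a::euclidean_space \<Rightarrow> real"
  assumes "open U" "smooth_on UNIV U f" "x \<in> U"
  shows "dderiv (dderiv f v) w x = dderiv (dderiv f w) v x"
proof -
  have UU: "openin (top_of_set UNIV) U" using assms by simp
  note sm = smooth_on_dderiv[OF subspace_UNIV UU _ UNIV_I]
  have lim: "\<forall>\<^sub>F y in nhds x. dist (g y) (g x) < e"
    if "smooth_on UNIV U g" "e > 0" for g :: "'a \<Rightarrow> real" and e
  proof -
    have "continuous_on U g" using that smooth_on_continuous by blast
    then have "(g \<longlongrightarrow> g x) (nhds x)"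
      using assms by (simp add: continuous_on_eq_continuous_at isCont_def tendsto_at_iff_tendsto_nhds)
    then show ?thesis using that by (auto simp: tendsto_iff)
  qed
  have "\<bar>dderiv (dderiv f v) w x - dderiv (dderiv f w) v x\<bar> < e" if "e > 0" for e
  proof -
    have "\<forall>\<^sub>F y in nhds x. y \<in> U \<and> dist (dderiv (dderiv f v) w y) (dderiv (dderiv f v) w x) < e/2
        \<and> dist (dderiv (dderiv f w) v y) (dderiv (dderiv f w) v x) < e/2"
      using assms that by (intro eventually_conj lim sm) (auto simp: eventually_nhds_in_open)
    then obtain \<delta> where \<delta>: "\<delta> > 0" "\<And>y. dist y x < \<delta> \<Longrightarrow> y \<in> U \<and> dist (dderiv (dderiv f v) w y) (dderiv (dderiv f v) w x) < e/2
        \<and> dist (dderiv (dderiv f w) v y) (dderiv (dderiv f w) v x) < e/2"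
      unfolding eventually_nhds_metric by blast
    define s where "s = \<delta> / (norm v + norm w + 1)"
    have s: "s > 0" unfolding s_def using \<delta>(1)
      by (meson divide_pos_pos add_nonneg_pos add_nonneg_nonneg norm_ge_zero zero_less_one)
    have sb: "s * (norm v + norm w) < \<delta>"
    proof -
      have "norm v + norm w + 1 > 0" by (simp add: add_nonneg_pos)
      then have "s * (norm v + norm w + 1) = \<delta>" by (simp add: s_def)
      then show ?thesis using s by (simp add: algebra_simps)
    qed
    have near: "dist (x + a *\<^sub>R v + b *\<^sub>R w) x < \<delta>" if "0 \<le> a" "a \<le> s" "0 \<le> b" "b \<le> s" for a b
    proof -
      have "norm (a *\<^sub>R v + b *\<^sub>R w) \<le> norm (a *\<^sub>R v) + norm (b *\<^sub>R w)" by (rule norm_triangle_ineq)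
      also have "\<dots> \<le> s * norm v + s * norm w"
        using that by (auto intro!: add_mono mult_right_mono)
      finally show ?thesis using sb by (simp add: dist_norm algebra_simps)
    qed
    obtain a b where ab: "0 \<le> a" "a \<le> s" "0 \<le> b" "b \<le> s"
      "f (x + s *\<^sub>R v + s *\<^sub>R w) - f (x + s *\<^sub>R v) - f (x + s *\<^sub>R w) + f x
      = s * s * dderiv (dderiv f v) w (x + a *\<^sub>R v + b *\<^sub>R w)"
      using second_difference_mean_value[OF assms(1,2) s] near \<delta>(2) by metis
    have near': "dist (x + a *\<^sub>R w + b *\<^sub>R v) x < \<delta>" if "0 \<le> a" "a \<le> s" "0 \<le> b" "b \<le> s" for a b
      using near[OF that(3,4,1,2)] by (simp add: ac_simps)
    obtain c d where cd: "0 \<le> c" "c \<le> s" "0 \<le> d" "d \<le> s"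
      "f (x + s *\<^sub>R w + s *\<^sub>R v) - f (x + s *\<^sub>R w) - f (x + s *\<^sub>R v) + f x
      = s * s * dderiv (dderiv f w) v (x + c *\<^sub>R w + d *\<^sub>R v)"
      using second_difference_mean_value[OF assms(1,2) s, of x w v] near' \<delta>(2) by metis
    have "dderiv (dderiv f v) w (x + a *\<^sub>R v + b *\<^sub>R w) = dderiv (dderiv f w) v (x + c *\<^sub>R w + d *\<^sub>R v)"
    proof -
      have eq: "x + s *\<^sub>R w + s *\<^sub>R v = x + s *\<^sub>R v + s *\<^sub>R w" by (simp add: ac_simps)
      then have "s * s * dderiv (dderiv f v) w (x + a *\<^sub>R v + b *\<^sub>R w) = s * s * dderiv (dderiv f w) v (x + c *\<^sub>R w + d *\<^sub>R v)"
        using ab(5) cd(5) unfolding eq by linarith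
      then show ?thesis using s by simp
    qed
    then show ?thesis
      using \<delta>(2)[OF near[OF ab(1-4)]] \<delta>(2)[OF near'[OF cd(1-4)]] unfolding dist_real_def by linarith
  qed
  then show ?thesis
    by (metis less_irrefl right_minus_eq zero_less_abs_iff)
qed

lemma dderiv_linear_outer:
  fixes S :: "'m::real_normed_vector set"
  assumes "bounded_linear L" "subspace S" "openin (top_of_set S) V" "smooth_on S V f" "v \<in> S" "x \<in> V"
  shows "dderiv (\<lambda>x. L (f x)) v x = L (dderiv f v x)"
  by (rule dderiv_eq) (rule bounded_linear.has_vector_derivative[OF assms(1) smooth_on_has_dderiv[OF assms(2-6)]])

lemma dderiv_commute:
  fixes f :: "'a::euclidean_space \<Rightarrow> 'e::euclidean_space"
  assumes "open U" "smooth_on UNIV U f" "x \<in> U"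
  shows "dderiv (dderiv f v) w x = dderiv (dderiv f w) v x"
proof (rule euclidean_eqI)
  fix b :: 'e
  have UU: "openin (top_of_set UNIV) U" using assms by simp
  have *: "dderiv (dderiv f v) w x \<bullet> b = dderiv (dderiv (\<lambda>x. f x \<bullet> b) v) w x" for v w
  proof -
    have "dderiv (dderiv f v) w x \<bullet> b = dderiv (\<lambda>x. dderiv f v x \<bullet> b) w x"
      by (rule dderiv_linear_outer[OF bounded_linear_inner_left subspace_UNIV UU _ UNIV_I assms(3), symmetric])
        (rule smooth_on_dderiv[OF subspace_UNIV UU assms(2) UNIV_I])
    also have "\<dots> = dderiv (dderiv (\<lambda>x. f x \<bullet> b) v) w x"
      by (rule dderiv_cong[OF subspace_UNIV UU assms(3) UNIV_I])
        (rule dderiv_linear_outer[OF bounded_linear_inner_left subspace_UNIV UU assms(2) UNIV_I, symmetric])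
    finally show ?thesis .
  qed
  show "dderiv (dderiv f v) w x \<bullet> b = dderiv (dderiv f w) v x \<bullet> b"
    unfolding * by (rule dderiv_commute_real[OF assms(1) _ assms(3)])
      (rule smooth_on_linear_outer[OF bounded_linear_inner_left assms(2)])
qed

section \<open>The smooth inverse function theorem\<close>

text \<open>
  The inverse function theorem gives a differentiable inverse \<open>g\<close>. The derivative of \<open>g\<close> solves a linear
  system whose matrix is the derivative of \<open>h\<close> at the values of \<open>g\<close>; so once \<open>g\<close> is of class
  \<open>C\<^sup>k\<close>, its derivative is too, and \<open>g\<close> gains one order of differentiability.
\<close>
lemma smooth_inverse_function:
  fixes h :: "real^'n \<Rightarrow> real^'n"
  assumes V: "open V" "x0 \<in> V" and h: "smooth_on UNIV V h"
    and inj: "inj (\<lambda>v. dderiv h v x0)"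
  obtains V' W g where "open V'" "V' \<subseteq> V" "x0 \<in> V'" "open W" "homeomorphism V' W h g" "smooth_on UNIV W g"
proof -
  have VV: "openin (top_of_set UNIV) V" using V by simp
  define f' where "f' x = Blinfun (\<lambda>v. dderiv h v x)" for x
  have f': "blinfun_apply (f' x) = (\<lambda>v. dderiv h v x)" if "x \<in> V" for x
    unfolding f'_def
    by (rule bounded_linear_Blinfun_apply) (simp add: linear_conv_bounded_linear[symmetric] smooth_on_dderiv_linear[OF V(1) h that])
  have cont: "continuous_on V f'"
  proof (rule continuous_on_blinfun_componentwise)
    fix i :: "real^'n"
    have "continuous_on V (dderiv h i)"
      by (rule smooth_on_continuous[OF smooth_on_dderiv[OF subspace_UNIV VV h UNIV_I]])
    then show "continuous_on V (\<lambda>x. blinfun_apply (f' x) i)"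
      by (rule continuous_on_eq) (simp add: f')
  qed
  obtain L where L: "linear L" "L \<circ> (\<lambda>v. dderiv h v x0) = id"
    using linear_injective_left_inverse[OF smooth_on_dderiv_linear[OF V(1) h V(2)] inj] by blast
  have inv: "Blinfun L o\<^sub>L f' x0 = id_blinfun"
    using L V by (intro blinfun_eqI)
      (simp add: f' bounded_linear_Blinfun_apply linear_conv_bounded_linear[symmetric] o_def fun_eq_iff)
  have der: "(h has_derivative blinfun_apply (f' x)) (at x)" if "x \<in> V" for x
    using smooth_on_has_derivative[OF V(1) h that] f'[OF that] by simp
  obtain V' W g g' where VW: "open V'" "V' \<subseteq> V" "x0 \<in> V'" "open W" "h x0 \<in> W" "homeomorphism V' W h g"
    and g': "\<And>y. y \<in> W \<Longrightarrow> (g has_derivative (g' y)) (at y)"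
    "\<And>y. y \<in> W \<Longrightarrow> g' y = Hilbert_Choice.inv (blinfun_apply (f'(g y)))"
    "\<And>y. y \<in> W \<Longrightarrow> bij (blinfun_apply (f'(g y)))"
    using inverse_function_theorem[OF V(1) der cont V(2) inv] by metis
  have WW: "openin (top_of_set UNIV) W" using VW by simp
  have gW: "g ` W \<subseteq> V" using VW(2,6) by (auto simp: homeomorphism_def)
  define A where "A y = matrix (\<lambda>v. dderiv h v (g y))" for y
  have lin: "linear (\<lambda>v. dderiv h v (g y))" if "y \<in> W" for y
    using smooth_on_dderiv_linear[OF V(1) h] gW that by blast
  have "Ck_on k UNIV W g" for k
  proof (induction k)
    case 0
    then show ?case using VW by (simp add: homeomorphism_def)
  next
    case (Suc k)
    show ?case
    proof (rule Ck_on_SucI[where g = "dderiv g"])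
      show "continuous_on W g" using VW by (simp add: homeomorphism_def)
      fix v
      show "((\<lambda>t. g (y + t *\<^sub>R v)) has_vector_derivative dderiv g v y) (at 0)" if "y \<in> W" for y
      proof -
        have "((\<lambda>t::real. y + t *\<^sub>R v) has_vector_derivative v) (at 0)"
          by (auto intro!: derivative_eq_intros)
        from vector_derivative_diff_chain_within[OF this, of g "g' y"] g'(1)[OF that]
        have "((\<lambda>t. g (y + t *\<^sub>R v)) has_vector_derivative g' y v) (at 0)"
          by (auto simp: o_def intro: has_derivative_at_withinI)
        then show ?thesis using dderiv_eq by metis
      qed
      show "Ck_on k UNIV W (dderiv g v)"
      proof (rule Ck_on_linear_system[where A = A and b = v, OF _ _ subspace_UNIV WW])
        fix i j
        have "Ck_on k UNIV W (\<lambda>y. dderiv h (axis j 1) (g y))"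
          using smooth_on_dderiv[OF subspace_UNIV VV h UNIV_I] unfolding smooth_on_def
          by (intro Ck_on_compose[OF subspace_UNIV WW V(1) gW _ Suc.IH]) blast
        then show "Ck_on k UNIV W (\<lambda>y. A y $ i $ j)"
          unfolding A_def matrix_def by (simp add: Ck_on_linear_outer[OF bounded_linear_vec_nth])
      next
        fix y assume y: "y \<in> W"
        have gy: "g y \<in> V" using gW y by blast
        have "bij (\<lambda>v. dderiv h v (g y))" using g'(3)[OF y] f'[OF gy] by simp
        then show "det (A y) \<noteq> 0"
          using det_nz_iff_inj[OF lin[OF y]] unfolding A_def by (simp add: bij_def)
        have "dderiv g v y = Hilbert_Choice.inv (\<lambda>v. dderiv h v (g y)) v"
          using dderiv_eq_derivative[OF g'(1)[OF y]] g'(2)[OF y] f'[OF gy] by simp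
        then have "dderiv h (dderiv g v y) (g y) = v"
          using surj_f_inv_f[OF bij_is_surj[OF \<open>bij (\<lambda>v. dderiv h v (g y))\<close>], of v] by simp
        then show "A y *v dderiv g v y = v"
          unfolding A_def using fun_cong[OF matrix_vector_mul(2)[OF lin[OF y]]] by simp
      qed
    qed
  qed
  then have "smooth_on UNIV W g" by (simp add: smooth_on_def)
  then show ?thesis using that VW by blast
qed

section \<open>Linear algebra of the normal and the tangent space\<close>

lemma orthonormal_expansion:
  fixes u :: "'b \<Rightarrow> 'e::euclidean_space"
  assumes B: "finite B" "card B + 1 = DIM('e)"
    and on: "\<And>v w. v \<in> B \<Longrightarrow> w \<in> B \<Longrightarrow> u v \<bullet> u w = (if v = w then 1 else 0)"
    and nu: "norm \<nu> = 1" "\<And>v. v \<in> B \<Longrightarrow> u v \<bullet> \<nu> = 0"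
    and x: "x \<bullet> \<nu> = 0"
  shows "x = (\<Sum>v\<in>B. (x \<bullet> u v) *\<^sub>R u v)"
proof -
  let ?U = "insert \<nu> (u ` B)"
  have nn: "\<nu> \<bullet> \<nu> = 1" using nu(1) by (simp add: norm_eq_1)
  have inj: "inj_on u B"
    by (rule inj_onI) (metis on zero_neq_one)
  have "\<nu> \<notin> u ` B" using nn nu(2) by force
  then have card: "card ?U = DIM('e)" using B inj by (simp add: card_image)
  have orth: "pairwise orthogonal ?U"
    using on nu(2) by (auto simp: pairwise_def orthogonal_def inner_commute split: if_splits)
  have "0 \<notin> ?U" using on nu by (auto simp: norm_eq_1) (metis inner_zero_left zero_neq_one)
  with orth have "independent ?U" by (rule pairwise_orthogonal_independent)
  then have "span ?U = UNIV"
    using card card_ge_dim_independent[of ?U UNIV] by (auto simp: dim_UNIV)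
  define z where "z = x - (\<Sum>v\<in>B. (x \<bullet> u v) *\<^sub>R u v)"
  have "orthogonal z y" if "y \<in> ?U" for y
  proof (cases "y = \<nu>")
    case True
    then show ?thesis using x nu(2) by (simp add: z_def orthogonal_def inner_diff_left inner_sum_left)
  next
    case False
    then obtain w where w: "w \<in> B" "y = u w" using \<open>y \<in> ?U\<close> by auto
    have "(\<Sum>v\<in>B. (x \<bullet> u v) * (u v \<bullet> u w)) = (\<Sum>v\<in>B. if v = w then x \<bullet> u v else 0)"
      using on w by (intro sum.cong) auto
    then show ?thesis using w B by (simp add: z_def orthogonal_def inner_diff_left inner_sum_left)
  qed
  then have "orthogonal z z"
    using orthogonal_to_span[of z ?U z] \<open>span ?U = UNIV\<close> by auto
  then have "z = 0" by (simp add: orthogonal_self)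
  then show ?thesis by (simp add: z_def)
qed

lemma orthonormal_basis_of_normal_space:
  fixes \<nu> :: "'e::euclidean_space"
  assumes "norm \<nu> = 1"
  obtains B where "finite B" "card B + 1 = DIM('e)" "\<And>x. x \<in> B \<Longrightarrow> x \<bullet> \<nu> = 0"
    "\<And>x y. x \<in> B \<Longrightarrow> y \<in> B \<Longrightarrow> x \<bullet> y = (if x = y then 1 else 0)"
proof -
  have nz: "\<nu> \<noteq> 0" using assms by auto
  obtain B where B: "B \<subseteq> {x. \<nu> \<bullet> x = 0}" "pairwise orthogonal B" "\<And>x. x \<in> B \<Longrightarrow> norm x = 1"
    "independent B" "card B = dim {x. \<nu> \<bullet> x = 0}"
    by (rule orthonormal_basis_subspace[OF subspace_hyperplane[of \<nu>]]) blast
  show ?thesis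
  proof (rule that[of B])
    show "finite B" using B(4) by (rule independent_imp_finite)
    show "card B + 1 = DIM('e)" using B(5) dim_hyperplane[OF nz] DIM_positive[where 'a='e] by simp
    show "x \<bullet> \<nu> = 0" if "x \<in> B" for x using B(1) that by (auto simp: inner_commute)
    show "x \<bullet> y = (if x = y then 1 else 0)" if "x \<in> B" "y \<in> B" for x y
      using B(2,3) that by (auto simp: pairwise_def orthogonal_def norm_eq_1)
  qed
qed

lemma injective_onto_normal_space:
  fixes L :: "real^'n \<Rightarrow> 'e::euclidean_space"
  assumes L: "linear L" "inj L" and dim: "CARD('n) + 1 = DIM('e)"
    and nu: "norm \<nu> = 1" "\<And>v. L v \<bullet> \<nu> = 0" and x: "x \<bullet> \<nu> = 0"
  obtains v where "x = L v"
proof -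
  have nz: "\<nu> \<noteq> 0" using nu by auto
  have "range L = {x. \<nu> \<bullet> x = 0}"
  proof (rule subspace_dim_equal)
    show "subspace (range L)" using L(1) by (simp add: linear_subspace_image)
    show "subspace {x. \<nu> \<bullet> x = 0}" by (rule subspace_hyperplane)
    show "range L \<subseteq> {x. \<nu> \<bullet> x = 0}" using nu by (auto simp: inner_commute)
    have "dim (range L) = dim (UNIV :: (real^'n) set)"
      using L by (intro dim_image_eq) auto
    then show "dim {x. \<nu> \<bullet> x = 0} \<le> dim (range L)"
      using dim dim_hyperplane[OF nz] by simp
  qed
  then have "x \<in> range L" using x by (simp add: inner_commute)
  then show ?thesis using that by blast
qed

section \<open>Topological preliminaries\<close>

lemma continuous_map_locally:
  assumes "\<And>x. x \<in> topspace X \<Longrightarrow> \<exists>U. openin X U \<and> x \<in> U \<and> continuous_map (subtopology X U) Y f"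
  shows "continuous_map X Y f"
  unfolding continuous_map_def
proof (intro conjI allI impI)
  show "f \<in> topspace X \<rightarrow> topspace Y"
  proof
    fix x assume x: "x \<in> topspace X"
    then obtain U where "x \<in> U" "continuous_map (subtopology X U) Y f" using assms by blast
    then show "f x \<in> topspace Y" using x by (auto simp: continuous_map_def)
  qed
  fix T assume T: "openin Y T"
  show "openin X {x \<in> topspace X. f x \<in> T}"
  proof (subst openin_subopen, intro ballI)
    fix x assume x: "x \<in> {x \<in> topspace X. f x \<in> T}"
    then obtain U where U: "openin X U" "x \<in> U" "continuous_map (subtopology X U) Y f" using assms by blast
    have "openin (subtopology X U) {q \<in> topspace (subtopology X U). f q \<in> T}"
      by (rule openin_continuous_map_preimage[OF U(3) T])
    then have "openin X {q \<in> topspace (subtopology X U). f q \<in> T}"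
      using U(1) by (metis openin_trans_full)
    then show "\<exists>V. openin X V \<and> x \<in> V \<and> V \<subseteq> {x \<in> topspace X. f x \<in> T}"
      using U(2) x by (intro exI[of _ "{q \<in> topspace (subtopology X U). f q \<in> T}"]) auto
  qed
qed

lemma connected_space_propagate:
  assumes "connected_space X" "closedin X {p \<in> topspace X. P p}"
    and loc: "\<And>p. p \<in> topspace X \<Longrightarrow> P p \<Longrightarrow> \<exists>U. openin X U \<and> p \<in> U \<and> (\<forall>q\<in>U. P q)"
    and p0: "p0 \<in> topspace X" "P p0" and q: "q \<in> topspace X"
  shows "P q"
proof -
  let ?Z = "{p \<in> topspace X. P p}"
  have "openin X ?Z"
  proof (subst openin_subopen, intro ballI)
    fix p assume "p \<in> ?Z"
    then obtain U where U: "openin X U" "p \<in> U" "\<forall>q\<in>U. P q" using loc by blast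
    then show "\<exists>T. openin X T \<and> p \<in> T \<and> T \<subseteq> ?Z"
      using openin_subset[OF U(1)] by blast
  qed
  then have "?Z = topspace X"
    using assms(1,2) p0 connected_space_clopen_in by blast
  then show ?thesis using q by blast
qed

section \<open>Hypersurfaces as graphs over linear projections\<close>

locale immersed_hypersurface =
  fixes M :: "'p topology" and A :: "('p, real^'n) chart set"
    and F N :: "'p \<Rightarrow> 'e::euclidean_space"
  assumes hypersurface: "hypersurface UNIV M A F N"
begin

lemma dimension: "CARD('n) + 1 = DIM('e)"
  using hypersurface by (simp add: hypersurface_def)

lemma Hausdorff: "Hausdorff_space M"
  using hypersurface by (simp add: hypersurface_def smooth_manifold_def)

lemma chart_at:
  assumes "p \<in> topspace M"
  obtains c where "c \<in> A" "p \<in> fst c"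
  using assms hypersurface unfolding hypersurface_def smooth_manifold_def smooth_atlas_def by blast

lemma chart_facts:
  assumes "c \<in> A"
  shows "openin M (fst c)" "open (snd c ` fst c)"
    "homeomorphic_maps (subtopology M (fst c)) (top_of_set (snd c ` fst c)) (snd c) (chart_inv c)"
    "smooth_on UNIV (snd c ` fst c) (F \<circ> chart_inv c)"
    "smooth_on UNIV (snd c ` fst c) (N \<circ> chart_inv c)"
proof -
  have c: "is_chart UNIV M c"
    using assms hypersurface by (auto simp: hypersurface_def smooth_manifold_def smooth_atlas_def)
  show 1: "openin M (fst c)" "open (snd c ` fst c)" using c by (auto simp: is_chart_def)
  have hm: "homeomorphic_map (subtopology M (fst c)) (top_of_set (snd c ` fst c)) (snd c)"
    using c by (simp add: is_chart_def)
  then obtain g where g: "homeomorphic_maps (subtopology M (fst c)) (top_of_set (snd c ` fst c)) (snd c) g"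
    by (auto simp: homeomorphic_map_maps)
  have ts: "topspace (subtopology M (fst c)) = fst c"
    using openin_subset[OF 1(1)] by auto
  have inj: "inj_on (snd c) (fst c)" using homeomorphic_imp_injective_map[OF hm] by (simp only: ts)
  have "g y = chart_inv c y" if y: "y \<in> snd c ` fst c" for y
  proof -
    have "g y \<in> fst c" "snd c (g y) = y"
      using g y ts by (auto simp: homeomorphic_maps_def continuous_map_def)
    then show ?thesis unfolding chart_inv_def by (metis inj inv_into_f_f)
  qed
  then show "homeomorphic_maps (subtopology M (fst c)) (top_of_set (snd c ` fst c)) (snd c) (chart_inv c)"
    using homeomorphic_maps_eq[OF g] by simp
  show "smooth_on UNIV (snd c ` fst c) (F \<circ> chart_inv c)"
    "smooth_on UNIV (snd c ` fst c) (N \<circ> chart_inv c)"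
    using assms hypersurface
    by (auto simp: hypersurface_def immersion_def unit_normal_field_def smooth_vector_map_def)
qed

lemma chart_inv_simps:
  assumes "c \<in> A"
  shows "p \<in> fst c \<Longrightarrow> chart_inv c (snd c p) = p"
    and "x \<in> snd c ` fst c \<Longrightarrow> chart_inv c x \<in> fst c"
    and "x \<in> snd c ` fst c \<Longrightarrow> snd c (chart_inv c x) = x"
proof -
  have ts: "topspace (subtopology M (fst c)) = fst c"
    using openin_subset[OF chart_facts(1)[OF assms]] by auto
  show "p \<in> fst c \<Longrightarrow> chart_inv c (snd c p) = p"
    and "x \<in> snd c ` fst c \<Longrightarrow> chart_inv c x \<in> fst c"
    and "x \<in> snd c ` fst c \<Longrightarrow> snd c (chart_inv c x) = x"
    using chart_facts(3)[OF assms] ts by (auto simp: homeomorphic_maps_def continuous_map_def)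
qed

lemma fst_chart_subset: "c \<in> A \<Longrightarrow> fst c \<subseteq> topspace M"
  using chart_facts(1) openin_subset by blast

lemma differential_eq: "differential c f p v = dderiv (f \<circ> chart_inv c) v (snd c p)"
  by (simp add: differential_def dderiv_def)

lemma norm_N: "p \<in> topspace M \<Longrightarrow> norm (N p) = 1"
  using hypersurface chart_at unfolding hypersurface_def unit_normal_field_def by metis

lemma differential_normal: "c \<in> A \<Longrightarrow> p \<in> fst c \<Longrightarrow> differential c F p v \<bullet> N p = 0"
  using hypersurface unfolding hypersurface_def unit_normal_field_def by blast

lemma differential_inj: "c \<in> A \<Longrightarrow> p \<in> fst c \<Longrightarrow> inj (differential c F p)"
  using hypersurface unfolding hypersurface_def immersion_def by blast

lemma differential_linear: "c \<in> A \<Longrightarrow> p \<in> fst c \<Longrightarrow> linear (differential c F p)"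
  using smooth_on_dderiv_linear[OF chart_facts(2,4)] unfolding differential_eq by blast

lemma continuous_map_of_charts:
  fixes f :: "'p \<Rightarrow> 'b::real_normed_vector"
  assumes "\<And>c. c \<in> A \<Longrightarrow> smooth_on UNIV (snd c ` fst c) (f \<circ> chart_inv c)"
  shows "continuous_map M euclidean f"
proof (rule continuous_map_locally)
  fix p assume "p \<in> topspace M"
  then obtain c where c: "c \<in> A" "p \<in> fst c" by (rule chart_at)
  have "continuous_map (subtopology M (fst c)) (top_of_set (snd c ` fst c)) (snd c)"
    using chart_facts(3)[OF c(1)] by (simp add: homeomorphic_maps_def)
  moreover have "continuous_map (top_of_set (snd c ` fst c)) euclidean (f \<circ> chart_inv c)"
    using smooth_on_continuous[OF assms[OF c(1)]] by simp
  ultimately have "continuous_map (subtopology M (fst c)) euclidean ((f \<circ> chart_inv c) \<circ> snd c)"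
    by (rule continuous_map_compose)
  then have "continuous_map (subtopology M (fst c)) euclidean f"
    by (rule continuous_map_eq) (auto simp: chart_inv_simps[OF c(1)])
  then show "\<exists>U. openin M U \<and> p \<in> U \<and> continuous_map (subtopology M U) euclidean f"
    using chart_facts(1)[OF c(1)] c(2) by blast
qed

lemma continuous_F: "continuous_map M euclidean F"
  and continuous_N: "continuous_map M euclidean N"
  by (rule continuous_map_of_charts, erule chart_facts)+

text \<open>
  A piece of the hypersurface is parametrized by the inverse \<open>\<sigma>\<close> of the restriction of a linear map
  \<open>\<Lambda>\<close> of the ambient space, so that the piece is a graph over \<open>real^'n\<close>. Since \<open>\<Lambda>\<close> does not depend on
  the point, it is a constant left inverse of the differential of the immersion, and traces over the tangent
  space can be taken without inverting the metric. The chart \<open>c\<close> is kept along, as a reference to the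
  given smooth structure.
\<close>
definition patch :: "('p, real^'n) chart \<Rightarrow> ('e \<Rightarrow> real^'n) \<Rightarrow> (real^'n) set \<Rightarrow> (real^'n \<Rightarrow> 'p) \<Rightarrow> bool" where
  "patch c \<Lambda> W \<sigma> \<longleftrightarrow> c \<in> A \<and> linear \<Lambda> \<and> open W \<and> \<sigma> ` W \<subseteq> fst c \<and> openin M (\<sigma> ` W) \<and>
     continuous_map (top_of_set W) M \<sigma> \<and> smooth_on UNIV W (snd c \<circ> \<sigma>) \<and> (\<forall>y\<in>W. \<Lambda> (F (\<sigma> y)) = y)"

lemma patchD:
  assumes "patch c \<Lambda> W \<sigma>"
  shows "c \<in> A" "linear \<Lambda>" "open W" "y \<in> W \<Longrightarrow> \<sigma> y \<in> fst c" "openin M (\<sigma> ` W)"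
    "continuous_map (top_of_set W) M \<sigma>" "smooth_on UNIV W (snd c \<circ> \<sigma>)"
    "y \<in> W \<Longrightarrow> \<Lambda> (F (\<sigma> y)) = y" "y \<in> W \<Longrightarrow> \<sigma> y \<in> topspace M" "openin (top_of_set UNIV) W"
    "q \<in> \<sigma> ` W \<Longrightarrow> \<Lambda> (F q) \<in> W" "q \<in> \<sigma> ` W \<Longrightarrow> \<sigma> (\<Lambda> (F q)) = q"
proof -
  have "\<sigma> ` W \<subseteq> topspace M" using assms fst_chart_subset[of c] unfolding patch_def by blast
  then show "c \<in> A" "linear \<Lambda>" "open W" "y \<in> W \<Longrightarrow> \<sigma> y \<in> fst c" "openin M (\<sigma> ` W)"
    "continuous_map (top_of_set W) M \<sigma>" "smooth_on UNIV W (snd c \<circ> \<sigma>)"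
    "y \<in> W \<Longrightarrow> \<Lambda> (F (\<sigma> y)) = y" "y \<in> W \<Longrightarrow> \<sigma> y \<in> topspace M" "openin (top_of_set UNIV) W"
    "q \<in> \<sigma> ` W \<Longrightarrow> \<Lambda> (F q) \<in> W" "q \<in> \<sigma> ` W \<Longrightarrow> \<sigma> (\<Lambda> (F q)) = q"
    using assms unfolding patch_def by auto
qed

text \<open>
  A linear map whose kernel meets the tangent space at \<open>p\<close> only in zero restricts to a local
  diffeomorphism at \<open>p\<close>, by the inverse function theorem in a chart.
\<close>
lemma patch_exists:
  assumes c: "c \<in> A" "p \<in> fst c" and L: "linear \<Lambda>"
    and ker: "\<And>x. x \<bullet> N p = 0 \<Longrightarrow> \<Lambda> x = 0 \<Longrightarrow> x = 0"
  obtains W \<sigma> where "patch c \<Lambda> W \<sigma>" "p \<in> \<sigma> ` W"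
proof -
  define D where "D = F \<circ> chart_inv c"
  define V where "V = snd c ` fst c"
  define x0 where "x0 = snd c p"
  define h where "h x = \<Lambda> (D x)" for x
  have blL: "bounded_linear \<Lambda>" using L by (simp add: linear_conv_bounded_linear)
  have V: "open V" "x0 \<in> V" and VV: "openin (top_of_set UNIV) V"
    using c chart_facts(2) by (auto simp: V_def x0_def)
  have D: "smooth_on UNIV V D" using chart_facts(4)[OF c(1)] by (simp add: V_def D_def)
  have h: "smooth_on UNIV V h" unfolding h_def by (rule smooth_on_linear_outer[OF blL D])
  have dh: "dderiv h v x0 = \<Lambda> (differential c F p v)" for v
    unfolding h_def differential_eq D_def[symmetric] x0_def[symmetric]
    by (rule dderiv_linear_outer[OF blL subspace_UNIV VV D UNIV_I V(2)])
  have "inj (\<lambda>v. dderiv h v x0)"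
  proof (subst linear_injective_0[OF smooth_on_dderiv_linear[OF V(1) h V(2)]], intro allI impI)
    fix v assume "dderiv h v x0 = 0"
    then have "differential c F p v = 0"
      using ker differential_normal[OF c] by (simp add: dh)
    then show "v = 0"
      using differential_inj[OF c] linear_injective_0[OF differential_linear[OF c]] by blast
  qed
  from smooth_inverse_function[OF V h this] obtain V' W g where VW: "open V'" "V' \<subseteq> V" "x0 \<in> V'" "open W"
      "homeomorphism V' W h g" "smooth_on UNIV W g" .
  define \<sigma> where "\<sigma> = chart_inv c \<circ> g"
  have gW: "g ` W = V'" using VW(5) by (simp add: homeomorphism_def)
  have hm: "homeomorphic_map (top_of_set V) (subtopology M (fst c)) (chart_inv c)"
    using chart_facts(3)[OF c(1)] homeomorphic_maps_sym homeomorphic_map_maps unfolding V_def by blast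
  have "patch c \<Lambda> W \<sigma>"
    unfolding patch_def
  proof (intro conjI ballI)
    show "\<sigma> ` W \<subseteq> fst c"
      using gW VW(2) chart_inv_simps(2)[OF c(1)] by (auto simp: \<sigma>_def V_def)
    have "openin (top_of_set V) V'" using VW by (simp add: open_subset)
    then have "openin (subtopology M (fst c)) (chart_inv c ` V')"
      using homeomorphic_imp_open_map[OF hm] by (auto simp: open_map_def)
    then show "openin M (\<sigma> ` W)"
      using chart_facts(1)[OF c(1)] gW by (metis openin_trans_full \<sigma>_def image_comp)
    have "continuous_map (top_of_set W) (top_of_set V) g"
      using VW gW by (auto simp: homeomorphism_def)
    then have "continuous_map (top_of_set W) (subtopology M (fst c)) \<sigma>"
      unfolding \<sigma>_def using homeomorphic_imp_continuous_map[OF hm] by (rule continuous_map_compose)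
    then show "continuous_map (top_of_set W) M \<sigma>" by (simp add: continuous_map_in_subtopology)
    have *: "g y \<in> V" if "y \<in> W" for y using that gW VW(2) by auto
    show "smooth_on UNIV W (snd c \<circ> \<sigma>)"
      by (rule smooth_on_cong[OF subspace_UNIV _ _ VW(6)])
        (use VW(4) * chart_inv_simps(3)[OF c(1)] in \<open>auto simp: \<sigma>_def V_def\<close>)
    fix y assume y: "y \<in> W"
    show "\<Lambda> (F (\<sigma> y)) = y"
      using y VW(5) by (auto simp: homeomorphism_def h_def D_def \<sigma>_def)
  qed (use c L VW in auto)
  moreover have "p \<in> \<sigma> ` W"
  proof -
    have "p = chart_inv c x0" using c chart_inv_simps(1) by (simp add: x0_def)
    then show ?thesis using VW(3) gW by (auto simp: \<sigma>_def)
  qed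
  ultimately show ?thesis using that by blast
qed

context
  fixes c \<Lambda> W \<sigma>
  assumes patch: "patch c \<Lambda> W \<sigma>"
begin

lemmas pD = patchD[OF patch]

lemma patch_bounded_linear: "bounded_linear \<Lambda>"
  using pD(2) by (simp add: linear_conv_bounded_linear)

lemma patch_smooth_of_chart:
  fixes f :: "'p \<Rightarrow> 'b::real_normed_vector"
  assumes "smooth_on UNIV (snd c ` fst c) (f \<circ> chart_inv c)"
  shows "smooth_on UNIV W (f \<circ> \<sigma>)"
proof -
  have "smooth_on UNIV W (\<lambda>y. (f \<circ> chart_inv c) ((snd c \<circ> \<sigma>) y))"
    by (rule smooth_on_compose[OF subspace_UNIV pD(10) chart_facts(2)[OF pD(1)] _ assms pD(7)]) (use pD(4) in auto)
  then show ?thesis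
    by (rule smooth_on_cong[OF subspace_UNIV pD(10), rotated])
      (use chart_inv_simps(1)[OF pD(1)] pD(4) in auto)
qed

lemma patch_smooth: "smooth_on UNIV W (F \<circ> \<sigma>)" "smooth_on UNIV W (N \<circ> \<sigma>)"
  by (rule patch_smooth_of_chart, rule chart_facts, rule pD)+

lemma patch_dderiv_proj: "y \<in> W \<Longrightarrow> \<Lambda> (dderiv (F \<circ> \<sigma>) v y) = v"
proof -
  assume y: "y \<in> W"
  have "\<Lambda> (dderiv (F \<circ> \<sigma>) v y) = dderiv (\<lambda>y. \<Lambda> ((F \<circ> \<sigma>) y)) v y"
    by (rule dderiv_linear_outer[OF patch_bounded_linear subspace_UNIV pD(10) patch_smooth(1) UNIV_I y, symmetric])
  also have "\<dots> = dderiv (\<lambda>y. y) v y"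
    by (rule dderiv_cong[OF subspace_UNIV pD(10) y UNIV_I]) (use pD(8) in auto)
  also have "\<dots> = v" by (rule dderiv_eq_derivative) (rule has_derivative_ident)
  finally show ?thesis .
qed

text \<open>
  Near \<open>\<sigma> y\<close> the function \<open>f\<close> is \<open>(f \<circ> \<sigma>) \<circ> (\<Lambda> \<circ> F)\<close>, so this is the chain rule for the passage
  from chart coordinates to patch coordinates.
\<close>
lemma patch_dderiv_chart:
  fixes f :: "'p \<Rightarrow> 'b::real_normed_vector"
  assumes "smooth_on UNIV (snd c ` fst c) (f \<circ> chart_inv c)" and y: "y \<in> W"
  shows "differential c f (\<sigma> y) v = dderiv (f \<circ> \<sigma>) (\<Lambda> (differential c F (\<sigma> y) v)) y"
proof -
  define x where "x = snd c (\<sigma> y)"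
  define V where "V = snd c ` fst c"
  have cA: "c \<in> A" by (rule pD)
  have V: "open V" "x \<in> V" and VV: "openin (top_of_set UNIV) V"
    using chart_facts(2)[OF cA] pD(4)[OF y] by (auto simp: V_def x_def)
  define V' where "V' = {z \<in> V. chart_inv c z \<in> \<sigma> ` W}"
  have V': "openin (top_of_set UNIV) V'" "x \<in> V'"
  proof -
    have "continuous_map (top_of_set V) M (chart_inv c)"
      using chart_facts(3)[OF cA] by (simp add: homeomorphic_maps_def V_def continuous_map_in_subtopology)
    then have "openin (top_of_set V) V'"
      using pD(5) unfolding V'_def continuous_map_def by auto
    then show "openin (top_of_set UNIV) V'" using V(1) by (metis open_openin openin_open_trans subtopology_UNIV)
    show "x \<in> V'" using V(2) y pD(4)[OF y] chart_inv_simps(1)[OF cA] by (auto simp: V'_def x_def)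
  qed
  define h where "h z = \<Lambda> ((F \<circ> chart_inv c) z)" for z
  have hx: "h x = y" using pD(4,8) y chart_inv_simps(1)[OF cA] by (simp add: h_def x_def)
  have D: "smooth_on UNIV V (F \<circ> chart_inv c)" using chart_facts(4)[OF cA] by (simp add: V_def)
  have "smooth_on UNIV V h" unfolding h_def by (rule smooth_on_linear_outer[OF patch_bounded_linear D])
  have dh: "((\<lambda>t. h (x + t *\<^sub>R v)) has_vector_derivative \<Lambda> (differential c F (\<sigma> y) v)) (at 0)"
    unfolding h_def differential_eq x_def[symmetric]
    by (rule bounded_linear.has_vector_derivative[OF patch_bounded_linear smooth_on_has_dderiv[OF subspace_UNIV VV D UNIV_I V(2)]])
  have "((\<lambda>t. (f \<circ> \<sigma>) (h (x + t *\<^sub>R v))) has_vector_derivative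
      dderiv (f \<circ> \<sigma>) (\<Lambda> (differential c F (\<sigma> y) v)) (h x)) (at 0)"
    by (rule has_line_derivative_compose[OF pD(3) _ _ dh])
      (use hx y patch_smooth_of_chart[OF assms(1)] in \<open>simp_all only: smooth_on_def\<close>)
  then have "((\<lambda>t. (f \<circ> chart_inv c) (x + t *\<^sub>R v)) has_vector_derivative
      dderiv (f \<circ> \<sigma>) (\<Lambda> (differential c F (\<sigma> y) v)) (h x)) (at 0)"
    by (rule has_dderiv_cong[OF subspace_UNIV V' UNIV_I, rotated])
      (use pD(12) in \<open>auto simp: V'_def h_def\<close>)
  from dderiv_eq[of "f \<circ> chart_inv c", OF this] show ?thesis
    unfolding differential_eq x_def[symmetric] by (simp add: hx)
qed

lemma patch_dderiv_normal:
  assumes y: "y \<in> W"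
  shows "dderiv (F \<circ> \<sigma>) v y \<bullet> N (\<sigma> y) = 0"
proof -
  have p: "\<sigma> y \<in> fst c" "c \<in> A" using pD y by auto
  have lin: "linear (differential c F (\<sigma> y))" by (rule differential_linear[OF p(2,1)])
  define g where "g v = \<Lambda> (differential c F (\<sigma> y) v)" for v
  have eq: "differential c F (\<sigma> y) v = dderiv (F \<circ> \<sigma>) (g v) y" for v
    unfolding g_def by (rule patch_dderiv_chart[OF chart_facts(4)[OF p(2)] y])
  have "linear g" unfolding g_def using linear_compose[OF lin pD(2)] by (simp add: o_def)
  moreover have "inj g"
    by (rule injI) (metis eq differential_inj[OF p(2,1)] injD)
  ultimately have "surj g" by (simp add: linear_injective_imp_surjective)
  then obtain w where "v = g w" by (metis surjD)
  then show ?thesis using eq[of w] differential_normal[OF p(2,1), of w] by simp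
qed

lemma patch_dderiv_linear:
  assumes "y \<in> W"
  shows "linear (\<lambda>v. dderiv (F \<circ> \<sigma>) v y)" "linear (\<lambda>v. dderiv (N \<circ> \<sigma>) v y)"
  using smooth_on_dderiv_linear[OF pD(3) _ assms] patch_smooth by auto

text \<open>
  Both vectors are tangent and have the same image under \<open>\<Lambda>\<close>, which is injective on the tangent space.
\<close>
lemma patch_tangent:
  assumes y: "y \<in> W" and z: "z \<bullet> N (\<sigma> y) = 0"
  shows "dderiv (F \<circ> \<sigma>) (\<Lambda> z) y = z"
proof -
  have "inj (\<lambda>v. dderiv (F \<circ> \<sigma>) v y)"
    by (rule injI) (metis patch_dderiv_proj[OF y])
  then obtain v where "z = dderiv (F \<circ> \<sigma>) v y"
    using injective_onto_normal_space[OF patch_dderiv_linear(1)[OF y] _ dimension norm_N[OF pD(9)[OF y]] patch_dderiv_normal[OF y] z]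
    by blast
  then show ?thesis using patch_dderiv_proj[OF y] by simp
qed

lemma patch_dN_tangent:
  assumes y: "y \<in> W"
  shows "dderiv (N \<circ> \<sigma>) v y \<bullet> N (\<sigma> y) = 0"
proof -
  have d: "((\<lambda>t::real. (N \<circ> \<sigma>) (y + t *\<^sub>R v)) has_vector_derivative dderiv (N \<circ> \<sigma>) v y) (at 0)"
    by (rule smooth_on_has_dderiv[OF subspace_UNIV pD(10) patch_smooth(2) UNIV_I y])
  have "((\<lambda>t::real. (N \<circ> \<sigma>) (y + t *\<^sub>R v) \<bullet> (N \<circ> \<sigma>) (y + t *\<^sub>R v)) has_vector_derivative
      2 * (dderiv (N \<circ> \<sigma>) v y \<bullet> N (\<sigma> y))) (at 0)"
    using bounded_bilinear.has_vector_derivative[OF bounded_bilinear_inner d d] by (simp add: inner_commute)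
  then have "((\<lambda>t::real. 1) has_vector_derivative 2 * (dderiv (N \<circ> \<sigma>) v y \<bullet> N (\<sigma> y))) (at 0)"
    by (rule has_dderiv_cong[OF subspace_UNIV pD(10) y UNIV_I, of "\<lambda>y. (N \<circ> \<sigma>) y \<bullet> (N \<circ> \<sigma>) y" "\<lambda>y. 1", rotated])
      (use norm_N pD(9) in \<open>auto simp: norm_eq_1\<close>)
  from vector_derivative_at[OF this] show ?thesis by simp
qed

text \<open>
  Both sides are the trace of the same endomorphism of the tangent space, the differential of the Gauss
  map. On the left it is taken with respect to an orthonormal basis, on the right with respect to the
  coordinate basis of the patch, whose dual basis consists of the components of \<open>\<Lambda>\<close>.
\<close>
lemma patch_trace:
  fixes u :: "'b \<Rightarrow> 'e"
  assumes y: "y \<in> W" and B: "finite B" "card B = CARD('n)"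
    and on: "\<And>v w. v \<in> B \<Longrightarrow> w \<in> B \<Longrightarrow> u v \<bullet> u w = (if v = w then 1 else 0)"
    and u: "\<And>v. v \<in> B \<Longrightarrow> u v \<bullet> N (\<sigma> y) = 0"
  shows "(\<Sum>v\<in>B. dderiv (N \<circ> \<sigma>) (\<Lambda> (u v)) y \<bullet> u v) = (\<Sum>i\<in>UNIV. \<Lambda> (dderiv (N \<circ> \<sigma>) (axis i 1) y) $ i)"
proof -
  define X where "X z = dderiv (N \<circ> \<sigma>) (\<Lambda> z) y" for z
  define \<delta> where "\<delta> i = dderiv (F \<circ> \<sigma>) (axis i 1) y" for i
  have linX: "linear X" unfolding X_def
    using linear_compose[OF pD(2) patch_dderiv_linear(2)[OF y]] by (simp add: o_def)
  have \<delta>: "(\<Sum>i\<in>UNIV. (\<Lambda> z $ i) *\<^sub>R \<delta> i) = z" if "z \<bullet> N (\<sigma> y) = 0" for z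
  proof -
    have "\<Lambda> z = (\<Sum>i\<in>UNIV. (\<Lambda> z $ i) *\<^sub>R axis i 1)"
      by (simp add: basis_expansion flip: scalar_mult_eq_scaleR)
    then have "dderiv (F \<circ> \<sigma>) (\<Lambda> z) y = (\<Sum>i\<in>UNIV. (\<Lambda> z $ i) *\<^sub>R \<delta> i)"
      using linear_sum[OF patch_dderiv_linear(1)[OF y], of "\<lambda>i. (\<Lambda> z $ i) *\<^sub>R axis i 1" UNIV]
        linear_scale[OF patch_dderiv_linear(1)[OF y]] by (simp add: \<delta>_def)
    then show ?thesis using patch_tangent[OF y that] by simp
  qed
  have dim: "card B + 1 = DIM('e)" using B dimension by simp
  have exp: "\<delta> i = (\<Sum>v\<in>B. (\<delta> i \<bullet> u v) *\<^sub>R u v)" for i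
    by (rule orthonormal_expansion[OF B(1) dim on norm_N[OF pD(9)[OF y]] u])
      (auto simp: \<delta>_def patch_dderiv_normal[OF y])
  have "dderiv (N \<circ> \<sigma>) (axis i 1) y = X (\<delta> i)" for i
    by (simp add: X_def \<delta>_def patch_dderiv_proj[OF y])
  then have "(\<Sum>i\<in>UNIV. \<Lambda> (dderiv (N \<circ> \<sigma>) (axis i 1) y) $ i) = (\<Sum>i\<in>UNIV. \<Lambda> (X (\<Sum>v\<in>B. (\<delta> i \<bullet> u v) *\<^sub>R u v)) $ i)"
    using exp by simp
  also have "\<dots> = (\<Sum>i\<in>UNIV. \<Sum>v\<in>B. (\<delta> i \<bullet> u v) * \<Lambda> (X (u v)) $ i)"
    by (simp add: linear_sum[OF linX] linear_scale[OF linX] linear_sum[OF pD(2)] linear_scale[OF pD(2)])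
  also have "\<dots> = (\<Sum>v\<in>B. (\<Sum>i\<in>UNIV. (\<Lambda> (X (u v)) $ i) *\<^sub>R \<delta> i) \<bullet> u v)"
    by (subst sum.swap) (simp add: inner_sum_left ac_simps)
  also have "\<dots> = (\<Sum>v\<in>B. X (u v) \<bullet> u v)"
    by (intro sum.cong refl) (simp add: \<delta> X_def patch_dN_tangent[OF y])
  finally show ?thesis by (simp add: X_def)
qed

text \<open>
  Differentiating the orthogonality of the coordinate vectors and \<open>N\<close> moves the second derivative of the
  immersion to the normal field.
\<close>
lemma second_fundamental_form_eq:
  assumes y: "y \<in> W"
  shows "second_fundamental_form c F N (\<sigma> y) v v
    = - (dderiv (N \<circ> \<sigma>) (\<Lambda> (differential c F (\<sigma> y) v)) y \<bullet> differential c F (\<sigma> y) v)"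
proof -
  define x where "x = snd c (\<sigma> y)"
  define V where "V = snd c ` fst c"
  define D where "D = F \<circ> chart_inv c"
  define n where "n = N \<circ> chart_inv c"
  have cA: "c \<in> A" by (rule pD)
  have V: "open V" "x \<in> V" and VV: "openin (top_of_set UNIV) V"
    using chart_facts(2)[OF cA] pD(4)[OF y] by (auto simp: V_def x_def)
  have D: "smooth_on UNIV V D" and n: "smooth_on UNIV V n"
    using chart_facts(4,5)[OF cA] by (simp_all add: V_def D_def n_def)
  have Dv: "smooth_on UNIV V (dderiv D v)" by (rule smooth_on_dderiv[OF subspace_UNIV VV D UNIV_I])
  have "second_fundamental_form c F N (\<sigma> y) v v = dderiv ((\<lambda>q. dderiv D v (snd c q)) \<circ> chart_inv c) v x \<bullet> N (\<sigma> y)"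
    by (simp add: second_fundamental_form_def differential_eq D_def x_def)
  also have "dderiv ((\<lambda>q. dderiv D v (snd c q)) \<circ> chart_inv c) v x = dderiv (dderiv D v) v x"
    by (rule dderiv_cong[OF subspace_UNIV VV V(2) UNIV_I]) (use chart_inv_simps(3)[OF cA] in \<open>auto simp: V_def\<close>)
  also have "N (\<sigma> y) = n x" using chart_inv_simps(1)[OF cA pD(4)[OF y]] by (simp add: n_def x_def)
  finally have 1: "second_fundamental_form c F N (\<sigma> y) v v = dderiv (dderiv D v) v x \<bullet> n x" .
  have "((\<lambda>t. dderiv D v (x + t *\<^sub>R v) \<bullet> n (x + t *\<^sub>R v)) has_vector_derivative
      (dderiv D v x \<bullet> dderiv n v x + dderiv (dderiv D v) v x \<bullet> n x)) (at 0)"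
    using bounded_bilinear.has_vector_derivative[OF bounded_bilinear_inner
        smooth_on_has_dderiv[OF subspace_UNIV VV Dv UNIV_I V(2), of v] smooth_on_has_dderiv[OF subspace_UNIV VV n UNIV_I V(2), of v]]
    by simp
  then have "((\<lambda>t::real. 0) has_vector_derivative (dderiv D v x \<bullet> dderiv n v x + dderiv (dderiv D v) v x \<bullet> n x)) (at 0)"
  proof (rule has_dderiv_cong[OF subspace_UNIV VV V(2) UNIV_I, of "\<lambda>x. dderiv D v x \<bullet> n x" "\<lambda>x. 0", rotated])
    fix z assume "z \<in> V"
    then have "chart_inv c z \<in> fst c" "snd c (chart_inv c z) = z"
      using chart_inv_simps[OF cA] by (auto simp: V_def)
    then show "dderiv D v z \<bullet> n z = 0"
      using differential_normal[OF cA, of "chart_inv c z" v] by (simp add: differential_eq D_def n_def)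
  qed
  from vector_derivative_at[OF this]
  have 2: "dderiv (dderiv D v) v x \<bullet> n x = - (dderiv n v x \<bullet> dderiv D v x)"
    by (simp add: inner_commute)
  have "dderiv n v x = dderiv (N \<circ> \<sigma>) (\<Lambda> (differential c F (\<sigma> y) v)) y"
    using patch_dderiv_chart[OF chart_facts(5)[OF cA] y, of v] by (simp add: differential_eq n_def x_def)
  then show ?thesis using 1 2 by (simp add: differential_eq D_def x_def)
qed

text \<open>
  In a patch the mean curvature is minus the divergence of \<open>\<Lambda> \<circ> N\<close>. This form holds at all points of
  the patch with the same \<open>\<Lambda>\<close>, so it can be differentiated without a moving frame.
\<close>
lemma patch_mean_curvature:
  assumes "constant_weighted_mean_curvature UNIV A F N lam" and y: "y \<in> W"
  shows "(1/2) * (F (\<sigma> y) \<bullet> N (\<sigma> y)) - (\<Sum>i\<in>UNIV. \<Lambda> (dderiv (N \<circ> \<sigma>) (axis i 1) y) $ i) = lam"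
proof -
  define p where "p = \<sigma> y"
  have p: "p \<in> fst c" "c \<in> A" "p \<in> topspace M" using pD y by (auto simp: p_def)
  define L where "L = differential c F p"
  have L: "linear L" "inj L" "\<And>v. L v \<bullet> N p = 0"
    unfolding L_def using differential_linear differential_inj differential_normal p by auto
  obtain B where B: "finite B" "card B + 1 = DIM('e)" "\<And>x. x \<in> B \<Longrightarrow> x \<bullet> N p = 0"
    "\<And>x y. x \<in> B \<Longrightarrow> y \<in> B \<Longrightarrow> x \<bullet> y = (if x = y then 1 else 0)"
    using orthonormal_basis_of_normal_space[OF norm_N[OF p(3)]] by blast
  have "\<exists>v. L v = x" if "x \<in> B" for x
    using injective_onto_normal_space[OF L(1,2) dimension norm_N[OF p(3)] L(3) B(3)[OF that]] by metis
  then obtain g where g: "\<And>x. x \<in> B \<Longrightarrow> L (g x) = x" by metis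
  have "inj_on g B" by (rule inj_onI) (metis g)
  define B' where "B' = g ` B"
  have B': "finite B'" "card B' = CARD('n)"
    using B dimension \<open>inj_on g B\<close> by (auto simp: B'_def card_image)
  have on: "L v \<bullet> L w = (if v = w then 1 else 0)" if "v \<in> B'" "w \<in> B'" for v w
    using that g B(4) by (auto simp: B'_def)
  have "orthonormal_tangent_basis UNIV c F p B'"
    using B' on by (simp add: orthonormal_tangent_basis_def induced_metric_def L_def)
  then have "mean_curvature c B' F N p + (1/2) * (F p \<bullet> N p) = lam"
    using assms(1) p by (simp add: constant_weighted_mean_curvature_def)
  moreover have "mean_curvature c B' F N p = - (\<Sum>v\<in>B'. dderiv (N \<circ> \<sigma>) (\<Lambda> (L v)) y \<bullet> L v)"
    unfolding mean_curvature_def p_def second_fundamental_form_eq[OF y] by (simp add: sum_negf L_def p_def)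
  moreover have "(\<Sum>v\<in>B'. dderiv (N \<circ> \<sigma>) (\<Lambda> (L v)) y \<bullet> L v) = (\<Sum>i\<in>UNIV. \<Lambda> (dderiv (N \<circ> \<sigma>) (axis i 1) y) $ i)"
    by (rule patch_trace[OF y B' on]) (use L(3) in \<open>auto simp: p_def\<close>)
  ultimately show ?thesis by (simp add: p_def)
qed

end

end

section \<open>The drift Laplacian of the Gauss map\<close>

lemma dderiv_inner:
  fixes S :: "'m::real_normed_vector set" and f g :: "'m \<Rightarrow> 'e::real_inner"
  assumes S: "subspace S" "openin (top_of_set S) V" and "smooth_on S V f" "smooth_on S V g" "v \<in> S" "x \<in> V"
  shows "dderiv (\<lambda>x. f x \<bullet> g x) v x = f x \<bullet> dderiv g v x + dderiv f v x \<bullet> g x"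
  by (rule dderiv_eq)
    (use bounded_bilinear.has_vector_derivative[OF bounded_bilinear_inner
      smooth_on_has_dderiv[OF S assms(3,5,6)] smooth_on_has_dderiv[OF S assms(4,5,6)]] in simp)

lemma dderiv_const [simp]: "dderiv (\<lambda>x. c) v x = 0"
  by (rule dderiv_eq) simp

lemma second_derivative_test:
  fixes f :: "real \<Rightarrow> real"
  assumes "\<forall>\<^sub>F t in nhds 0. (f has_real_derivative f1 t) (at t)"
    and "(f1 has_real_derivative f2) (at 0)"
    and "\<forall>\<^sub>F t in nhds 0. f 0 \<le> f t"
  shows "f1 0 = 0" "0 \<le> f2"
proof -
  obtain d where d: "d > 0" "\<And>t. \<bar>t\<bar> < d \<Longrightarrow> (f has_real_derivative f1 t) (at t) \<and> f 0 \<le> f t"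
    using eventually_conj[OF assms(1,3)] unfolding eventually_nhds_metric by (auto simp: dist_real_def)
  show f10: "f1 0 = 0"
    by (rule DERIV_local_min[of f "f1 0" 0 d]) (use d in auto)
  show "0 \<le> f2"
  proof (rule ccontr)
    assume "\<not> 0 \<le> f2"
    then obtain e where e: "e > 0" "\<And>h. 0 < h \<Longrightarrow> h < e \<Longrightarrow> f1 (0 + h) < f1 0"
      using DERIV_neg_dec_right[OF assms(2)] by auto
    define t where "t = min d e / 2"
    have t: "0 < t" "t < d" "t < e" using d(1) e(1) by (auto simp: t_def)
    have "\<exists>z>0. z < t \<and> f t - f 0 = (t - 0) * f1 z"
      using d(2) t by (intro MVT2) auto
    then obtain z where z: "0 < z" "z < t" "f t - f 0 = t * f1 z" by auto
    have "f1 z < 0" using e(2)[of z] z t f10 by simp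
    then have "f t - f 0 < 0" using z t by (simp add: mult_pos_neg)
    then show False using d(2)[of t] t by simp
  qed
qed

context immersed_hypersurface
begin

lemma orthonormal_frame:
  assumes p: "p \<in> topspace M"
  obtains u :: "'n \<Rightarrow> 'e" where "\<And>i j. u i \<bullet> u j = (if i = j then 1 else 0)" "\<And>i. u i \<bullet> N p = 0"
    "\<And>z. z = (z \<bullet> N p) *\<^sub>R N p + (\<Sum>i\<in>UNIV. (z \<bullet> u i) *\<^sub>R u i)"
proof -
  obtain B where B: "finite B" "card B + 1 = DIM('e)" "\<And>x. x \<in> B \<Longrightarrow> x \<bullet> N p = 0"
    "\<And>x y. x \<in> B \<Longrightarrow> y \<in> B \<Longrightarrow> x \<bullet> y = (if x = y then 1 else 0)"
    using orthonormal_basis_of_normal_space[OF norm_N[OF p]] by blast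
  have "card B = CARD('n)" using B dimension by simp
  then obtain u :: "'n \<Rightarrow> 'e" where u: "bij_betw u UNIV B"
    using B(1) by (metis finite_same_card_bij finite)
  have uB: "u i \<in> B" for i using u by (auto simp: bij_betw_def)
  have inj: "u i = u j \<longleftrightarrow> i = j" for i j using u by (auto simp: bij_betw_def inj_eq)
  have on: "u i \<bullet> u j = (if i = j then 1 else 0)" for i j
    using B(4)[OF uB uB, of i j] inj by auto
  have un: "u i \<bullet> N p = 0" for i using B(3)[OF uB] .
  have exp: "z = (z \<bullet> N p) *\<^sub>R N p + (\<Sum>i\<in>UNIV. (z \<bullet> u i) *\<^sub>R u i)" for z
  proof -
    have "z - (z \<bullet> N p) *\<^sub>R N p = (\<Sum>i\<in>UNIV. ((z - (z \<bullet> N p) *\<^sub>R N p) \<bullet> u i) *\<^sub>R u i)"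
      by (rule orthonormal_expansion[OF _ _ on norm_N[OF p] un])
        (use dimension norm_N[OF p] in \<open>auto simp: inner_diff_left norm_eq_1\<close>)
    also have "\<dots> = (\<Sum>i\<in>UNIV. (z \<bullet> u i) *\<^sub>R u i)"
      using un by (simp add: inner_diff_left inner_commute[of "N p"])
    finally show ?thesis by (simp add: algebra_simps)
  qed
  show ?thesis using that[of u] on un exp by blast
qed

lemma frame_parseval:
  assumes exp: "\<And>z. z = (z \<bullet> \<nu>) *\<^sub>R \<nu> + (\<Sum>i\<in>I. (z \<bullet> u i) *\<^sub>R u i)"
  shows "z \<bullet> w = (z \<bullet> \<nu>) * (w \<bullet> \<nu>) + (\<Sum>i\<in>I. (z \<bullet> u i) * (w \<bullet> u i))"
proof -
  have "z \<bullet> w = z \<bullet> ((w \<bullet> \<nu>) *\<^sub>R \<nu> + (\<Sum>i\<in>I. (w \<bullet> u i) *\<^sub>R u i))"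
    using exp[of w] by simp
  then show ?thesis by (simp add: inner_add_right inner_sum_right ac_simps)
qed

lemma patch_inj: "patch c \<Lambda> W \<sigma> \<Longrightarrow> inj_on F (\<sigma> ` W)"
  by (rule inj_onI) (metis patchD(12))

lemma continuous_proj_F: "linear \<Lambda> \<Longrightarrow> continuous_map M euclidean (\<lambda>q. \<Lambda> (F q))" for \<Lambda> :: "'e \<Rightarrow> real^'n"
  using continuous_map_compose[OF continuous_F, of euclidean \<Lambda>]
  by (simp add: linear_continuous_on o_def linear_conv_bounded_linear)

lemma patch_openin_image:
  assumes patch: "patch c \<Lambda> W \<sigma>" and O: "open O'" "O' \<subseteq> W"
  shows "openin M (\<sigma> ` O')"
proof -
  note pd = patchD[OF patch]
  have "openin M ({q \<in> topspace M. \<Lambda> (F q) \<in> O'} \<inter> \<sigma> ` W)"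
    by (intro openin_Int pd(5) openin_continuous_map_preimage[OF continuous_proj_F[OF pd(2)]]) (use O in simp)
  also have "{q \<in> topspace M. \<Lambda> (F q) \<in> O'} \<inter> \<sigma> ` W = \<sigma> ` O'"
  proof
    show "{q \<in> topspace M. \<Lambda> (F q) \<in> O'} \<inter> \<sigma> ` W \<subseteq> \<sigma> ` O'"
    proof
      fix q assume "q \<in> {q \<in> topspace M. \<Lambda> (F q) \<in> O'} \<inter> \<sigma> ` W"
      then have q: "\<Lambda> (F q) \<in> O'" "q \<in> \<sigma> ` W" by simp_all
      show "q \<in> \<sigma> ` O'"
        using imageI[OF q(1), of \<sigma>] unfolding pd(12)[OF q(2)] .
    qed
    show "\<sigma> ` O' \<subseteq> {q \<in> topspace M. \<Lambda> (F q) \<in> O'} \<inter> \<sigma> ` W"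
    proof
      fix q assume "q \<in> \<sigma> ` O'"
      then obtain y where y: "y \<in> O'" "q = \<sigma> y" by blast
      then have "y \<in> W" using O(2) by blast
      then show "q \<in> {q \<in> topspace M. \<Lambda> (F q) \<in> O'} \<inter> \<sigma> ` W"
        using y pd(8,9) by simp
    qed
  qed
  finally show ?thesis .
qed

text \<open>
  Here \<open>\<Lambda>\<close> is the orthogonal projection to the tangent space at \<open>p\<close>. In this patch the coordinate
  vectors are orthonormal at \<open>p\<close> and the second derivatives of the immersion are normal there, so the
  Laplacian of a function at \<open>p\<close> is the plain sum of its second derivatives.
\<close>
lemma frame_patch:
  assumes c: "c \<in> A" "p \<in> fst c"
  obtains u :: "'n \<Rightarrow> 'e" and \<Lambda> W \<sigma> y
  where "\<And>i j. u i \<bullet> u j = (if i = j then 1 else 0)" "\<And>i. u i \<bullet> N p = 0"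
    "\<And>z. z = (z \<bullet> N p) *\<^sub>R N p + (\<Sum>i\<in>UNIV. (z \<bullet> u i) *\<^sub>R u i)"
    "\<And>z. \<Lambda> z = (\<chi> i. z \<bullet> u i)" "patch c \<Lambda> W \<sigma>" "y \<in> W" "p = \<sigma> y"
proof -
  have pM: "p \<in> topspace M" using c fst_chart_subset by blast
  obtain u :: "'n \<Rightarrow> 'e" where frame: "\<And>i j. u i \<bullet> u j = (if i = j then 1 else 0)" "\<And>i. u i \<bullet> N p = 0"
    "\<And>z. z = (z \<bullet> N p) *\<^sub>R N p + (\<Sum>i\<in>UNIV. (z \<bullet> u i) *\<^sub>R u i)"
    using orthonormal_frame[OF pM] by blast
  define \<Lambda> :: "'e \<Rightarrow> real^'n" where "\<Lambda> z = (\<chi> i. z \<bullet> u i)" for z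
  have lin: "linear \<Lambda>" by (rule linearI) (auto simp: \<Lambda>_def vec_eq_iff inner_add_left)
  have "z = 0" if "z \<bullet> N p = 0" "\<Lambda> z = 0" for z
  proof -
    have "z \<bullet> u i = 0" for i using that(2) by (simp add: \<Lambda>_def vec_eq_iff)
    then show ?thesis using frame(3)[of z] that(1) by simp
  qed
  then obtain W \<sigma> where patch: "patch c \<Lambda> W \<sigma>" and pW: "p \<in> \<sigma> ` W"
    using patch_exists[OF c lin] by metis
  then obtain y where "y \<in> W" "p = \<sigma> y" by blast
  then show ?thesis using that[of u \<Lambda> W \<sigma> y] frame \<Lambda>_def patch by blast
qed

lemma patch_at:
  assumes "c \<in> A" "p \<in> fst c"
  obtains \<Lambda> W \<sigma> where "patch c \<Lambda> W \<sigma>" "p \<in> \<sigma> ` W"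
  by (rule frame_patch[OF assms]) (blast intro: that)

text \<open>
  The last equation says \<open>\<Delta>N - dN(x\<^sup>T)/2 = - |A|\<^sup>2 N\<close> at the centre of the patch, where \<open>x\<^sup>T\<close> is
  the tangential part of the position vector. The normal component of \<open>\<Delta>N\<close> comes from \<open>|N| = 1\<close>. For the
  tangential component, the symmetry of the second fundamental form turns \<open>\<Sum>i. n\<^sub>i\<^sub>i \<bullet> u\<^sub>k\<close> into
  \<open>\<Sum>i. n\<^sub>k\<^sub>i \<bullet> u\<^sub>i\<close>, which is the derivative of the divergence of \<open>\<Lambda> \<circ> N\<close> in direction \<open>k\<close>. By
  the equation for the mean curvature this divergence is \<open>(x \<bullet> N)/2 - lam\<close>, and its derivative is \<open>(x \<bullet> n\<^sub>k)/2\<close>.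
\<close>
lemma gauss_map_equation:
  assumes cwmc: "constant_weighted_mean_curvature UNIV A F N lam"
    and patch: "patch c \<Lambda> W \<sigma>" and y: "y \<in> W"
    and frame: "\<And>i j. u i \<bullet> u j = (if i = j then 1 else 0)" "\<And>i. u i \<bullet> N (\<sigma> y) = 0"
      "\<And>z. z = (z \<bullet> N (\<sigma> y)) *\<^sub>R N (\<sigma> y) + (\<Sum>i\<in>UNIV. (z \<bullet> u i) *\<^sub>R u i)"
    and \<Lambda>: "\<And>z. \<Lambda> z = (\<chi> i. z \<bullet> u i)"
  defines "D \<equiv> F \<circ> \<sigma>" and "n \<equiv> N \<circ> \<sigma>" and "b \<equiv> \<lambda>i. axis i (1::real) :: real^'n"
  shows "dderiv D (b i) y = u i"
    and "(\<Sum>i\<in>UNIV. dderiv (dderiv D (b i)) (b i) y) = (lam - (1/2) * (D y \<bullet> n y)) *\<^sub>R n y"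
    and "(\<Sum>i\<in>UNIV. dderiv (dderiv n (b i)) (b i) y)
      = - (\<Sum>i\<in>UNIV. (norm (dderiv n (b i) y))\<^sup>2) *\<^sub>R n y + (1/2) *\<^sub>R (\<Sum>j\<in>UNIV. (D y \<bullet> u j) *\<^sub>R dderiv n (b j) y)"
proof -
  note pd = patchD[OF patch]
  note WW = subspace_UNIV pd(10)
  have smD: "smooth_on UNIV W D" and smn: "smooth_on UNIV W n"
    using patch_smooth[OF patch] by (simp_all add: D_def n_def)
  note sm1 = smooth_on_dderiv[OF WW _ UNIV_I]
  have smDi: "smooth_on UNIV W (dderiv D v)" "smooth_on UNIV W (dderiv n v)" for v
    using sm1 smD smn by blast+
  define \<nu> where "\<nu> = n y"
  have \<nu>1: "\<nu> \<bullet> \<nu> = 1" using norm_N[OF pd(9)[OF y]] by (simp add: \<nu>_def n_def norm_eq_1)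
  have \<nu>u: "u i \<bullet> \<nu> = 0" for i using frame(2) by (simp add: \<nu>_def n_def)
  have exp: "z = (z \<bullet> \<nu>) *\<^sub>R \<nu> + (\<Sum>i\<in>UNIV. (z \<bullet> u i) *\<^sub>R u i)" for z
    using frame(3)[of z] by (simp add: \<nu>_def n_def)
  note parseval = frame_parseval[of \<nu> u UNIV, OF exp]
  have Lb: "\<Lambda> (u i) = b i" for i
    unfolding \<Lambda> b_def by (simp add: vec_eq_iff axis_def frame(1))
  show Di: "dderiv D (b i) y = u i" for i
    using patch_tangent[OF patch y frame(2), of i] by (simp add: Lb D_def)
  have Dnz: "dderiv D v z \<bullet> n z = 0" if "z \<in> W" for v z
    using patch_dderiv_normal[OF patch that] by (simp add: D_def n_def)
  have nnz: "dderiv n v z \<bullet> n z = 0" if "z \<in> W" for v z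
    using patch_dN_tangent[OF patch that] by (simp add: n_def)
  note inn = dderiv_inner[OF WW _ _ UNIV_I]
  have Dvw_n: "dderiv (dderiv D v) w z \<bullet> n z = - (dderiv D v z \<bullet> dderiv n w z)" if z: "z \<in> W" for v w z
  proof -
    have "dderiv (\<lambda>z. dderiv D v z \<bullet> n z) w z = dderiv (\<lambda>z. 0) w z"
      by (rule dderiv_cong[OF WW z UNIV_I]) (rule Dnz)
    then show ?thesis using inn[OF smDi(1) smn z, of v w] by simp
  qed
  have sym: "dderiv D v z \<bullet> dderiv n w z = dderiv D w z \<bullet> dderiv n v z" if z: "z \<in> W" for v w z
    using Dvw_n[OF z, of v w] Dvw_n[OF z, of w v] dderiv_commute[OF pd(3) smD z, of v w] by simp
  \<comment> \<open>\<open>\<Lambda> \<circ> D\<close> is the identity, so its second derivatives vanish\<close>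
  have Dvw_u: "dderiv (dderiv D v) w y \<bullet> u k = 0" for v w k
  proof -
    have "\<Lambda> (dderiv (dderiv D v) w y) = dderiv (\<lambda>z. \<Lambda> (dderiv D v z)) w y"
      by (rule dderiv_linear_outer[OF patch_bounded_linear[OF patch] WW smDi(1) UNIV_I y, symmetric])
    also have "\<dots> = dderiv (\<lambda>z. v) w y"
      by (rule dderiv_cong[OF WW y UNIV_I]) (use patch_dderiv_proj[OF patch] in \<open>simp add: D_def\<close>)
    finally have "\<Lambda> (dderiv (dderiv D v) w y) $ k = 0" by simp
    then show ?thesis by (simp add: \<Lambda>)
  qed
  have Dvw: "dderiv (dderiv D v) w y = (dderiv (dderiv D v) w y \<bullet> \<nu>) *\<^sub>R \<nu>" for v w
    using exp[of "dderiv (dderiv D v) w y"] Dvw_u by simp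
  define T where "T z = (\<Sum>i\<in>UNIV. \<Lambda> (dderiv n (b i) z) $ i)" for z
  have T: "T z = (1/2) * (D z \<bullet> n z) - lam" if "z \<in> W" for z
    using patch_mean_curvature[OF patch cwmc that] by (simp add: T_def n_def D_def b_def)
  have "(\<Sum>i\<in>UNIV. dderiv (dderiv D (b i)) (b i) y) \<bullet> \<nu> = - T y"
    using Dvw_n[OF y] by (simp add: inner_sum_left T_def \<Lambda> \<nu>_def Di sum_negf inner_commute[of "u i" for i])
  moreover have "(\<Sum>i\<in>UNIV. dderiv (dderiv D (b i)) (b i) y) = ((\<Sum>i\<in>UNIV. dderiv (dderiv D (b i)) (b i) y) \<bullet> \<nu>) *\<^sub>R \<nu>"
    using exp[of "\<Sum>i\<in>UNIV. dderiv (dderiv D (b i)) (b i) y"] Dvw_u \<nu>1 by (simp add: inner_sum_left)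
  ultimately show "(\<Sum>i\<in>UNIV. dderiv (dderiv D (b i)) (b i) y) = (lam - (1/2) * (D y \<bullet> n y)) *\<^sub>R n y"
    using T[OF y] by (simp add: \<nu>_def)
  define Z where "Z = (\<Sum>i\<in>UNIV. dderiv (dderiv n (b i)) (b i) y)"
  have Z\<nu>: "Z \<bullet> \<nu> = - (\<Sum>i\<in>UNIV. (norm (dderiv n (b i) y))\<^sup>2)"
  proof -
    have "dderiv (dderiv n v) v y \<bullet> n y = - (norm (dderiv n v y))\<^sup>2" for v
    proof -
      have "dderiv (\<lambda>z. dderiv n v z \<bullet> n z) v y = dderiv (\<lambda>z. 0) v y"
        by (rule dderiv_cong[OF WW y UNIV_I]) (rule nnz)
      then show ?thesis using inn[OF smDi(2) smn y, of v v] by (simp add: power2_norm_eq_inner)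
    qed
    then show ?thesis by (simp add: Z_def inner_sum_left \<nu>_def sum_negf)
  qed
  have Zu: "Z \<bullet> u k = (1/2) * (D y \<bullet> dderiv n (b k) y)" for k
  proof -
    have "dderiv (dderiv n (b i)) (b i) y \<bullet> u k = \<Lambda> (dderiv (dderiv n (b i)) (b k) y) $ i" for i
    proof -
      have "dderiv (\<lambda>z. dderiv D (b k) z \<bullet> dderiv n (b i) z) (b i) y = dderiv (\<lambda>z. dderiv D (b i) z \<bullet> dderiv n (b k) z) (b i) y"
        by (rule dderiv_cong[OF WW y UNIV_I]) (rule sym)
      then have "u k \<bullet> dderiv (dderiv n (b i)) (b i) y + dderiv (dderiv D (b k)) (b i) y \<bullet> dderiv n (b i) y
          = u i \<bullet> dderiv (dderiv n (b k)) (b i) y + dderiv (dderiv D (b i)) (b i) y \<bullet> dderiv n (b k) y"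
        using inn[OF smDi(1) smDi(2) y] by (simp add: Di)
      moreover have "dderiv (dderiv D v) w y \<bullet> dderiv n x y = 0" for v w x
        using Dvw[of v w] nnz[OF y, of x] by (metis \<nu>_def inner_commute inner_scaleR_left mult_zero_right)
      moreover have "dderiv (dderiv n (b k)) (b i) y = dderiv (dderiv n (b i)) (b k) y"
        by (rule dderiv_commute[OF pd(3) smn y])
      ultimately show ?thesis by (simp add: \<Lambda> inner_commute)
    qed
    then have "Z \<bullet> u k = (\<Sum>i\<in>UNIV. \<Lambda> (dderiv (dderiv n (b i)) (b k) y) $ i)"
      by (simp add: Z_def inner_sum_left)
    also have "\<dots> = dderiv T (b k) y"
    proof (rule dderiv_eq[symmetric])
      have "((\<lambda>t. \<Lambda> (dderiv n (b i) (y + t *\<^sub>R b k)) $ i) has_vector_derivative \<Lambda> (dderiv (dderiv n (b i)) (b k) y) $ i) (at 0)" for i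
        by (rule bounded_linear.has_vector_derivative[OF bounded_linear_compose[OF bounded_linear_vec_nth patch_bounded_linear[OF patch]]
            smooth_on_has_dderiv[OF WW smDi(2) UNIV_I y]])
      then show "((\<lambda>t. T (y + t *\<^sub>R b k)) has_vector_derivative (\<Sum>i\<in>UNIV. \<Lambda> (dderiv (dderiv n (b i)) (b k) y) $ i)) (at 0)"
        unfolding T_def by (intro has_vector_derivative_sum)
    qed
    also have "\<dots> = dderiv (\<lambda>z. (1/2) * (D z \<bullet> n z) - lam) (b k) y"
      by (rule dderiv_cong[OF WW y UNIV_I]) (rule T)
    also have "\<dots> = (1/2) * (D y \<bullet> dderiv n (b k) y)"
    proof (rule dderiv_eq)
      have "((\<lambda>t. D (y + t *\<^sub>R b k) \<bullet> n (y + t *\<^sub>R b k)) has_vector_derivative (D y \<bullet> dderiv n (b k) y + dderiv D (b k) y \<bullet> n y)) (at 0)"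
        using bounded_bilinear.has_vector_derivative[OF bounded_bilinear_inner
          smooth_on_has_dderiv[OF WW smD UNIV_I y, of "b k"] smooth_on_has_dderiv[OF WW smn UNIV_I y, of "b k"]] by simp
      then have "((\<lambda>t. D (y + t *\<^sub>R b k) \<bullet> n (y + t *\<^sub>R b k)) has_real_derivative (D y \<bullet> dderiv n (b k) y)) (at 0)"
        using Dnz[OF y] by (simp add: has_real_derivative_iff_has_vector_derivative)
      then have "((\<lambda>t. (1/2) * (D (y + t *\<^sub>R b k) \<bullet> n (y + t *\<^sub>R b k)) - lam) has_real_derivative (1/2) * (D y \<bullet> dderiv n (b k) y)) (at 0)"
        by (auto intro!: derivative_eq_intros)
      then show "((\<lambda>t. (1/2) * (D (y + t *\<^sub>R b k) \<bullet> n (y + t *\<^sub>R b k)) - lam) has_vector_derivative (1/2) * (D y \<bullet> dderiv n (b k) y)) (at 0)"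
        by (simp add: has_real_derivative_iff_has_vector_derivative)
    qed
    finally show ?thesis .
  qed
  have swap: "(\<Sum>k\<in>UNIV. (D y \<bullet> dderiv n (b k) y) *\<^sub>R u k) = (\<Sum>j\<in>UNIV. (D y \<bullet> u j) *\<^sub>R dderiv n (b j) y)"
  proof -
    have nk: "dderiv n (b k) y \<bullet> \<nu> = 0" for k using nnz[OF y] by (simp add: \<nu>_def)
    have "(\<Sum>k\<in>UNIV. (D y \<bullet> dderiv n (b k) y) *\<^sub>R u k)
      = (\<Sum>k\<in>UNIV. \<Sum>j\<in>UNIV. ((D y \<bullet> u j) * (dderiv n (b k) y \<bullet> u j)) *\<^sub>R u k)"
      using nk by (subst parseval) (simp add: scaleR_sum_left)
    also have "\<dots> = (\<Sum>j\<in>UNIV. \<Sum>k\<in>UNIV. ((D y \<bullet> u j) * (dderiv n (b j) y \<bullet> u k)) *\<^sub>R u k)"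
      using sym[OF y, of "b k" "b j" for k j] by (subst sum.swap) (simp add: Di inner_commute)
    also have "\<dots> = (\<Sum>j\<in>UNIV. (D y \<bullet> u j) *\<^sub>R (\<Sum>k\<in>UNIV. (dderiv n (b j) y \<bullet> u k) *\<^sub>R u k))"
      by (simp add: scaleR_sum_right)
    also have "\<dots> = (\<Sum>j\<in>UNIV. (D y \<bullet> u j) *\<^sub>R dderiv n (b j) y)"
      using exp[of "dderiv n (b j) y" for j] nk by simp
    finally show ?thesis .
  qed
  have "(\<Sum>k\<in>UNIV. (Z \<bullet> u k) *\<^sub>R u k) = (1/2) *\<^sub>R (\<Sum>j\<in>UNIV. (D y \<bullet> u j) *\<^sub>R dderiv n (b j) y)"
    unfolding swap[symmetric] by (simp add: Zu scaleR_sum_right)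
  then show "Z = - (\<Sum>i\<in>UNIV. (norm (dderiv n (b i) y))\<^sup>2) *\<^sub>R n y + (1/2) *\<^sub>R (\<Sum>j\<in>UNIV. (D y \<bullet> u j) *\<^sub>R dderiv n (b j) y)"
    using exp[of Z] Z\<nu> by (simp add: \<nu>_def)
qed

text \<open>
  At a minimum of \<open>w = N \<bullet> e + \<phi>(|F - a|\<^sup>2)\<close> the Laplacian of \<open>w\<close> is nonnegative and the gradients of the
  two summands cancel, so the gradient term in the equation for \<open>N \<bullet> e\<close> can be expressed by \<open>\<phi>\<close>.
  What remains is \<open>|A|\<^sup>2 (N \<bullet> e) \<le> L(\<phi>(|F - a|\<^sup>2))\<close> for the drift Laplacian \<open>L\<close>; \<open>K\<close> is
  \<open>|A|\<^sup>2\<close>. This inequality is the only form in which the curvature equation enters the maximum principles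
  below, each of which is a choice of \<open>\<phi>\<close> and \<open>a\<close>.
\<close>
lemma local_min_inequality:
  assumes cwmc: "constant_weighted_mean_curvature UNIV A F N lam"
    and c: "c \<in> A" "p \<in> fst c"
    and U: "openin M U" "p \<in> U"
    and min: "\<And>q. q \<in> U \<Longrightarrow> N p \<bullet> e + \<phi> ((norm (F p - a))\<^sup>2) \<le> N q \<bullet> e + \<phi> ((norm (F q - a))\<^sup>2)"
    and \<phi>1: "\<And>s. (\<phi> has_real_derivative \<phi>1 s) (at s)"
    and \<phi>2: "(\<phi>1 has_real_derivative \<phi>2) (at ((norm (F p - a))\<^sup>2))"
  obtains K where "K \<ge> 0" "\<And>v. K = 0 \<Longrightarrow> differential c N p v = 0"
    "K * (N p \<bullet> e) \<le> 4 * \<phi>2 * ((norm (F p - a))\<^sup>2 - ((F p - a) \<bullet> N p)\<^sup>2)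
      + \<phi>1 ((norm (F p - a))\<^sup>2) * (2 * CARD('n) + 2 * lam * ((F p - a) \<bullet> N p) - F p \<bullet> (F p - a))"
proof -
  obtain u :: "'n \<Rightarrow> 'e" and \<Lambda> W \<sigma> y
    where frame: "\<And>i j. u i \<bullet> u j = (if i = j then 1 else 0)" "\<And>i. u i \<bullet> N p = 0"
    "\<And>z. z = (z \<bullet> N p) *\<^sub>R N p + (\<Sum>i\<in>UNIV. (z \<bullet> u i) *\<^sub>R u i)"
    and \<Lambda>_def: "\<And>z. \<Lambda> z = (\<chi> i. z \<bullet> u i)" and patch: "patch c \<Lambda> W \<sigma>" and y: "y \<in> W" "p = \<sigma> y"
    by (rule frame_patch[OF c]) blast
  note parseval = frame_parseval[of "N p" u UNIV, OF frame(3)]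
  note pd = patchD[OF patch]
  note WW = subspace_UNIV pd(10)
  define D where "D = F \<circ> \<sigma>"
  define n where "n = N \<circ> \<sigma>"
  define b where "b i = (axis i 1 :: real^'n)" for i
  note ge = gauss_map_equation[OF cwmc patch y(1) frame[unfolded y(2)] \<Lambda>_def, folded D_def n_def, folded b_def]
  have smD: "smooth_on UNIV W D" and smn: "smooth_on UNIV W n"
    using patch_smooth[OF patch] by (simp_all add: D_def n_def)
  have smDi: "smooth_on UNIV W (dderiv D v)" "smooth_on UNIV W (dderiv n v)" for v
    using smooth_on_dderiv[OF WW _ UNIV_I] smD smn by blast+
  define \<rho> where "\<rho> z = (D z - a) \<bullet> (D z - a)" for z
  define \<rho>1 where "\<rho>1 v z = 2 * ((D z - a) \<bullet> dderiv D v z)" for v z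
  have Dy: "D y = F p" "n y = N p" using y by (auto simp: D_def n_def)
  have \<rho>y: "\<rho> y = (norm (F p - a))\<^sup>2" by (simp add: \<rho>_def Dy power2_norm_eq_inner)
  have dD: "((\<lambda>t. D (z + t *\<^sub>R v) - a) has_vector_derivative dderiv D v z) (at 0)" if "z \<in> W" for v z
    using has_vector_derivative_diff[OF smooth_on_has_dderiv[OF WW smD UNIV_I that, of v] has_vector_derivative_const[of a]] by simp
  have d\<rho>: "((\<lambda>t. \<rho> (z + t *\<^sub>R v)) has_vector_derivative \<rho>1 v z) (at 0)" if "z \<in> W" for v z
    using bounded_bilinear.has_vector_derivative[OF bounded_bilinear_inner dD[OF that, of v] dD[OF that, of v]]
    by (simp add: \<rho>_def \<rho>1_def inner_commute)
  have d\<rho>1: "((\<lambda>t. \<rho>1 v (y + t *\<^sub>R v)) has_real_derivative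
      2 * ((D y - a) \<bullet> dderiv (dderiv D v) v y + dderiv D v y \<bullet> dderiv D v y)) (at 0)" for v
  proof -
    have "((\<lambda>t. (D (y + t *\<^sub>R v) - a) \<bullet> dderiv D v (y + t *\<^sub>R v)) has_real_derivative
      ((D y - a) \<bullet> dderiv (dderiv D v) v y + dderiv D v y \<bullet> dderiv D v y)) (at 0)"
      using bounded_bilinear.has_vector_derivative[OF bounded_bilinear_inner dD[OF y(1), of v]
          smooth_on_has_dderiv[OF WW smDi(1) UNIV_I y(1), of v v]]
      by (simp add: has_real_derivative_iff_has_vector_derivative)
    then show ?thesis unfolding \<rho>1_def by (auto intro!: derivative_eq_intros)
  qed
  have test: "dderiv n v y \<bullet> e + \<phi>1 (\<rho> y) * \<rho>1 v y = 0 \<and>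
    0 \<le> dderiv (dderiv n v) v y \<bullet> e + (\<phi>2 * \<rho>1 v y * \<rho>1 v y
        + \<phi>1 (\<rho> y) * (2 * ((D y - a) \<bullet> dderiv (dderiv D v) v y + dderiv D v y \<bullet> dderiv D v y)))" for v
  proof -
    define f where "f t = n (y + t *\<^sub>R v) \<bullet> e + \<phi> (\<rho> (y + t *\<^sub>R v))" for t :: real
    define f1 where "f1 t = dderiv n v (y + t *\<^sub>R v) \<bullet> e + \<phi>1 (\<rho> (y + t *\<^sub>R v)) * \<rho>1 v (y + t *\<^sub>R v)" for t :: real
    define f2 where "f2 = dderiv (dderiv n v) v y \<bullet> e + (\<phi>2 * \<rho>1 v y * \<rho>1 v y
        + \<phi>1 (\<rho> y) * (2 * ((D y - a) \<bullet> dderiv (dderiv D v) v y + dderiv D v y \<bullet> dderiv D v y)))"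
    have inW: "\<forall>\<^sub>F t in nhds 0. y + t *\<^sub>R v \<in> W"
      by (rule line_eventually_in[OF WW y(1) UNIV_I])
    have 1: "\<forall>\<^sub>F t in nhds 0. (f has_real_derivative f1 t) (at t)"
      using inW
    proof eventually_elim
      case (elim t)
      have a: "((\<lambda>t. n (y + t *\<^sub>R v) \<bullet> e) has_real_derivative dderiv n v (y + t *\<^sub>R v) \<bullet> e) (at t)"
        unfolding has_real_derivative_iff_has_vector_derivative
        by (rule bounded_linear.has_vector_derivative[OF bounded_linear_inner_left
              line_derivative_shift[OF smooth_on_has_dderiv[OF WW smn UNIV_I elim]]])
      have b: "((\<lambda>t. \<rho> (y + t *\<^sub>R v)) has_real_derivative \<rho>1 v (y + t *\<^sub>R v)) (at t)"
        unfolding has_real_derivative_iff_has_vector_derivative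
        by (rule line_derivative_shift[OF d\<rho>[OF elim]])
      show ?case
        unfolding f_def f1_def by (rule DERIV_add[OF a DERIV_chain2[OF \<phi>1 b]])
    qed
    have 2: "(f1 has_real_derivative f2) (at 0)"
    proof -
      have a: "((\<lambda>t. dderiv n v (y + t *\<^sub>R v) \<bullet> e) has_real_derivative dderiv (dderiv n v) v y \<bullet> e) (at 0)"
        unfolding has_real_derivative_iff_has_vector_derivative
        by (rule bounded_linear.has_vector_derivative[OF bounded_linear_inner_left
            smooth_on_has_dderiv[OF WW smDi(2) UNIV_I y(1)]])
      have b: "((\<lambda>t. \<rho> (y + t *\<^sub>R v)) has_real_derivative \<rho>1 v y) (at 0)"
        unfolding has_real_derivative_iff_has_vector_derivative by (rule d\<rho>[OF y(1)])
      have "(\<phi>1 has_real_derivative \<phi>2) (at (\<rho> (y + 0 *\<^sub>R v)))" using \<phi>2 \<rho>y by simp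
      from DERIV_chain2[OF this b]
      have c: "((\<lambda>t. \<phi>1 (\<rho> (y + t *\<^sub>R v))) has_real_derivative \<phi>2 * \<rho>1 v y) (at 0)" .
      from DERIV_add[OF a DERIV_mult[OF c d\<rho>1[of v]]]
      show ?thesis unfolding f1_def f2_def by (simp add: algebra_simps)
    qed
    have 3: "\<forall>\<^sub>F t in nhds 0. f 0 \<le> f t"
    proof -
      have "openin (top_of_set W) {z \<in> W. \<sigma> z \<in> U}"
        using pd(6) U(1) unfolding continuous_map_def by auto
      then have "openin (top_of_set UNIV) {z \<in> W. \<sigma> z \<in> U}"
        using pd(3) by (metis open_openin openin_open_trans subtopology_UNIV)
      from line_eventually_in[OF subspace_UNIV this, of y v]
      have "\<forall>\<^sub>F t in nhds 0. y + t *\<^sub>R v \<in> {z \<in> W. \<sigma> z \<in> U}" using y U(2) by auto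
      then show ?thesis
      proof eventually_elim
        case (elim t)
        then show ?case using min[of "\<sigma> (y + t *\<^sub>R v)"]
          by (simp add: f_def n_def \<rho>_def D_def y(2) power2_norm_eq_inner)
      qed
    qed
    from second_derivative_test[OF 1 2 3] show ?thesis by (simp add: f1_def f2_def)
  qed
  define K where "K = (\<Sum>i\<in>UNIV. (norm (dderiv n (b i) y))\<^sup>2)"
  define s where "s = (F p - a) \<bullet> N p"
  define X where "X = \<phi>1 (\<rho> y)"
  have cross: "(\<Sum>i\<in>UNIV. (F p \<bullet> u i) * ((F p - a) \<bullet> u i)) = F p \<bullet> (F p - a) - (F p \<bullet> N p) * s"
    using parseval[of "F p" "F p - a"] by (simp add: s_def)
  have square: "(\<Sum>i\<in>UNIV. ((F p - a) \<bullet> u i)\<^sup>2) = (norm (F p - a))\<^sup>2 - s\<^sup>2"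
    using parseval[of "F p - a" "F p - a"] by (simp add: s_def dot_square_norm power2_eq_square)
  have ne: "dderiv n (b i) y \<bullet> e = - 2 * X * ((F p - a) \<bullet> u i)" for i
    using test[of "b i"] by (simp add: \<rho>1_def ge(1) Dy X_def)
  have "0 \<le> (\<Sum>i\<in>UNIV. dderiv (dderiv n (b i)) (b i) y \<bullet> e + (\<phi>2 * \<rho>1 (b i) y * \<rho>1 (b i) y
        + X * (2 * ((D y - a) \<bullet> dderiv (dderiv D (b i)) (b i) y + dderiv D (b i) y \<bullet> dderiv D (b i) y))))"
    using test by (intro sum_nonneg) (auto simp: X_def)
  also have "\<dots> = (\<Sum>i\<in>UNIV. dderiv (dderiv n (b i)) (b i) y \<bullet> e + (4 * \<phi>2 * ((F p - a) \<bullet> u i)\<^sup>2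
      + 2 * X * ((F p - a) \<bullet> dderiv (dderiv D (b i)) (b i) y + 1)))"
    by (intro sum.cong refl) (simp add: \<rho>1_def ge(1) Dy frame(1) power2_eq_square)
  also have "\<dots> = (\<Sum>i\<in>UNIV. dderiv (dderiv n (b i)) (b i) y) \<bullet> e + 4 * \<phi>2 * (\<Sum>i\<in>UNIV. ((F p - a) \<bullet> u i)\<^sup>2)
      + 2 * X * ((F p - a) \<bullet> (\<Sum>i\<in>UNIV. dderiv (dderiv D (b i)) (b i) y) + CARD('n))"
    by (simp add: sum.distrib inner_sum_left inner_sum_right flip: sum_distrib_left)
  also have "(\<Sum>i\<in>UNIV. dderiv (dderiv n (b i)) (b i) y) \<bullet> e = - K * (N p \<bullet> e) - X * (F p \<bullet> (F p - a) - (F p \<bullet> N p) * s)"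
    unfolding ge(3) cross[symmetric]
    by (simp add: inner_diff_left inner_add_left inner_sum_left Dy K_def ne sum_distrib_left sum_negf ac_simps)
      (intro sum.cong refl, simp add: field_simps)
  also have "(\<Sum>i\<in>UNIV. dderiv (dderiv D (b i)) (b i) y) = (lam - (1/2) * (F p \<bullet> N p)) *\<^sub>R N p"
    unfolding ge(2) Dy ..
  finally have ineq: "K * (N p \<bullet> e) \<le> 4 * \<phi>2 * ((norm (F p - a))\<^sup>2 - s\<^sup>2)
      + X * (2 * CARD('n) + 2 * lam * s - F p \<bullet> (F p - a))"
    unfolding square by (simp add: s_def algebra_simps)
  have K0: "K \<ge> 0" unfolding K_def by (intro sum_nonneg) auto
  have "differential c N p v = 0" if "K = 0" for v
  proof -
    have n0: "dderiv n (b i) y = 0" for i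
      using that unfolding K_def by (subst (asm) sum_nonneg_eq_0_iff) auto
    have "dderiv n w y = 0" for w
    proof -
      have "w = (\<Sum>i\<in>UNIV. (w $ i) *\<^sub>R b i)"
        unfolding b_def by (simp add: basis_expansion flip: scalar_mult_eq_scaleR)
      then have "dderiv n w y = dderiv n (\<Sum>i\<in>UNIV. (w $ i) *\<^sub>R b i) y" by simp
      also have "\<dots> = 0"
        using linear_sum[OF patch_dderiv_linear(2)[OF patch y(1), folded n_def], of "\<lambda>i. (w $ i) *\<^sub>R b i" UNIV]
          linear_scale[OF patch_dderiv_linear(2)[OF patch y(1), folded n_def]] n0 by simp
      finally show ?thesis .
    qed
    then show ?thesis
      using patch_dderiv_chart[OF patch chart_facts(5)[OF c(1)] y(1), of v] y(2) by (simp add: n_def)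
  qed
  then show ?thesis using that[OF K0] ineq unfolding X_def \<rho>y s_def by blast
qed

end

section \<open>The angle function attains its minimum\<close>

lemma compactin_attains_min:
  assumes "compactin M K" "K \<noteq> {}" "continuous_map M euclideanreal f"
  obtains p where "p \<in> K" "\<And>q. q \<in> K \<Longrightarrow> f p \<le> f q"
proof -
  have "compact (f ` K)" using image_compactin[OF assms(1,3)] by simp
  then obtain s where "s \<in> f ` K" "\<forall>t\<in>f ` K. s \<le> t"
    using compact_attains_inf[of "f ` K"] assms(2) by auto
  then show ?thesis using that by auto
qed

context immersed_hypersurface
begin

lemma connected: "connected_space M" and nonempty: "topspace M \<noteq> {}"
  using hypersurface by (auto simp: hypersurface_def)

lemma constant_of_zero_differential:
  fixes f :: "'p \<Rightarrow> 'b::real_normed_vector"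
  assumes sm: "\<And>c. c \<in> A \<Longrightarrow> smooth_on UNIV (snd c ` fst c) (f \<circ> chart_inv c)"
    and zero: "\<And>c p v. c \<in> A \<Longrightarrow> p \<in> fst c \<Longrightarrow> differential c f p v = 0"
    and p: "p \<in> topspace M" "q \<in> topspace M"
  shows "f p = f q"
proof -
  have cont: "continuous_map M euclidean f" by (rule continuous_map_of_charts[OF sm])
  have "f q = f p"
  proof (rule connected_space_propagate[OF connected, of "\<lambda>q. f q = f p", OF _ _ p(1) refl p(2)])
    have "closedin M {x \<in> topspace M. f x \<in> {f p}}"
      by (rule closedin_continuous_map_preimage[OF cont]) simp
    then show "closedin M {x \<in> topspace M. f x = f p}" by simp
    fix x assume x: "x \<in> topspace M" "f x = f p"
    obtain c where c: "c \<in> A" "x \<in> fst c" using chart_at[OF x(1)] .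
    define V where "V = snd c ` fst c"
    have V: "open V" "snd c x \<in> V" using chart_facts(2)[OF c(1)] c(2) by (auto simp: V_def)
    obtain r where r: "r > 0" "ball (snd c x) r \<subseteq> V" using V by (meson open_contains_ball)
    have hd: "(f \<circ> chart_inv c has_derivative (\<lambda>h. 0)) (at y within ball (snd c x) r)" if "y \<in> ball (snd c x) r" for y
    proof -
      have yV: "y \<in> V" using r that by auto
      have "(f \<circ> chart_inv c has_derivative (\<lambda>h. dderiv (f \<circ> chart_inv c) h y)) (at y)"
        by (rule smooth_on_has_derivative[OF V(1) _ yV]) (use sm[OF c(1)] in \<open>simp add: V_def\<close>)
      moreover have "dderiv (f \<circ> chart_inv c) h y = 0" for h
        using zero[OF c(1), of "chart_inv c y" h] chart_inv_simps(2,3)[OF c(1)] yV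
        by (simp add: differential_eq V_def)
      ultimately show ?thesis by (simp add: has_derivative_at_withinI)
    qed
    have const: "(f \<circ> chart_inv c) y = f x" if y: "y \<in> ball (snd c x) r" for y
    proof -
      have "(f \<circ> chart_inv c) y = (f \<circ> chart_inv c) (snd c x)"
        using has_derivative_zero_unique[OF convex_ball hd y, of "snd c x"] r by auto
      then show ?thesis using chart_inv_simps(1)[OF c] by simp
    qed
    have "continuous_map (subtopology M (fst c)) euclidean (snd c)"
      using chart_facts(3)[OF c(1)] by (simp add: homeomorphic_maps_def continuous_map_in_subtopology)
    then have "openin (subtopology M (fst c)) {q \<in> topspace (subtopology M (fst c)). snd c q \<in> ball (snd c x) r}"
      by (rule openin_continuous_map_preimage) simp
    then have "openin M {q \<in> topspace (subtopology M (fst c)). snd c q \<in> ball (snd c x) r}"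
      using chart_facts(1)[OF c(1)] by (metis openin_trans_full)
    moreover have "f q = f x" if "q \<in> fst c" "snd c q \<in> ball (snd c x) r" for q
      using const[OF that(2)] chart_inv_simps(1)[OF c(1) that(1)] by simp
    ultimately show "\<exists>U. openin M U \<and> x \<in> U \<and> (\<forall>q\<in>U. f q = f p)"
      using c(2) x r by (intro exI[of _ "{q \<in> topspace (subtopology M (fst c)). snd c q \<in> ball (snd c x) r}"]) auto
  qed
  then show ?thesis by simp
qed

text \<open>
  If a secant were the multiple \<open>s N(x)\<close> of the normal, its projection would be \<open>s \<Lambda>(N(x))\<close>, and the mean
  value theorem for the component along \<open>N(x)\<close> would give \<open>s = s G(x, \<xi>)\<close> at an intermediate point,
  where \<open>G\<close> is a continuous function that vanishes on the diagonal. Near the diagonal this forces \<open>s = 0\<close>.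
  The lemma provides the nonzero gradient of the barrier in Hopf's argument.
\<close>
lemma patch_secant_not_normal:
  assumes patch: "patch c \<Lambda> W \<sigma>" and y: "y \<in> W"
  obtains r where "r > 0" "ball y r \<subseteq> W"
    "\<And>x x' s. x \<in> ball y r \<Longrightarrow> x' \<in> ball y r \<Longrightarrow> F (\<sigma> x) - F (\<sigma> x') = s *\<^sub>R N (\<sigma> x) \<Longrightarrow> x = x'"
proof -
  note pd = patchD[OF patch]
  note WW = subspace_UNIV pd(10)
  define D where "D = F \<circ> \<sigma>"
  define n where "n = N \<circ> \<sigma>"
  have smD: "smooth_on UNIV W D" and smn: "smooth_on UNIV W n"
    using patch_smooth[OF patch] by (simp_all add: D_def n_def)
  define G where "G z = (\<Sum>i\<in>UNIV. (\<Lambda> (n (fst z)) $ i) * (dderiv D (axis i 1) (snd z) \<bullet> n (fst z)))" for z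
  have G: "G (x, \<xi>) = dderiv D (\<Lambda> (n x)) \<xi> \<bullet> n x" if "\<xi> \<in> W" for x \<xi>
  proof -
    have "\<Lambda> (n x) = (\<Sum>i\<in>UNIV. (\<Lambda> (n x) $ i) *\<^sub>R axis i 1)"
      by (simp add: basis_expansion flip: scalar_mult_eq_scaleR)
    then have "dderiv D (\<Lambda> (n x)) \<xi> = dderiv D (\<Sum>i\<in>UNIV. (\<Lambda> (n x) $ i) *\<^sub>R axis i 1) \<xi>" by simp
    also have "\<dots> = (\<Sum>i\<in>UNIV. (\<Lambda> (n x) $ i) *\<^sub>R dderiv D (axis i 1) \<xi>)"
      using linear_sum[OF patch_dderiv_linear(1)[OF patch that, folded D_def], of "\<lambda>i. (\<Lambda> (n x) $ i) *\<^sub>R axis i 1" UNIV]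
        linear_scale[OF patch_dderiv_linear(1)[OF patch that, folded D_def]] by simp
    finally show ?thesis by (simp add: G_def inner_sum_left)
  qed
  have "continuous_on (W \<times> W) G"
  proof -
    have cn: "continuous_on (W \<times> W) (\<lambda>z. n (fst z))"
      by (rule continuous_on_compose2[OF smooth_on_continuous[OF smn]]) (auto intro: continuous_intros)
    have cD: "continuous_on (W \<times> W) (\<lambda>z. dderiv D v (snd z))" for v
      by (rule continuous_on_compose2[OF smooth_on_continuous[OF smooth_on_dderiv[OF WW smD UNIV_I]]])
        (auto intro: continuous_intros)
    have cL: "continuous_on (W \<times> W) (\<lambda>z. \<Lambda> (n (fst z)) $ i)" for i
      by (intro bounded_linear.continuous_on[OF bounded_linear_vec_nth]
          bounded_linear.continuous_on[OF patch_bounded_linear[OF patch]] cn)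
    show ?thesis unfolding G_def
      by (intro continuous_on_sum continuous_on_mult cL continuous_on_inner cD cn)
  qed
  then have "isCont G (y, y)"
    using pd(3) y by (simp add: continuous_on_eq_continuous_at open_Times)
  moreover have "G (y, y) = 0"
    using G[OF y] patch_dderiv_normal[OF patch y] by (simp add: D_def n_def)
  ultimately have "\<forall>\<^sub>F z in nhds (y, y). dist (G z) 0 < 1"
    unfolding isCont_def tendsto_at_iff_tendsto_nhds by (auto simp: tendsto_iff)
  moreover have "\<forall>\<^sub>F z in nhds (y, y). z \<in> W \<times> W"
    using pd(3) y by (intro eventually_nhds_in_open) (auto simp: open_Times)
  ultimately have "\<forall>\<^sub>F z in nhds (y, y). dist (G z) 0 < 1 \<and> z \<in> W \<times> W" by eventually_elim simp
  then obtain r where r: "r > 0" "\<And>z. dist z (y, y) < r \<Longrightarrow> dist (G z) 0 < 1 \<and> z \<in> W \<times> W"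
    unfolding eventually_nhds_metric by blast
  have near: "dist (x, \<xi>) (y, y) < r" if "x \<in> ball y (r/2)" "\<xi> \<in> ball y (r/2)" for x \<xi>
  proof -
    have "dist (x, \<xi>) (y, y) \<le> dist x y + dist \<xi> y"
      unfolding dist_Pair_Pair by (rule sqrt_sum_squares_le_sum) auto
    then show ?thesis using that by (simp add: dist_commute)
  qed
  have bW: "ball y (r/2) \<subseteq> W"
  proof
    fix x assume "x \<in> ball y (r/2)"
    then show "x \<in> W" using r(2)[OF near[of x x]] by auto
  qed
  show ?thesis
  proof (rule that[of "r/2"])
    show "r/2 > 0" using r by simp
    show "ball y (r/2) \<subseteq> W" by (rule bW)
    fix x x' s assume x: "x \<in> ball y (r/2)" "x' \<in> ball y (r/2)" "F (\<sigma> x) - F (\<sigma> x') = s *\<^sub>R N (\<sigma> x)"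
    have "D x - D x' = s *\<^sub>R n x" using x(3) by (simp add: D_def n_def)
    then have eq: "x - x' = s *\<^sub>R \<Lambda> (n x)"
    proof -
      have "x - x' = \<Lambda> (D x - D x')"
        using pd(8) bW x(1,2) by (simp add: D_def linear_diff[OF pd(2)] subset_iff)
      then show ?thesis using \<open>D x - D x' = s *\<^sub>R n x\<close> by (simp add: linear_scale[OF pd(2)])
    qed
    have seg: "x' + t *\<^sub>R (x - x') \<in> ball y (r/2)" if "0 \<le> t" "t \<le> 1" for t
    proof -
      have "(1 - t) *\<^sub>R x' + t *\<^sub>R x \<in> ball y (r/2)"
        using convexD[OF convex_ball x(2,1), of "1 - t" t] that by simp
      then show ?thesis by (simp add: algebra_simps)
    qed
    define f where "f t = D (x' + t *\<^sub>R (x - x')) \<bullet> n x" for t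
    have "\<exists>t>0. t < 1 \<and> f 1 - f 0 = (1 - 0) * (dderiv D (x - x') (x' + t *\<^sub>R (x - x')) \<bullet> n x)"
    proof (rule MVT2)
      fix t :: real assume "0 \<le> t" "t \<le> 1"
      then have "x' + t *\<^sub>R (x - x') \<in> W" using seg bW by blast
      then show "(f has_real_derivative (dderiv D (x - x') (x' + t *\<^sub>R (x - x')) \<bullet> n x)) (at t)"
        unfolding f_def has_real_derivative_iff_has_vector_derivative
        by (rule bounded_linear.has_vector_derivative[OF bounded_linear_inner_left
            line_derivative_shift[OF smooth_on_has_dderiv[OF WW smD UNIV_I]]])
    qed simp
    then obtain t where t: "0 < t" "t < 1" "f 1 - f 0 = dderiv D (x - x') (x' + t *\<^sub>R (x - x')) \<bullet> n x" by auto
    define \<xi> where "\<xi> = x' + t *\<^sub>R (x - x')"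
    have \<xi>: "\<xi> \<in> ball y (r/2)" using seg t by (simp add: \<xi>_def)
    have "n x \<bullet> n x = 1" using norm_N[OF pd(9)] bW x(1) by (auto simp: n_def norm_eq_1)
    then have "f 1 - f 0 = s"
      using \<open>D x - D x' = s *\<^sub>R n x\<close> by (simp add: f_def flip: inner_diff_left)
    moreover have "dderiv D (x - x') \<xi> = s *\<^sub>R dderiv D (\<Lambda> (n x)) \<xi>"
      unfolding eq using linear_scale[OF patch_dderiv_linear(1)[OF patch, folded D_def]] \<xi> bW by blast
    ultimately have "s = s * G (x, \<xi>)"
      using t(3) G[of \<xi> x] \<xi> bW by (auto simp: \<xi>_def[symmetric])
    moreover have "\<bar>G (x, \<xi>)\<bar> < 1" using r(2)[OF near[OF x(1) \<xi>]] by simp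
    ultimately have "s = 0" by auto
    then show "x = x'" using eq by simp
  qed
qed

end

locale proper_lambda_hypersurface = immersed_hypersurface M A F N
  for M :: "'p topology" and A :: "('p, real^'n) chart set" and F N :: "'p \<Rightarrow> 'e::euclidean_space" +
  fixes lam :: real
  assumes proper: "proper_map M euclidean F"
    and cwmc: "constant_weighted_mean_curvature UNIV A F N lam"
begin

lemma compact_sublevel: "compactin M {p \<in> topspace M. norm (F p) \<le> R}"
  using compactin_proper_map_preimage[OF proper, of "cball 0 R"] by simp

lemma continuous_inner_N: "continuous_map M euclideanreal (\<lambda>p. N p \<bullet> e)"
  using continuous_map_compose[OF continuous_N, of euclideanreal "\<lambda>x. x \<bullet> e"]
  by (simp add: o_def continuous_on_inner)

text \<open>
  Taking \<open>\<phi>(s) = \<epsilon> s\<close> and \<open>a = 0\<close>, the drift Laplacian of \<open>|F|\<^sup>2\<close> is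
  \<open>2n + 2 lam (F \<bullet> N) - |F|\<^sup>2\<close>, which is negative where \<open>|F| > R0\<close>. As \<open>F\<close> is proper,
  \<open>N \<bullet> e + \<epsilon> |F|\<^sup>2\<close> has a minimum. If \<open>N \<bullet> e\<close> were somewhere below its minimum over \<open>|F| \<le> R0\<close>, then for
  small \<open>\<epsilon>\<close> this minimum would lie in \<open>|F| > R0\<close>, against \<open>local_min_inequality\<close>. Khasminskii's test for
  parabolicity works in the same way; it takes the place of estimates for the weighted volume.
\<close>
lemma angle_attains_min:
  assumes pos: "\<And>p. p \<in> topspace M \<Longrightarrow> 0 \<le> N p \<bullet> e"
  obtains p where "p \<in> topspace M" "\<And>q. q \<in> topspace M \<Longrightarrow> N p \<bullet> e \<le> N q \<bullet> e"
proof -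
  obtain p1 where p1: "p1 \<in> topspace M" using nonempty by blast
  define R0 where "R0 = max (norm (F p1)) (2 * \<bar>lam\<bar> + 2 * CARD('n) + 1)"
  define Kc where "Kc R = {p \<in> topspace M. norm (F p) \<le> R}" for R
  have far: "2 * CARD('n) + 2 * lam * (F p \<bullet> N p) - F p \<bullet> F p < 0" if "p \<in> topspace M" "R0 < norm (F p)" for p
  proof -
    have "\<bar>F p \<bullet> N p\<bar> \<le> norm (F p)"
      using Cauchy_Schwarz_ineq2[of "F p" "N p"] norm_N[OF that(1)] by simp
    then have "lam * (F p \<bullet> N p) \<le> \<bar>lam\<bar> * norm (F p)"
      by (metis abs_ge_self abs_mult mult_left_mono abs_ge_zero order_trans)
    moreover have "(2 * \<bar>lam\<bar> + 2 * CARD('n) + 1) * norm (F p) \<le> norm (F p) * norm (F p)"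
      using that(2) by (intro mult_right_mono) (auto simp: R0_def)
    moreover have "norm (F p) \<ge> 1"
      using that(2) abs_ge_zero[of lam] of_nat_0_le_iff[of "CARD('n)"] unfolding R0_def by linarith
    then have "(2 * CARD('n) + 1) * norm (F p) \<ge> 2 * CARD('n) + 1"
      using mult_left_mono[of 1 "norm (F p)" "2 * real CARD('n) + 1"] by simp
    ultimately show ?thesis by (simp add: dot_square_norm power2_eq_square algebra_simps)
  qed
  obtain p0 where p0: "p0 \<in> Kc R0" "\<And>q. q \<in> Kc R0 \<Longrightarrow> N p0 \<bullet> e \<le> N q \<bullet> e"
  proof -
    have "Kc R0 \<noteq> {}" using p1 by (auto simp: Kc_def R0_def)
    from compactin_attains_min[OF compact_sublevel[of R0, folded Kc_def] this continuous_inner_N, of e]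
    show ?thesis using that by blast
  qed
  define m where "m = N p0 \<bullet> e"
  have m0: "m \<ge> 0" using pos p0 by (auto simp: m_def Kc_def)
  have "m \<le> N q \<bullet> e" if q: "q \<in> topspace M" for q
  proof (rule ccontr)
    assume "\<not> m \<le> N q \<bullet> e"
    then have lt: "N q \<bullet> e < m" by simp
    define g where "g = (norm (F q))\<^sup>2 + 1"
    have g: "g > 0" by (simp add: g_def add_nonneg_pos)
    define \<epsilon> where "\<epsilon> = (m - N q \<bullet> e) / (2 * g)"
    have \<epsilon>: "\<epsilon> > 0" using lt g by (simp add: \<epsilon>_def)
    have "\<epsilon> * ((norm (F q))\<^sup>2 + 1) = (m - N q \<bullet> e) / 2"
      using g by (simp add: \<epsilon>_def flip: g_def)
    then have \<epsilon>q: "N q \<bullet> e + \<epsilon> * (norm (F q))\<^sup>2 < m" using lt \<epsilon> by (simp add: algebra_simps)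
    define w where "w p = N p \<bullet> e + \<epsilon> * (norm (F p))\<^sup>2" for p
    have cw: "continuous_map M euclideanreal w"
      unfolding w_def
      by (intro continuous_map_add continuous_inner_N continuous_map_real_mult continuous_map_real_pow continuous_map_norm continuous_F) simp
    \<comment> \<open>at radius \<open>R1\<close> the penalty exceeds \<open>m\<close>, so the minimum over the ball is interior\<close>
    define R1 where "R1 = max (norm (F q)) (m / \<epsilon> + 1)"
    obtain p where p: "p \<in> Kc R1" "\<And>q. q \<in> Kc R1 \<Longrightarrow> w p \<le> w q"
    proof -
      have "Kc R1 \<noteq> {}" using q by (auto simp: Kc_def R1_def)
      from compactin_attains_min[OF compact_sublevel[of R1, folded Kc_def] this cw]
      show ?thesis using that by blast
    qed
    have wp: "w p < m" using p(2)[of q] q \<epsilon>q by (simp add: Kc_def R1_def w_def)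
    have pM: "p \<in> topspace M" using p(1) by (simp add: Kc_def)
    have inner: "norm (F p) < R1"
    proof (rule ccontr)
      assume "\<not> norm (F p) < R1"
      then have "m / \<epsilon> + 1 \<le> norm (F p)" by (simp add: R1_def)
      moreover have "m / \<epsilon> \<ge> 0" using m0 \<epsilon> by simp
      ultimately have "m / \<epsilon> \<le> (norm (F p))\<^sup>2"
        using mult_mono[of 1 "norm (F p)" "m / \<epsilon>" "norm (F p)"] by (simp add: power2_eq_square)
      then have "m \<le> \<epsilon> * (norm (F p))\<^sup>2" using \<epsilon> by (simp add: field_simps)
      then show False using wp pos[OF pM] by (simp add: w_def)
    qed
    have out: "R0 < norm (F p)"
    proof (rule ccontr)
      assume "\<not> R0 < norm (F p)"
      then have "m \<le> N p \<bullet> e" using p0(2)[of p] pM by (simp add: Kc_def m_def)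
      moreover have "0 \<le> \<epsilon> * (norm (F p))\<^sup>2" using \<epsilon> by simp
      ultimately show False using wp by (simp add: w_def)
    qed
    obtain c where c: "c \<in> A" "p \<in> fst c" using chart_at[OF pM] .
    define U where "U = {q \<in> topspace M. norm (F q) \<in> {..<R1}}"
    have U: "openin M U" unfolding U_def
      by (rule openin_continuous_map_preimage[OF continuous_map_norm[OF continuous_F]]) simp
    have pU: "p \<in> U" using pM inner by (simp add: U_def)
    have Umin: "N p \<bullet> e + \<epsilon> * (norm (F p - 0))\<^sup>2 \<le> N q \<bullet> e + \<epsilon> * (norm (F q - 0))\<^sup>2" if "q \<in> U" for q
      using p(2)[of q] that by (simp add: U_def Kc_def w_def)
    have d1: "((\<lambda>s. \<epsilon> * s) has_real_derivative (\<lambda>s. \<epsilon>) s) (at s)" for s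
      by (auto intro!: derivative_eq_intros)
    have d2: "((\<lambda>s. \<epsilon>) has_real_derivative 0) (at s)" for s :: real by simp
    obtain K where "K \<ge> 0" "K * (N p \<bullet> e) \<le> 4 * 0 * ((norm (F p - 0))\<^sup>2 - ((F p - 0) \<bullet> N p)\<^sup>2)
      + \<epsilon> * (2 * CARD('n) + 2 * lam * ((F p - 0) \<bullet> N p) - F p \<bullet> (F p - 0))"
      by (rule local_min_inequality[OF cwmc c U pU Umin d1 d2]) blast
    moreover have "\<epsilon> * (2 * CARD('n) + 2 * lam * (F p \<bullet> N p) - F p \<bullet> F p) < 0"
      using far[OF pM out] \<epsilon> by (simp add: mult_pos_neg)
    moreover have "K * (N p \<bullet> e) \<ge> 0" using \<open>K \<ge> 0\<close> pos[OF pM] by simp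
    ultimately show False by simp
  qed
  then show ?thesis using that[of p0] p0(1) by (auto simp: m_def Kc_def)
qed

end

section \<open>The strong maximum principle\<close>

text \<open>
  The ball with diameter from \<open>x\<close> to \<open>y\<close> touches the sphere around \<open>x\<close> through \<open>y\<close> only in \<open>y\<close>.
\<close>
lemma touching_ball_unique:
  fixes x y z :: "'a::real_inner"
  assumes "norm (z - (1/2) *\<^sub>R (x + y)) \<le> norm (y - x) / 2" "norm (y - x) \<le> norm (z - x)"
  shows "z = y"
proof -
  define w where "w = z - x"
  define v where "v = y - x"
  have eq: "z - (1/2) *\<^sub>R (x + y) = w - (1/2) *\<^sub>R v"
  proof -
    have "x = (1/2) *\<^sub>R x + (1/2) *\<^sub>R x" by (simp flip: scaleR_left_distrib)
    then show ?thesis by (simp add: w_def v_def algebra_simps)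
  qed
  have "(norm (w - (1/2) *\<^sub>R v))\<^sup>2 \<le> (norm v / 2)\<^sup>2"
    using assms(1) by (intro power_mono) (auto simp: eq v_def)
  moreover have "(norm (w - (1/2) *\<^sub>R v))\<^sup>2 = w \<bullet> w - w \<bullet> v + (v \<bullet> v) / 4"
    by (simp add: power2_norm_eq_inner inner_diff_left inner_diff_right inner_commute[of v w] field_simps)
  moreover have "(norm v / 2)\<^sup>2 = (v \<bullet> v) / 4"
    by (simp add: power2_norm_eq_inner power_divide)
  ultimately have "w \<bullet> w \<le> w \<bullet> v" by linarith
  moreover have "v \<bullet> v \<le> w \<bullet> w"
    using assms(2) by (simp add: w_def v_def norm_le)
  ultimately have "(w - v) \<bullet> (w - v) \<le> 0"
    by (simp add: inner_diff_left inner_diff_right inner_commute[of v w])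
  then have "w = v" by (metis inner_ge_zero inner_eq_zero_iff order_antisym right_minus_eq)
  then show ?thesis by (simp add: w_def v_def)
qed

context proper_lambda_hypersurface
begin

text \<open>
  Hopf's argument, with balls of the ambient space. If \<open>N \<bullet> e > m\<close> at a point \<open>x1\<close> near \<open>z\<close>, let \<open>x2\<close>
  be a point with \<open>N \<bullet> e = m\<close> nearest to \<open>x1\<close>. Halving the ball around \<open>x1\<close> through \<open>x2\<close> makes \<open>x2\<close>
  the only point of contact. With \<open>a\<close> the centre of the half ball, \<open>exp(- \<kappa> |F - a|\<^sup>2)\<close> is strictly
  subharmonic near \<open>x2\<close> for large \<open>\<kappa>\<close>, because the secant from \<open>x1\<close> to \<open>x2\<close> has a tangential part.
  Subtracting a small multiple of it from \<open>N \<bullet> e\<close> produces an interior minimum, which violates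
  \<open>local_min_inequality\<close>.
\<close>
lemma angle_locally_constant_at_min:
  assumes m: "\<And>q. q \<in> topspace M \<Longrightarrow> m \<le> N q \<bullet> e" and m0: "0 \<le> m"
    and z: "z \<in> topspace M" "N z \<bullet> e = m"
  obtains U where "openin M U" "z \<in> U" "\<And>q. q \<in> U \<Longrightarrow> N q \<bullet> e = m"
proof -
  obtain c where c: "c \<in> A" "z \<in> fst c" using chart_at[OF z(1)] .
  obtain \<Lambda> W \<sigma> where patch: "patch c \<Lambda> W \<sigma>" and "z \<in> \<sigma> ` W" using patch_at[OF c] .
  then obtain y0 where y0: "y0 \<in> W" "z = \<sigma> y0" by blast
  note pd = patchD[OF patch]
  obtain r1 where r1: "r1 > 0" "ball y0 r1 \<subseteq> W"
    "\<And>x x' s. x \<in> ball y0 r1 \<Longrightarrow> x' \<in> ball y0 r1 \<Longrightarrow> F (\<sigma> x) - F (\<sigma> x') = s *\<^sub>R N (\<sigma> x) \<Longrightarrow> x = x'"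
    using patch_secant_not_normal[OF patch y0(1)] by blast
  define D where "D = F \<circ> \<sigma>"
  define n where "n = N \<circ> \<sigma>"
  define \<beta> where "\<beta> x = n x \<bullet> e" for x
  have contD: "continuous_on W D" and contn: "continuous_on W n"
    using patch_smooth[OF patch, THEN smooth_on_continuous] by (simp_all add: D_def n_def)
  have cont\<beta>: "continuous_on W \<beta>" unfolding \<beta>_def by (intro continuous_on_inner contn continuous_on_const)
  have \<beta>m: "m \<le> \<beta> x" if "x \<in> W" for x using m pd(9)[OF that] by (simp add: \<beta>_def n_def)
  have nn: "n x \<bullet> n x = 1" if "x \<in> W" for x using norm_N pd(9)[OF that] by (simp add: n_def norm_eq_1)
  have Dinj: "x = x'" if "x \<in> W" "x' \<in> W" "D x = D x'" for x x'
    using arg_cong[OF that(3), of \<Lambda>] unfolding D_def o_apply pd(8)[OF that(1)] pd(8)[OF that(2)] .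
  define r2 where "r2 = r1 / 2"
  have r2: "r2 > 0" "cball y0 r2 \<subseteq> ball y0 r1" using r1(1) by (auto simp: r2_def)
  define C where "C = cball y0 r2"
  have CW: "C \<subseteq> W" using r2 r1 by (auto simp: C_def)
  obtain \<delta> where \<delta>: "\<delta> > 0" "\<And>x. x \<in> sphere y0 r2 \<Longrightarrow> \<delta> \<le> norm (D x - D y0)"
  proof (cases "sphere y0 r2 = {}")
    case True
    then show ?thesis using that[of 1] by simp
  next
    case False
    have "continuous_on (sphere y0 r2) (\<lambda>x. norm (D x - D y0))"
      using CW by (intro continuous_intros continuous_on_subset[OF contD]) (auto simp: C_def)
    then obtain x where x: "x \<in> sphere y0 r2" "\<And>x'. x' \<in> sphere y0 r2 \<Longrightarrow> norm (D x - D y0) \<le> norm (D x' - D y0)"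
      using continuous_attains_inf[OF compact_sphere False] by blast
    have "x \<in> W" "x \<noteq> y0" using x(1) CW r2(1) by (auto simp: C_def)
    then have "norm (D x - D y0) > 0" using Dinj[of x y0] y0(1) by auto
    then show ?thesis using that x(2) by blast
  qed
  define Om where "Om = ball y0 r2 \<inter> {x \<in> W. norm (D x - D y0) < \<delta> / 4}"
  have "open Om"
  proof -
    have "continuous_on W (\<lambda>x. norm (D x - D y0))" by (intro continuous_intros contD)
    then have "open (W \<inter> (\<lambda>x. norm (D x - D y0)) -` {..<\<delta> / 4})"
      using continuous_open_preimage[OF _ pd(3) open_lessThan] by blast
    moreover have "Om = ball y0 r2 \<inter> (W \<inter> (\<lambda>x. norm (D x - D y0)) -` {..<\<delta> / 4})"
      by (auto simp: Om_def)
    ultimately show ?thesis by auto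
  qed
  have "\<beta> x1 = m" if x1: "x1 \<in> Om" for x1
  proof (rule ccontr)
    assume "\<beta> x1 \<noteq> m"
    have x1W: "x1 \<in> W" "x1 \<in> C" using x1 by (auto simp: Om_def C_def)
    define Z where "Z = {x \<in> C. \<beta> x = m}"
    have "compact Z"
    proof -
      have "closed {x \<in> C. \<beta> x = m}"
        by (rule continuous_closed_preimage_constant[OF continuous_on_subset[OF cont\<beta> CW]]) (simp add: C_def)
      from compact_Int_closed[OF compact_cball[of y0 r2] this]
      have "compact (C \<inter> {x \<in> C. \<beta> x = m})" by (simp only: C_def)
      moreover have "C \<inter> {x \<in> C. \<beta> x = m} = Z" by (auto simp: Z_def)
      ultimately show ?thesis by simp
    qed
    moreover have "y0 \<in> Z" using z y0 r2 by (auto simp: Z_def C_def \<beta>_def n_def)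
    moreover have "continuous_on Z (\<lambda>x. norm (D x - D x1))"
      using CW by (intro continuous_intros continuous_on_subset[OF contD]) (auto simp: Z_def)
    ultimately obtain x2 where x2: "x2 \<in> Z" "\<And>x. x \<in> Z \<Longrightarrow> norm (D x2 - D x1) \<le> norm (D x - D x1)"
      using continuous_attains_inf[of Z "\<lambda>x. norm (D x - D x1)"] by blast
    have x2C: "x2 \<in> C" "x2 \<in> W" "\<beta> x2 = m" using x2(1) CW by (auto simp: Z_def)
    have "norm (D x2 - D x1) \<le> norm (D y0 - D x1)" by (rule x2(2)[OF \<open>y0 \<in> Z\<close>])
    also have "\<dots> < \<delta> / 4" using x1 by (simp add: Om_def norm_minus_commute)
    finally have "norm (D x2 - D x1) < \<delta> / 4" .
    moreover have "norm (D x1 - D y0) < \<delta> / 4" using x1 by (simp add: Om_def)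
    ultimately have "norm (D x2 - D y0) < \<delta>"
      using norm_triangle_ineq[of "D x2 - D x1" "D x1 - D y0"] \<delta>(1) by simp
    then have "x2 \<notin> sphere y0 r2" using \<delta>(2)[of x2] by auto
    then have x2b: "x2 \<in> ball y0 r2" using x2C(1) by (auto simp: C_def)
    have "x2 \<noteq> x1" using x2C(3) \<open>\<beta> x1 \<noteq> m\<close> by auto
    define a where "a = (1/2) *\<^sub>R (D x1 + D x2)"
    define r where "r = norm (D x2 - D x1) / 2"
    have Da: "D x2 - a = (1/2) *\<^sub>R (D x2 - D x1)"
    proof -
      have "D x2 = (1/2) *\<^sub>R D x2 + (1/2) *\<^sub>R D x2" by (simp flip: scaleR_left_distrib)
      then show ?thesis by (simp add: a_def algebra_simps)
    qed
    have rD: "norm (D x2 - a) = r" by (simp add: Da r_def)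
    have touch: "\<beta> x > m" if "x \<in> C" "x \<noteq> x2" "norm (D x - a) \<le> r" for x
    proof (rule ccontr)
      assume "\<not> \<beta> x > m"
      then have "x \<in> Z" using \<beta>m[of x] that(1) CW by (auto simp: Z_def)
      then have "D x = D x2"
        using touching_ball_unique[of "D x" "D x1" "D x2"] x2(2) that(3) by (simp add: a_def r_def)
      then show False using Dinj[of x x2] that(1,2) CW x2C by auto
    qed
    \<comment> \<open>\<open>\<tau>\<close> is the squared length of the tangential part of \<open>D - a\<close>\<close>
    define \<tau> where "\<tau> x = (norm (D x - a))\<^sup>2 - ((D x - a) \<bullet> n x)\<^sup>2" for x
    have cont\<tau>: "continuous_on W \<tau>"
      unfolding \<tau>_def by (intro continuous_intros contD contn)
    have \<tau>2: "\<tau> x2 > 0"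
    proof (rule ccontr)
      assume "\<not> \<tau> x2 > 0"
      define w where "w = D x2 - a"
      have "(w - (w \<bullet> n x2) *\<^sub>R n x2) \<bullet> (w - (w \<bullet> n x2) *\<^sub>R n x2) = \<tau> x2"
      proof -
        have "(w - (w \<bullet> n x2) *\<^sub>R n x2) \<bullet> (w - (w \<bullet> n x2) *\<^sub>R n x2) = w \<bullet> w - (w \<bullet> n x2)\<^sup>2"
          using nn[OF x2C(2)] by (simp add: inner_diff_left inner_diff_right inner_commute power2_eq_square)
        then show ?thesis by (simp add: \<tau>_def w_def power2_norm_eq_inner)
      qed
      then have "w - (w \<bullet> n x2) *\<^sub>R n x2 = 0"
        using \<open>\<not> \<tau> x2 > 0\<close> by (metis inner_gt_zero_iff)
      then have "(1/2) *\<^sub>R (D x2 - D x1) = (w \<bullet> n x2) *\<^sub>R n x2"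
        unfolding Da[folded w_def, symmetric] by (simp only: right_minus_eq)
      then have "2 *\<^sub>R ((1/2) *\<^sub>R (D x2 - D x1)) = 2 *\<^sub>R ((w \<bullet> n x2) *\<^sub>R n x2)" by simp
      then have "F (\<sigma> x2) - F (\<sigma> x1) = (2 * (w \<bullet> n x2)) *\<^sub>R N (\<sigma> x2)"
        by (simp add: D_def n_def)
      then have "x2 = x1"
        by (rule r1(3)[rotated 2]) (use x1W(2) x2C(1) r2(2) in \<open>unfold C_def, blast+\<close>)
      then show False using \<open>x2 \<noteq> x1\<close> by simp
    qed
    obtain s where s: "s > 0" "cball x2 s \<subseteq> ball y0 r2" "\<And>x. x \<in> cball x2 s \<Longrightarrow> \<tau> x2 / 2 < \<tau> x"
    proof -
      have "isCont \<tau> x2" using cont\<tau> pd(3) x2C(2) by (simp add: continuous_on_eq_continuous_at)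
      then have "\<forall>\<^sub>F x in nhds x2. \<tau> x2 / 2 < \<tau> x"
        unfolding isCont_def tendsto_at_iff_tendsto_nhds using \<tau>2 by (intro order_tendstoD(1)) auto
      moreover have "\<forall>\<^sub>F x in nhds x2. x \<in> ball y0 r2"
        using x2b by (intro eventually_nhds_in_open) auto
      ultimately have "\<forall>\<^sub>F x in nhds x2. \<tau> x2 / 2 < \<tau> x \<and> x \<in> ball y0 r2" by eventually_elim simp
      then obtain d where d: "d > 0" "\<And>x. dist x x2 < d \<Longrightarrow> \<tau> x2 / 2 < \<tau> x \<and> x \<in> ball y0 r2"
        unfolding eventually_nhds_metric by blast
      have near: "dist x x2 < d" if "x \<in> cball x2 (d/2)" for x using that d(1) by (auto simp: dist_commute)
      show ?thesis
      proof (rule that[of "d/2"])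
        show "cball x2 (d/2) \<subseteq> ball y0 r2" using d(2)[OF near] by blast
        show "\<tau> x2 / 2 < \<tau> x" if "x \<in> cball x2 (d/2)" for x using d(2)[OF near[OF that]] by blast
      qed (use d(1) in simp)
    qed
    have sC: "cball x2 s \<subseteq> C" using s(2) by (auto simp: C_def)
    have ne: "cball x2 s \<noteq> {}" using s(1) by simp
    define g where "g x = 2 * CARD('n) + 2 * lam * ((D x - a) \<bullet> n x) - D x \<bullet> (D x - a)" for x
    have "continuous_on (cball x2 s) g"
      unfolding g_def using sC CW by (intro continuous_intros continuous_on_subset[OF contD] continuous_on_subset[OF contn]) auto
    then obtain xg where xg: "\<And>x. x \<in> cball x2 s \<Longrightarrow> g x \<le> g xg"
      using continuous_attains_sup[OF compact_cball ne, of g] by blast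
    \<comment> \<open>chosen so that \<open>4 \<kappa> \<tau>\<close> exceeds the bounded term \<open>g\<close>\<close>
    define \<kappa> where "\<kappa> = (\<bar>g xg\<bar> + 1) / (2 * \<tau> x2)"
    have \<kappa>: "\<kappa> > 0" using \<tau>2 by (simp add: \<kappa>_def add_nonneg_pos)
    have neg: "g x - 4 * \<kappa> * \<tau> x < 0" if "x \<in> cball x2 s" for x
    proof -
      have "4 * \<kappa> * \<tau> x > 4 * \<kappa> * (\<tau> x2 / 2)" using s(3)[OF that] \<kappa> by simp
      also have "4 * \<kappa> * (\<tau> x2 / 2) = \<bar>g xg\<bar> + 1" using \<tau>2 by (simp add: \<kappa>_def)
      finally show ?thesis using xg[OF that] by linarith
    qed
    define E where "E x = exp (- \<kappa> * (norm (D x - a))\<^sup>2)" for x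
    have E01: "0 < E x" "E x \<le> 1" for x using \<kappa> by (auto simp: E_def)
    obtain \<eta> where \<eta>: "\<eta> > 0" "\<And>x. x \<in> sphere x2 s \<Longrightarrow> norm (D x - a) \<le> r \<Longrightarrow> m + \<eta> \<le> \<beta> x"
    proof (cases "{x \<in> sphere x2 s. norm (D x - a) \<le> r} = {}")
      case True
      then show ?thesis using that[of 1] by auto
    next
      case False
      have sW: "sphere x2 s \<subseteq> W" using sC CW sphere_cball by blast
      have cs: "continuous_on (sphere x2 s) (\<lambda>x. norm (D x - a))"
        by (intro continuous_on_norm continuous_on_diff continuous_on_const continuous_on_subset[OF contD sW])
      have cs\<beta>: "continuous_on (sphere x2 s) \<beta>" by (rule continuous_on_subset[OF cont\<beta> sW])
      have "closed (sphere x2 s \<inter> (\<lambda>x. norm (D x - a)) -` {..r})"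
        by (rule continuous_closed_preimage[OF cs]) auto
      from compact_Int_closed[OF compact_sphere[of x2 s] this]
      have "compact (sphere x2 s \<inter> (\<lambda>x. norm (D x - a)) -` {..r})" by simp
      moreover have "sphere x2 s \<inter> (\<lambda>x. norm (D x - a)) -` {..r} = {x \<in> sphere x2 s. norm (D x - a) \<le> r}" by auto
      ultimately have comp: "compact {x \<in> sphere x2 s. norm (D x - a) \<le> r}" by simp
      have "continuous_on {x \<in> sphere x2 s. norm (D x - a) \<le> r} \<beta>"
        by (rule continuous_on_subset[OF cs\<beta>]) blast
      from continuous_attains_inf[OF comp False this]
      obtain x3 where x3: "x3 \<in> {x \<in> sphere x2 s. norm (D x - a) \<le> r}"
        "\<forall>x\<in>{x \<in> sphere x2 s. norm (D x - a) \<le> r}. \<beta> x3 \<le> \<beta> x" ..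
      have "x3 \<in> C" "x3 \<noteq> x2" using x3(1) s(1) sC sphere_cball[of x2 s] by auto
      then have pos: "\<beta> x3 > m" using touch[of x3] x3(1) by simp
      show ?thesis
      proof (rule that[of "\<beta> x3 - m"])
        show "m + (\<beta> x3 - m) \<le> \<beta> x" if "x \<in> sphere x2 s" "norm (D x - a) \<le> r" for x
          using x3(2) that by simp
      qed (use pos in simp)
    qed
    define w where "w x = \<beta> x - \<eta> * E x" for x
    \<comment> \<open>inside the touching ball \<open>\<beta>\<close> exceeds \<open>m\<close> by \<open>\<eta>\<close>; outside, the barrier is below its value at \<open>x2\<close>\<close>
    have wbd: "w x2 < w x" if "x \<in> sphere x2 s" for x
    proof (cases "norm (D x - a) \<le> r")
      case True
      then have "m + \<eta> \<le> \<beta> x" using \<eta>(2)[OF that] by simp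
      moreover have "\<eta> * E x \<le> \<eta>" "\<eta> * E x2 > 0" using E01[of x] E01[of x2] \<eta>(1) by auto
      ultimately show ?thesis using x2C(3) by (simp add: w_def)
    next
      case False
      have "r \<ge> 0" by (simp add: r_def)
      then have "r\<^sup>2 < (norm (D x - a))\<^sup>2" using False by (intro power_strict_mono) auto
      then have "E x < E x2" using \<kappa> by (simp add: E_def rD)
      then have "\<eta> * E x < \<eta> * E x2" using \<eta>(1) by simp
      moreover have "x \<in> W" using that sC CW by auto
      ultimately show ?thesis using \<beta>m[of x] x2C(3) by (simp add: w_def)
    qed
    have "continuous_on (cball x2 s) w"
      unfolding w_def E_def using sC CW
      by (intro continuous_intros continuous_on_subset[OF contD] continuous_on_subset[OF cont\<beta>]) auto
    then obtain x4 where x4: "x4 \<in> cball x2 s" "\<And>x. x \<in> cball x2 s \<Longrightarrow> w x4 \<le> w x"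
      using continuous_attains_inf[OF compact_cball ne, of w] by blast
    have "x4 \<notin> sphere x2 s" using wbd[of x4] x4(2)[of x2] s(1) by auto
    then have x4b: "x4 \<in> ball x2 s" using x4(1) by auto
    define p where "p = \<sigma> x4"
    have x4W: "x4 \<in> W" using x4(1) sC CW by auto
    have p: "p \<in> fst c" "p \<in> topspace M" using pd(4,9) x4W by (auto simp: p_def)
    define U where "U = \<sigma> ` ball x2 s"
    have U: "openin M U" "p \<in> U"
    proof -
      have "ball x2 s \<subseteq> W" using sC CW ball_subset_cball[of x2 s] by blast
      then show "openin M U" unfolding U_def by (rule patch_openin_image[OF patch open_ball])
      show "p \<in> U" unfolding U_def p_def using x4b by blast
    qed
    define f where "f t = - \<eta> * exp (- \<kappa> * t)" for t
    define f1 where "f1 t = \<eta> * \<kappa> * exp (- \<kappa> * t)" for t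
    have fd: "(f has_real_derivative f1 t) (at t)" for t
      unfolding f_def f1_def by (auto intro!: derivative_eq_intros)
    have fd1: "(f1 has_real_derivative - \<eta> * \<kappa> * \<kappa> * exp (- \<kappa> * t)) (at t)" for t
      unfolding f1_def by (auto intro!: derivative_eq_intros)
    have Umin: "N p \<bullet> e + f ((norm (F p - a))\<^sup>2) \<le> N q \<bullet> e + f ((norm (F q - a))\<^sup>2)" if q: "q \<in> U" for q
    proof -
      obtain x where "x \<in> ball x2 s" "q = \<sigma> x" using q by (auto simp: U_def)
      then show ?thesis using x4(2)[of x]
        by (auto simp: w_def \<beta>_def E_def f_def p_def D_def n_def)
    qed
    let ?\<rho> = "(norm (F p - a))\<^sup>2"
    obtain K where K: "K \<ge> 0" "K * (N p \<bullet> e) \<le> 4 * (- \<eta> * \<kappa> * \<kappa> * exp (- \<kappa> * ?\<rho>)) * (?\<rho> - ((F p - a) \<bullet> N p)\<^sup>2)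
      + f1 ?\<rho> * (2 * CARD('n) + 2 * lam * ((F p - a) \<bullet> N p) - F p \<bullet> (F p - a))"
      by (rule local_min_inequality[OF cwmc c(1) p(1) U Umin fd fd1]) blast
    have "4 * (- \<eta> * \<kappa> * \<kappa> * exp (- \<kappa> * ?\<rho>)) * (?\<rho> - ((F p - a) \<bullet> N p)\<^sup>2)
      + f1 ?\<rho> * (2 * CARD('n) + 2 * lam * ((F p - a) \<bullet> N p) - F p \<bullet> (F p - a))
      = (\<eta> * \<kappa> * exp (- \<kappa> * ?\<rho>)) * (g x4 - 4 * \<kappa> * \<tau> x4)"
      by (simp add: f1_def g_def \<tau>_def D_def n_def p_def algebra_simps)
    also have "\<dots> < 0" using neg[OF x4(1)] \<eta>(1) \<kappa> by (simp add: mult_pos_neg)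
    finally have "K * (N p \<bullet> e) < 0" using K(2) by linarith
    moreover have "N p \<bullet> e \<ge> 0" using m[OF p(2)] m0 by simp
    ultimately show False using K(1) by (simp add: mult_less_0_iff)
  qed
  then have \<beta>Om: "\<And>x. x \<in> Om \<Longrightarrow> N (\<sigma> x) \<bullet> e = m" by (simp add: \<beta>_def n_def)
  have "Om \<subseteq> W" by (auto simp: Om_def)
  show ?thesis
  proof (rule that[of "\<sigma> ` Om"])
    show "openin M (\<sigma> ` Om)" by (rule patch_openin_image[OF patch \<open>open Om\<close> \<open>Om \<subseteq> W\<close>])
    have "y0 \<in> Om" using y0(1) r2(1) \<delta>(1) by (simp add: Om_def)
    then show "z \<in> \<sigma> ` Om" using y0(2) by blast
    show "N q \<bullet> e = m" if "q \<in> \<sigma> ` Om" for q using \<beta>Om that by blast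
  qed
qed

lemma angle_constant:
  assumes pos: "\<And>p. p \<in> topspace M \<Longrightarrow> 0 \<le> N p \<bullet> e"
  obtains m where "0 \<le> m" "\<And>p. p \<in> topspace M \<Longrightarrow> N p \<bullet> e = m"
proof -
  obtain p where p: "p \<in> topspace M" "\<And>q. q \<in> topspace M \<Longrightarrow> N p \<bullet> e \<le> N q \<bullet> e"
    using angle_attains_min[OF pos] by blast
  define m where "m = N p \<bullet> e"
  have "N q \<bullet> e = m" if "q \<in> topspace M" for q
  proof (rule connected_space_propagate[OF connected, of "\<lambda>q. N q \<bullet> e = m", OF _ _ p(1) m_def[symmetric] that])
    have "closedin M {q \<in> topspace M. N q \<bullet> e \<in> {m}}"
      by (rule closedin_continuous_map_preimage[OF continuous_inner_N]) simp
    then show "closedin M {q \<in> topspace M. N q \<bullet> e = m}" by simp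
    fix z assume z: "z \<in> topspace M" "N z \<bullet> e = m"
    show "\<exists>U. openin M U \<and> z \<in> U \<and> (\<forall>q\<in>U. N q \<bullet> e = m)"
      using angle_locally_constant_at_min[OF p(2)[folded m_def] _ z] pos[OF p(1)] m_def by metis
  qed
  then show ?thesis using that[of m] pos[OF p(1)] by (simp add: m_def)
qed

text \<open>
  Every point is a minimum of a constant angle function, so \<open>|A|\<^sup>2 m \<le> 0\<close> by \<open>local_min_inequality\<close> with \<open>\<phi> = 0\<close>.
\<close>
lemma flat_of_positive_angle:
  assumes m: "0 < m" "\<And>p. p \<in> topspace M \<Longrightarrow> N p \<bullet> e = m"
    and pq: "p \<in> topspace M" "q \<in> topspace M"
  shows "N p = N q"
proof (rule constant_of_zero_differential[OF chart_facts(5) _ pq])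
  fix c p v assume c: "c \<in> A" "p \<in> fst c"
  have pM: "p \<in> topspace M" using c fst_chart_subset by blast
  obtain K where K: "K \<ge> 0" "K = 0 \<Longrightarrow> differential c N p v = 0"
    "K * (N p \<bullet> e) \<le> 4 * 0 * ((norm (F p - 0))\<^sup>2 - ((F p - 0) \<bullet> N p)\<^sup>2)
      + 0 * (2 * CARD('n) + 2 * lam * ((F p - 0) \<bullet> N p) - F p \<bullet> (F p - 0))"
  proof (rule local_min_inequality[OF cwmc c openin_topspace pM])
    show "((\<lambda>s. 0) has_real_derivative (\<lambda>s. 0) s) (at s)" for s :: real by simp
    show "((\<lambda>s. 0) has_real_derivative 0) (at ((norm (F p - 0))\<^sup>2))" by simp
    show "N p \<bullet> e + 0 \<le> N q \<bullet> e + 0" if "q \<in> topspace M" for q using m(2) pM that by simp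
  qed blast
  have "K \<le> 0" using K(3) m(1) m(2)[OF pM] by (simp add: mult_le_0_iff)
  then show "differential c N p v = 0" using K(1,2) by simp
qed

end

section \<open>Lifting lines through a proper local homeomorphism\<close>

text \<open>
  If translation by \<open>t e\<close> lifts to the domain of a proper, locally injective map for short times, it lifts for
  all times: over a bounded part of a line the lift stays in a compact set, on which the length of the time
  interval is bounded below. Lifts are unique, so they form a flow.
\<close>
locale proper_local_flow =
  fixes M :: "'p topology" and F :: "'p \<Rightarrow> 'e::real_normed_vector" and e :: 'e
  assumes hausdorff: "Hausdorff_space M"
    and contF: "continuous_map M euclidean F"
    and properF: "\<And>R. compactin M {p \<in> topspace M. norm (F p) \<le> R}"
    and box: "\<And>p. p \<in> topspace M \<Longrightarrow> \<exists>U \<delta> \<phi>. openin M U \<and> p \<in> U \<and> \<delta> > 0 \<and> inj_on F U \<and>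
      continuous_map (prod_topology (subtopology M U) (top_of_set {-\<delta><..<\<delta>})) M \<phi> \<and>
      (\<forall>q\<in>U. \<phi> (q, 0) = q \<and> (\<forall>t\<in>{-\<delta><..<\<delta>}. F (\<phi> (q, t)) = F q + t *\<^sub>R e))"
begin

definition traj :: "'e \<Rightarrow> real set \<Rightarrow> (real \<Rightarrow> 'p) \<Rightarrow> bool" where
  "traj x I \<gamma> \<longleftrightarrow> continuous_map (top_of_set I) M \<gamma> \<and> (\<forall>t\<in>I. F (\<gamma> t) = x + t *\<^sub>R e)"

lemma trajD:
  assumes "traj x I \<gamma>"
  shows "continuous_map (top_of_set I) M \<gamma>" "t \<in> I \<Longrightarrow> F (\<gamma> t) = x + t *\<^sub>R e" "t \<in> I \<Longrightarrow> \<gamma> t \<in> topspace M"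
  using assms by (auto simp: traj_def continuous_map_def)

lemma traj_subset: "traj x I \<gamma> \<Longrightarrow> J \<subseteq> I \<Longrightarrow> traj x J \<gamma>"
  unfolding traj_def by (auto intro: continuous_map_from_subtopology_mono)

lemma traj_shift:
  assumes "traj x I \<gamma>"
  shows "traj (x + s *\<^sub>R e) ((\<lambda>t. t - s) ` I) (\<lambda>t. \<gamma> (t + s))"
proof -
  have "continuous_map (top_of_set ((\<lambda>t. t - s) ` I)) (top_of_set I) (\<lambda>t. t + s)"
    by (auto intro: continuous_intros)
  from continuous_map_compose[OF this trajD(1)[OF assms]]
  show ?thesis using trajD(2)[OF assms] unfolding traj_def
    by (auto simp: o_def algebra_simps)
qed

text \<open>
  Two lifts of the same line agree on a closed set, because \<open>M\<close> is Hausdorff, and on an open one, because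
  \<open>F\<close> is locally injective.
\<close>
lemma traj_unique:
  assumes "traj x I \<gamma>" "traj x I \<eta>" "connected I" "s \<in> I" "\<gamma> s = \<eta> s" "t \<in> I"
  shows "\<gamma> t = \<eta> t"
proof (rule connected_space_propagate[of "top_of_set I" "\<lambda>t. \<gamma> t = \<eta> t" s])
  show "connected_space (top_of_set I)"
    using assms(3) connectedin_iff_connected[of I] unfolding connectedin_def by blast
  show "closedin (top_of_set I) {t \<in> topspace (top_of_set I). \<gamma> t = \<eta> t}"
    by (rule closedin_continuous_maps_eq[OF hausdorff trajD(1)[OF assms(1)] trajD(1)[OF assms(2)]])
  fix t assume "t \<in> topspace (top_of_set I)" "\<gamma> t = \<eta> t"
  then have t: "t \<in> I" "\<gamma> t = \<eta> t" by auto
  obtain U where U: "openin M U" "\<gamma> t \<in> U" "inj_on F U"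
    using box[OF trajD(3)[OF assms(1) t(1)]] by blast
  define T where "T = {t \<in> topspace (top_of_set I). \<gamma> t \<in> U} \<inter> {t \<in> topspace (top_of_set I). \<eta> t \<in> U}"
  have "openin (top_of_set I) T"
    unfolding T_def by (intro openin_Int openin_continuous_map_preimage[OF trajD(1)[OF assms(1)] U(1)]
        openin_continuous_map_preimage[OF trajD(1)[OF assms(2)] U(1)])
  moreover have "t \<in> T" using t U(2) by (simp add: T_def)
  moreover have "\<forall>t\<in>T. \<gamma> t = \<eta> t"
    using trajD(2)[OF assms(1)] trajD(2)[OF assms(2)] inj_onD[OF U(3)] by (auto simp: T_def)
  ultimately show "\<exists>T. openin (top_of_set I) T \<and> t \<in> T \<and> (\<forall>t\<in>T. \<gamma> t = \<eta> t)" by blast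
qed (use assms in auto)

lemma traj_glue:
  assumes \<gamma>: "traj x I \<gamma>" and \<eta>: "traj x J \<eta>" and I: "open I" "connected I" and J: "open J" "connected J"
    and s: "s \<in> I" "s \<in> J" "\<gamma> s = \<eta> s"
  obtains \<zeta> where "traj x (I \<union> J) \<zeta>" "\<And>t. t \<in> I \<Longrightarrow> \<zeta> t = \<gamma> t"
proof -
  define \<zeta> where "\<zeta> t = (if t \<in> I then \<gamma> t else \<eta> t)" for t
  have "connected (I \<inter> J)" using I(2) J(2) by (meson is_interval_Int is_interval_connected_1)
  then have eq: "\<gamma> t = \<eta> t" if "t \<in> I" "t \<in> J" for t
    using traj_unique[OF traj_subset[OF \<gamma>, of "I \<inter> J"] traj_subset[OF \<eta>, of "I \<inter> J"] _ _ s(3), of t] s that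
    by auto
  have \<zeta>J: "\<zeta> t = \<eta> t" if "t \<in> J" for t using eq that by (auto simp: \<zeta>_def)
  have "continuous_map (top_of_set (I \<union> J)) M \<zeta>"
  proof (rule continuous_map_locally)
    fix t assume "t \<in> topspace (top_of_set (I \<union> J))"
    then consider "t \<in> I" | "t \<in> J" by auto
    then show "\<exists>U. openin (top_of_set (I \<union> J)) U \<and> t \<in> U \<and> continuous_map (subtopology (top_of_set (I \<union> J)) U) M \<zeta>"
    proof cases
      case 1
      have "continuous_map (top_of_set I) M \<zeta>"
        by (rule continuous_map_eq[OF trajD(1)[OF \<gamma>]]) (auto simp: \<zeta>_def)
      then show ?thesis using 1 I(1)
        by (intro exI[of _ I]) (auto simp: subtopology_subtopology Int_absorb1 open_subset)
    next
      case 2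
      have "continuous_map (top_of_set J) M \<zeta>"
        by (rule continuous_map_eq[OF trajD(1)[OF \<eta>]]) (auto simp: \<zeta>J)
      then show ?thesis using 2 J(1)
        by (intro exI[of _ J]) (auto simp: subtopology_subtopology Int_absorb1 open_subset)
    qed
  qed
  then have "traj x (I \<union> J) \<zeta>"
    using trajD(2)[OF \<gamma>] trajD(2)[OF \<eta>] unfolding traj_def by (auto simp: \<zeta>_def)
  then show ?thesis using that[of \<zeta>] by (simp add: \<zeta>_def)
qed

lemma box_traj:
  assumes "openin M U" "q \<in> U"
    and "continuous_map (prod_topology (subtopology M U) (top_of_set I)) M \<phi>"
    and "\<And>t. t \<in> I \<Longrightarrow> F (\<phi> (q, t)) = F q + t *\<^sub>R e"
  shows "traj (F q) I (\<lambda>t. \<phi> (q, t))"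
proof -
  have "q \<in> topspace M" using assms(1,2) openin_subset by blast
  then have "continuous_map (top_of_set I) (prod_topology (subtopology M U) (top_of_set I)) (\<lambda>t. (q, t))"
    using assms(2) by (intro continuous_map_pairedI) (auto simp del: continuous_map_subtopology_eu)
  from continuous_map_compose[OF this assms(3)] show ?thesis
    using assms(4) by (simp add: traj_def o_def)
qed

lemma traj_uniform:
  obtains \<delta> where "\<delta> > 0" "\<And>q. q \<in> topspace M \<Longrightarrow> norm (F q) \<le> R \<Longrightarrow> \<exists>\<eta>. traj (F q) {-\<delta><..<\<delta>} \<eta> \<and> \<eta> 0 = q"
proof -
  define K where "K = {p \<in> topspace M. norm (F p) \<le> R}"
  have "\<exists>U \<delta>. openin M U \<and> p \<in> U \<and> \<delta> > 0 \<and> (\<forall>q\<in>U. \<exists>\<eta>. traj (F q) {-\<delta><..<\<delta>} \<eta> \<and> \<eta> 0 = q)" if p: "p \<in> topspace M" for p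
  proof -
    obtain U \<delta> \<phi> where U: "openin M U" "p \<in> U" "\<delta> > 0"
      and \<phi>: "continuous_map (prod_topology (subtopology M U) (top_of_set {-\<delta><..<\<delta>})) M \<phi>"
      "\<forall>q\<in>U. \<phi> (q, 0) = q \<and> (\<forall>t\<in>{-\<delta><..<\<delta>}. F (\<phi> (q, t)) = F q + t *\<^sub>R e)"
      using box[OF p] by blast
    have "traj (F q) {-\<delta><..<\<delta>} (\<lambda>t. \<phi> (q, t))" if "q \<in> U" for q
      using box_traj[OF U(1) that \<phi>(1)] \<phi>(2) that by blast
    then show ?thesis using U \<phi>(2) by blast
  qed
  then obtain U \<delta> where U: "\<And>p. p \<in> topspace M \<Longrightarrow> openin M (U p) \<and> p \<in> U p \<and> \<delta> p > 0 \<and>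
      (\<forall>q\<in>U p. \<exists>\<eta>. traj (F q) {-\<delta> p<..<\<delta> p} \<eta> \<and> \<eta> 0 = q)" by metis
  have comp: "compactin M K" using properF by (simp add: K_def)
  have "\<And>V. V \<in> U ` K \<Longrightarrow> openin M V" "K \<subseteq> \<Union> (U ` K)" using U by (auto simp: K_def)
  then obtain C where C: "finite C" "C \<subseteq> U ` K" "K \<subseteq> \<Union> C"
    using comp unfolding compactin_def by meson
  then obtain P where P: "P \<subseteq> K" "finite P" "C = U ` P" by (meson finite_subset_image)
  define d where "d = Min (insert 1 (\<delta> ` P))"
  have Pd: "\<delta> p > 0" if "p \<in> P" for p using U P(1) that by (auto simp: K_def)
  have "d > 0" unfolding d_def using P(2) Pd by (subst Min_gr_iff) auto
  moreover have "\<exists>\<eta>. traj (F q) {-d<..<d} \<eta> \<and> \<eta> 0 = q" if "q \<in> topspace M" "norm (F q) \<le> R" for q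
  proof -
    have "q \<in> K" using that by (simp add: K_def)
    then obtain p where p: "p \<in> P" "q \<in> U p" using C(3) P(3) by blast
    then obtain \<eta> where \<eta>: "traj (F q) {-\<delta> p<..<\<delta> p} \<eta>" "\<eta> 0 = q" using U P(1) by (force simp: K_def)
    have "d \<le> \<delta> p" unfolding d_def using P(2) p(1) by (intro Min_le) auto
    then have "traj (F q) {-d<..<d} \<eta>" by (intro traj_subset[OF \<eta>(1)]) auto
    then show ?thesis using \<eta>(2) by blast
  qed
  ultimately show ?thesis using that by blast
qed

lemma traj_extend:
  assumes \<delta>: "\<delta> > 0" "\<And>q. q \<in> topspace M \<Longrightarrow> norm (F q) \<le> R \<Longrightarrow> \<exists>\<eta>. traj (F q) {-\<delta><..<\<delta>} \<eta> \<and> \<eta> 0 = q"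
    and \<gamma>: "traj x I \<gamma>" "open I" "connected I" and s: "s \<in> I" "norm (x + s *\<^sub>R e) \<le> R"
  obtains \<zeta> where "traj x (I \<union> {s-\<delta><..<s+\<delta>}) \<zeta>" "\<And>t. t \<in> I \<Longrightarrow> \<zeta> t = \<gamma> t"
proof -
  have Fs: "F (\<gamma> s) = x + s *\<^sub>R e" "\<gamma> s \<in> topspace M" using trajD[OF \<gamma>(1)] s(1) by auto
  then obtain \<eta> where \<eta>: "traj (x + s *\<^sub>R e) {-\<delta><..<\<delta>} \<eta>" "\<eta> 0 = \<gamma> s"
    using \<delta>(2)[of "\<gamma> s"] s(2) by auto
  have "(\<lambda>t. t + s) ` {-\<delta><..<\<delta>} = {s-\<delta><..<s+\<delta>}"
  proof (intro equalityI subsetI)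
    fix t assume "t \<in> {s-\<delta><..<s+\<delta>}"
    then show "t \<in> (\<lambda>t. t + s) ` {-\<delta><..<\<delta>}" by (intro image_eqI[of _ _ "t - s"]) auto
  qed auto
  with traj_shift[OF \<eta>(1), of "-s"] have \<eta>': "traj x {s-\<delta><..<s+\<delta>} (\<lambda>t. \<eta> (t - s))" by simp
  show ?thesis
    by (rule traj_glue[OF \<gamma>(1) \<eta>' \<gamma>(2,3) _ _ s(1)]) (use \<delta>(1) \<eta>(2) that in auto)
qed

text \<open>
  All points over the segment have norm at most \<open>R\<close>, so one \<open>\<delta>\<close> serves throughout and finitely many
  extensions by \<open>\<delta>/2\<close> at both ends reach the time \<open>T\<close>.
\<close>
lemma traj_exists_bounded:
  assumes p: "p \<in> topspace M" and T: "T > 0"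
  obtains \<gamma> where "traj (F p) {-T<..<T} \<gamma>" "\<gamma> 0 = p"
proof -
  define R where "R = norm (F p) + T * norm e"
  obtain \<delta> where \<delta>: "\<delta> > 0" "\<And>q. q \<in> topspace M \<Longrightarrow> norm (F q) \<le> R \<Longrightarrow> \<exists>\<eta>. traj (F q) {-\<delta><..<\<delta>} \<eta> \<and> \<eta> 0 = q"
    using traj_uniform by blast
  have bd: "norm (F p + s *\<^sub>R e) \<le> R" if "\<bar>s\<bar> \<le> T" for s
    unfolding R_def using that by (intro norm_triangle_le add_mono) (auto intro: mult_right_mono)
  define r where "r k = min T (real (Suc k) * (\<delta> / 2))" for k
  have rpos: "r k > 0" for k using T \<delta>(1) by (simp add: r_def)
  have "\<exists>\<gamma>. traj (F p) {-r k<..<r k} \<gamma> \<and> \<gamma> 0 = p" for k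
  proof (induction k)
    case 0
    obtain \<eta> where \<eta>: "traj (F p) {-\<delta><..<\<delta>} \<eta>" "\<eta> 0 = p" using \<delta>(2)[OF p] bd[of 0] T by auto
    have "r 0 \<le> \<delta>" using \<delta>(1) by (simp add: r_def)
    then have "{-r 0<..<r 0} \<subseteq> {-\<delta><..<\<delta>}" by auto
    then show ?case using traj_subset[OF \<eta>(1)] \<eta>(2) by blast
  next
    case (Suc k)
    then obtain \<gamma> where \<gamma>: "traj (F p) {-r k<..<r k} \<gamma>" "\<gamma> 0 = p" by blast
    define s where "s = r k - min (r k) \<delta> / 4"
    have rk: "r k \<le> T" by (simp add: r_def)
    have s: "0 < s" "s < r k" "\<delta> / 4 \<ge> r k - s" using rpos[of k] \<delta>(1) by (auto simp: s_def)
    have "\<bar>s\<bar> \<le> T" using s rk by simp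
    from traj_extend[OF \<delta> \<gamma>(1) _ _ _ bd[OF this]] s
    obtain \<zeta> where \<zeta>: "traj (F p) ({-r k<..<r k} \<union> {s-\<delta><..<s+\<delta>}) \<zeta>" "\<And>t. t \<in> {-r k<..<r k} \<Longrightarrow> \<zeta> t = \<gamma> t" by auto
    have "{-r k<..<r k} \<union> {s-\<delta><..<s+\<delta>} \<supseteq> {-r k<..<s+\<delta>}" using s \<delta>(1) by auto
    then have \<zeta>1: "traj (F p) {-r k<..<s+\<delta>} \<zeta>" by (rule traj_subset[OF \<zeta>(1)])
    have "\<bar>-s\<bar> \<le> T" using s rk by simp
    from traj_extend[OF \<delta> \<zeta>1 _ _ _ bd[OF this]] s \<delta>(1)
    obtain \<xi> where \<xi>: "traj (F p) ({-r k<..<s+\<delta>} \<union> {-s-\<delta><..<-s+\<delta>}) \<xi>" "\<And>t. t \<in> {-r k<..<s+\<delta>} \<Longrightarrow> \<xi> t = \<zeta> t" by auto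
    have "real (Suc (Suc k)) * (\<delta> / 2) = real (Suc k) * (\<delta> / 2) + \<delta> / 2" by (simp add: field_simps)
    then have "r (Suc k) \<le> r k + \<delta> / 2" using \<delta>(1) unfolding r_def by linarith
    then have "{-r (Suc k)<..<r (Suc k)} \<subseteq> {-r k<..<s+\<delta>} \<union> {-s-\<delta><..<-s+\<delta>}" using s \<delta>(1) by auto
    then have "traj (F p) {-r (Suc k)<..<r (Suc k)} \<xi>" by (rule traj_subset[OF \<xi>(1)])
    moreover have "\<xi> 0 = p" using \<xi>(2)[of 0] \<zeta>(2)[of 0] \<gamma>(2) rpos[of k] s \<delta>(1) by simp
    ultimately show ?case by blast
  qed
  moreover obtain k where "T / (\<delta> / 2) < real k" using reals_Archimedean2 by blast
  then have "T \<le> real (Suc k) * (\<delta> / 2)" using \<delta>(1) by (simp add: field_simps)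
  then have "r k = T" by (simp add: r_def)
  ultimately show ?thesis using that by metis
qed

lemma traj_exists:
  assumes p: "p \<in> topspace M"
  obtains \<gamma> where "traj (F p) UNIV \<gamma>" "\<gamma> 0 = p"
proof -
  obtain g where g: "\<And>k. traj (F p) {-real (Suc k)<..<real (Suc k)} (g k)" "\<And>k. g k 0 = p"
  proof -
    have "\<exists>\<gamma>. traj (F p) {-real (Suc k)<..<real (Suc k)} \<gamma> \<and> \<gamma> 0 = p" for k
      by (rule traj_exists_bounded[OF p, of "real (Suc k)"]) (simp, blast)
    then show ?thesis using that by metis
  qed
  define \<gamma> where "\<gamma> t = g (nat \<lceil>\<bar>t\<bar>\<rceil>) t" for t
  have mono: "g k t = g j t" if "k \<le> j" "\<bar>t\<bar> < real (Suc k)" for k j t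
  proof -
    have "traj (F p) {-real (Suc k)<..<real (Suc k)} (g j)"
      by (rule traj_subset[OF g(1)[of j]]) (use that in auto)
    from traj_unique[OF g(1) this, of 0 t] show ?thesis using g(2) that(2) by (auto simp: abs_less_iff)
  qed
  have agree: "\<gamma> t = g k t" if "\<bar>t\<bar> < real (Suc k)" for k t
  proof -
    have "\<bar>t\<bar> < real (Suc (nat \<lceil>\<bar>t\<bar>\<rceil>))" by linarith
    then show ?thesis unfolding \<gamma>_def using mono[of "nat \<lceil>\<bar>t\<bar>\<rceil>" k t] mono[of k "nat \<lceil>\<bar>t\<bar>\<rceil>" t] that by (metis nle_le)
  qed
  have "continuous_map euclideanreal M \<gamma>"
  proof (rule continuous_map_locally)
    fix t :: real
    define k where "k = nat \<lceil>\<bar>t\<bar>\<rceil>"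
    have tk: "\<bar>t\<bar> < real (Suc k)" unfolding k_def by linarith
    have "continuous_map (top_of_set {-real (Suc k)<..<real (Suc k)}) M \<gamma>"
      by (rule continuous_map_eq[OF trajD(1)[OF g(1)[of k]]]) (use agree[of _ k] in \<open>auto simp: abs_less_iff\<close>)
    then show "\<exists>U. openin euclideanreal U \<and> t \<in> U \<and> continuous_map (top_of_set U) M \<gamma>"
      using tk by (intro exI[of _ "{-real (Suc k)<..<real (Suc k)}"]) auto
  qed
  moreover have "F (\<gamma> t) = F p + t *\<^sub>R e" for t
  proof -
    have "\<bar>t\<bar> < real (Suc (nat \<lceil>\<bar>t\<bar>\<rceil>))" by linarith
    then have "t \<in> {-real (Suc (nat \<lceil>\<bar>t\<bar>\<rceil>))<..<real (Suc (nat \<lceil>\<bar>t\<bar>\<rceil>))}" by (simp only: abs_less_iff) simp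
    from trajD(2)[OF g(1) this] show ?thesis by (simp only: \<gamma>_def)
  qed
  ultimately have "traj (F p) UNIV \<gamma>" by (simp add: traj_def)
  moreover have "\<gamma> 0 = p" using agree[of 0 0] g(2) by simp
  ultimately show ?thesis using that by blast
qed

definition flow :: "'p \<Rightarrow> real \<Rightarrow> 'p" where
  "flow p = (SOME \<gamma>. traj (F p) UNIV \<gamma> \<and> \<gamma> 0 = p)"

lemma flow_traj: "p \<in> topspace M \<Longrightarrow> traj (F p) UNIV (flow p)"
  and flow_0: "p \<in> topspace M \<Longrightarrow> flow p 0 = p"
proof -
  assume "p \<in> topspace M"
  then have "\<exists>\<gamma>. traj (F p) UNIV \<gamma> \<and> \<gamma> 0 = p" using traj_exists[of p] by blast
  from someI_ex[OF this] show "traj (F p) UNIV (flow p)" "flow p 0 = p"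
    unfolding flow_def by simp_all
qed

lemma flow_in: "p \<in> topspace M \<Longrightarrow> flow p t \<in> topspace M"
  and F_flow: "p \<in> topspace M \<Longrightarrow> F (flow p t) = F p + t *\<^sub>R e"
  using trajD[OF flow_traj] by auto

lemma flow_unique:
  assumes "traj (F p) I \<gamma>" "connected I" "0 \<in> I" "\<gamma> 0 = p" "t \<in> I" "p \<in> topspace M"
  shows "flow p t = \<gamma> t"
  by (rule traj_unique[OF traj_subset[OF flow_traj] assms(1-3) _ assms(5)]) (use assms flow_0 in auto)

lemma flow_add:
  assumes "p \<in> topspace M"
  shows "flow (flow p s) t = flow p (s + t)"
proof (rule flow_unique[where I = UNIV])
  have "surj (\<lambda>t. t - s)" by (rule surjI[of _ "\<lambda>t. t + s"]) simp
  then show "traj (F (flow p s)) UNIV (\<lambda>t. flow p (s + t))"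
    using traj_shift[OF flow_traj[OF assms], of s] F_flow[OF assms, of s] by (simp add: add.commute)
qed (use assms flow_in in auto)

lemma flow_box:
  assumes p: "p \<in> topspace M"
  obtains U \<delta> where "openin M U" "p \<in> U" "\<delta> > 0"
    "continuous_map (prod_topology (subtopology M U) (top_of_set {-\<delta><..<\<delta>})) M (\<lambda>(q, t). flow q t)"
proof -
  obtain U \<delta> \<phi> where U: "openin M U" "p \<in> U" "\<delta> > 0"
    and \<phi>: "continuous_map (prod_topology (subtopology M U) (top_of_set {-\<delta><..<\<delta>})) M \<phi>"
    "\<forall>q\<in>U. \<phi> (q, 0) = q \<and> (\<forall>t\<in>{-\<delta><..<\<delta>}. F (\<phi> (q, t)) = F q + t *\<^sub>R e)"
    using box[OF p] by blast
  have eq: "flow q t = \<phi> (q, t)" if q: "q \<in> U" and t: "t \<in> {-\<delta><..<\<delta>}" for q t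
  proof -
    have qM: "q \<in> topspace M" using U(1) q openin_subset by blast
    have "traj (F q) {-\<delta><..<\<delta>} (\<lambda>t. \<phi> (q, t))"
      using box_traj[OF U(1) q \<phi>(1)] \<phi>(2) q by blast
    then show ?thesis using t \<phi>(2) q qM by (intro flow_unique) auto
  qed
  have "continuous_map (prod_topology (subtopology M U) (top_of_set {-\<delta><..<\<delta>})) M (\<lambda>(q, t). flow q t)"
    by (rule continuous_map_eq[OF \<phi>(1)]) (auto simp: eq)
  then show ?thesis using that U by blast
qed

text \<open>
  For short times the flow is continuous by assumption. The times at which it is continuous near \<open>p\<close> form an
  open set; it is closed because the flow at a limit time is the flow at a slightly different time followed
  by a short one. By connectedness it contains all times.
\<close>
lemma flow_continuous: "continuous_map (prod_topology M euclideanreal) M (\<lambda>(q, t). flow q t)"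
proof (rule continuous_map_locally)
  fix z assume "z \<in> topspace (prod_topology M euclideanreal)"
  then obtain p t0 where z: "z = (p, t0)" and p: "p \<in> topspace M" by auto
  define good where "good t \<longleftrightarrow> (\<exists>U I. openin M U \<and> p \<in> U \<and> open I \<and> t \<in> I \<and>
     continuous_map (prod_topology (subtopology M U) (top_of_set I)) M (\<lambda>(q, t). flow q t))" for t
  have "open {t. good t}"
    unfolding open_subopen[of "{t. good t}"]
  proof (intro ballI)
    fix t assume "t \<in> {t. good t}"
    then obtain U I where "openin M U" "p \<in> U" "open I" "t \<in> I"
     "continuous_map (prod_topology (subtopology M U) (top_of_set I)) M (\<lambda>(q, t). flow q t)"
      by (auto simp: good_def)
    then show "\<exists>T. open T \<and> t \<in> T \<and> T \<subseteq> {t. good t}"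
      by (intro exI[of _ I]) (auto simp: good_def)
  qed
  moreover have "closed {t. good t}"
    unfolding closed_limpt islimpt_approachable
  proof (intro allI impI)
    fix t assume lim: "\<forall>\<epsilon>>0. \<exists>s\<in>{t. good t}. s \<noteq> t \<and> dist s t < \<epsilon>"
    obtain U \<delta> where U: "openin M U" "flow p t \<in> U" "\<delta> > 0"
      "continuous_map (prod_topology (subtopology M U) (top_of_set {-\<delta><..<\<delta>})) M (\<lambda>(q, t). flow q t)"
      using flow_box[OF flow_in[OF p]] by metis
    have "openin euclideanreal {s \<in> topspace euclideanreal. flow p s \<in> U}"
      using openin_continuous_map_preimage[OF _ U(1), of euclideanreal "flow p"] trajD(1)[OF flow_traj[OF p]] by simp
    then obtain r where r: "r > 0" "\<And>s. dist s t < r \<Longrightarrow> flow p s \<in> U"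
      using U(2) by (auto simp: open_dist)
    obtain s where s: "good s" "dist s t < min r \<delta>" using lim r(1) U(3) by (metis mem_Collect_eq min_less_iff_conj)
    obtain V I where V: "openin M V" "p \<in> V" "open I" "s \<in> I"
      "continuous_map (prod_topology (subtopology M V) (top_of_set I)) M (\<lambda>(q, t). flow q t)"
      using s(1) by (auto simp: good_def)
    have cs: "continuous_map (subtopology M V) M (\<lambda>q. flow q s)"
    proof -
      have "continuous_map (subtopology M V) (prod_topology (subtopology M V) (top_of_set I)) (\<lambda>q. (q, s))"
        using V(4) by (intro continuous_map_pairedI) auto
      from continuous_map_compose[OF this V(5)] show ?thesis by (simp add: o_def)
    qed
    define V' where "V' = {q \<in> topspace (subtopology M V). flow q s \<in> U}"
    have "openin (subtopology M V) V'" unfolding V'_def by (rule openin_continuous_map_preimage[OF cs U(1)])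
    then have V': "openin M V'" using V(1) by (metis openin_trans_full)
    have pV': "p \<in> V'" using p V(2) r(2) s(2) by (simp add: V'_def)
    define J where "J = {s-\<delta><..<s+\<delta>}"
    have tJ: "t \<in> J" using s(2) by (auto simp: J_def dist_real_def)
    have V'V: "V' \<subseteq> V" "V' \<subseteq> topspace M" by (auto simp: V'_def)
    have "continuous_map (prod_topology (subtopology M V') (top_of_set J)) (prod_topology (subtopology M U) (top_of_set {-\<delta><..<\<delta>}))
        (\<lambda>x. (flow (fst x) s, snd x - s))"
    proof (intro continuous_map_pairedI)
      have "continuous_map (subtopology M V') (subtopology M U) (\<lambda>q. flow q s)"
        using continuous_map_from_subtopology_mono[OF cs V'V(1)] by (auto simp: continuous_map_in_subtopology V'_def)
      from continuous_map_compose[OF continuous_map_fst this]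
      show "continuous_map (prod_topology (subtopology M V') (top_of_set J)) (subtopology M U) (\<lambda>x. flow (fst x) s)"
        by (simp add: o_def)
      have "continuous_map (top_of_set J) (top_of_set {-\<delta><..<\<delta>}) (\<lambda>t. t - s)"
        by (auto simp: J_def intro: continuous_intros)
      from continuous_map_compose[OF continuous_map_snd this]
      show "continuous_map (prod_topology (subtopology M V') (top_of_set J)) (top_of_set {-\<delta><..<\<delta>}) (\<lambda>x. snd x - s)"
        unfolding o_def .
    qed
    from continuous_map_compose[OF this U(4)]
    have "continuous_map (prod_topology (subtopology M V') (top_of_set J)) M (\<lambda>x. flow (flow (fst x) s) (snd x - s))"
      by (simp add: o_def)
    then have "continuous_map (prod_topology (subtopology M V') (top_of_set J)) M (\<lambda>(q, t). flow q t)"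
      by (rule continuous_map_eq) (use V'V(2) flow_add in auto)
    moreover have "open J" by (simp add: J_def)
    ultimately show "t \<in> {t. good t}"
      unfolding good_def mem_Collect_eq using V' pV' tJ by blast
  qed
  moreover have "0 \<in> {t. good t}"
  proof -
    obtain U \<delta> where "openin M U" "p \<in> U" "\<delta> > 0"
      "continuous_map (prod_topology (subtopology M U) (top_of_set {-\<delta><..<\<delta>})) M (\<lambda>(q, t). flow q t)"
      using flow_box[OF p] by blast
    then show ?thesis unfolding good_def mem_Collect_eq by (intro exI[of _ U] exI[of _ "{-\<delta><..<\<delta>}"]) auto
  qed
  ultimately have "{t. good t} = UNIV" using clopen[of "{t. good t}"] by blast
  then have "good t0" by blast
  then obtain U I where "openin M U" "p \<in> U" "open I" "t0 \<in> I"
     "continuous_map (prod_topology (subtopology M U) (top_of_set I)) M (\<lambda>(q, t). flow q t)"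
    by (auto simp: good_def)
  then show "\<exists>U. openin (prod_topology M euclideanreal) U \<and> z \<in> U \<and>
      continuous_map (subtopology (prod_topology M euclideanreal) U) M (\<lambda>(q, t). flow q t)"
    using z by (intro exI[of _ "U \<times> I"]) (auto simp: openin_prod_Times_iff subtopology_Times)
qed

end

section \<open>Lifts to the hypersurface and the flat case\<close>

context immersed_hypersurface
begin

text \<open>
  In a patch the derivative of \<open>F \<circ> \<sigma>\<close> in direction \<open>\<Lambda> e\<close> is \<open>e\<close> itself, since \<open>e\<close> is tangent. So straight
  lines in direction \<open>\<Lambda> e\<close> in the coordinates are mapped to straight lines in direction \<open>e\<close>.
\<close>
lemma tangent_line_box:
  assumes tang: "\<And>q. q \<in> topspace M \<Longrightarrow> N q \<bullet> e = 0" and p: "p \<in> topspace M"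
  shows "\<exists>U \<delta> \<phi>. openin M U \<and> p \<in> U \<and> \<delta> > 0 \<and> inj_on F U \<and>
      continuous_map (prod_topology (subtopology M U) (top_of_set {-\<delta><..<\<delta>})) M \<phi> \<and>
      (\<forall>q\<in>U. \<phi> (q, 0) = q \<and> (\<forall>t\<in>{-\<delta><..<\<delta>}. F (\<phi> (q, t)) = F q + t *\<^sub>R e))"
proof -
  obtain c where c: "c \<in> A" "p \<in> fst c" using chart_at[OF p] .
  obtain \<Lambda> W \<sigma> where patch: "patch c \<Lambda> W \<sigma>" and pW: "p \<in> \<sigma> ` W" using patch_at[OF c] .
  note pd = patchD[OF patch]
  note WW = subspace_UNIV pd(10)
  obtain y where y: "y \<in> W" "p = \<sigma> y" using pW by blast
  obtain r where r: "r > 0" "ball y r \<subseteq> W" using pd(3) y(1) by (meson open_contains_ball)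
  define D where "D = F \<circ> \<sigma>"
  have smD: "smooth_on UNIV W D" using patch_smooth(1)[OF patch] by (simp add: D_def)
  define \<delta> where "\<delta> = r / (2 * (norm (\<Lambda> e) + 1))"
  have pos: "norm (\<Lambda> e) + 1 > 0" by (simp add: add_nonneg_pos)
  have \<delta>: "\<delta> > 0" using r(1) pos by (simp add: \<delta>_def)
  define U where "U = \<sigma> ` ball y (r/2)"
  define \<phi> where "\<phi> = (\<lambda>(q, t). \<sigma> (\<Lambda> (F q) + t *\<^sub>R \<Lambda> e))"
  have bW: "ball y (r/2) \<subseteq> W" using r by auto
  have U: "openin M U" unfolding U_def by (rule patch_openin_image[OF patch open_ball bW])
  have Uq: "\<Lambda> (F q) \<in> ball y (r/2)" "\<sigma> (\<Lambda> (F q)) = q" if "q \<in> U" for q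
    using that pd(8) bW unfolding U_def by (metis imageE subsetD)+
  have seg: "z + t *\<^sub>R \<Lambda> e \<in> W" if "z \<in> ball y (r/2)" "\<bar>t\<bar> < \<delta>" for z t
  proof -
    have "\<bar>t\<bar> * norm (\<Lambda> e) \<le> \<delta> * (norm (\<Lambda> e) + 1)" using that(2) by (intro mult_mono) auto
    also have "\<delta> * (norm (\<Lambda> e) + 1) = r / 2"
    proof -
      have "r / (2 * X) * X = r / 2" if "X > 0" for X :: real using that by simp
      then show ?thesis using pos unfolding \<delta>_def by blast
    qed
    finally have "norm (t *\<^sub>R \<Lambda> e) \<le> r/2" by simp
    moreover have "dist y (z + t *\<^sub>R \<Lambda> e) \<le> dist y z + norm (t *\<^sub>R \<Lambda> e)"
      by (metis dist_norm dist_triangle add_diff_cancel_left' dist_commute)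
    ultimately have "z + t *\<^sub>R \<Lambda> e \<in> ball y r" using that(1) by simp
    then show ?thesis using r(2) by blast
  qed
  have line: "D (z + t *\<^sub>R \<Lambda> e) = D z + t *\<^sub>R e" if z: "z \<in> ball y (r/2)" and t: "\<bar>t\<bar> < \<delta>" for z t
  proof -
    define f where "f t = D (z + t *\<^sub>R \<Lambda> e) - t *\<^sub>R e" for t
    have "f t = f 0"
    proof (rule has_derivative_zero_unique[of "{-\<delta><..<\<delta>}"])
      fix s assume "s \<in> {-\<delta><..<\<delta>}"
      then have zs: "z + s *\<^sub>R \<Lambda> e \<in> W" by (intro seg[OF z]) auto
      have de: "dderiv D (\<Lambda> e) (z + s *\<^sub>R \<Lambda> e) = e"
        unfolding D_def by (rule patch_tangent[OF patch zs]) (use tang[OF pd(9)[OF zs]] in \<open>simp add: inner_commute\<close>)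
      have "((\<lambda>t. D (z + t *\<^sub>R \<Lambda> e)) has_vector_derivative e) (at s)"
        by (rule line_derivative_shift) (use smooth_on_has_dderiv[OF WW smD UNIV_I zs, of "\<Lambda> e"] de in simp)
      then have "(f has_vector_derivative (e - 1 *\<^sub>R e)) (at s)"
        unfolding f_def by (intro has_vector_derivative_diff has_vector_derivative_scaleR[of "\<lambda>t. t" 1 s UNIV "\<lambda>t. e" 0, simplified]) (auto intro!: derivative_eq_intros)
      then show "(f has_derivative (\<lambda>h. 0)) (at s within {-\<delta><..<\<delta>})"
        by (simp add: has_vector_derivative_def has_derivative_at_withinI)
    qed (use t \<delta> in auto)
    then show ?thesis by (simp add: f_def algebra_simps)
  qed
  have "continuous_map (prod_topology (subtopology M U) (top_of_set {-\<delta><..<\<delta>})) M \<phi>"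
  proof -
    have "continuous_map (prod_topology (subtopology M U) (top_of_set {-\<delta><..<\<delta>})) euclidean (\<lambda>x. \<Lambda> (F (fst x)) + snd x *\<^sub>R \<Lambda> e)"
    proof (rule continuous_map_add)
      show "continuous_map (prod_topology (subtopology M U) (top_of_set {-\<delta><..<\<delta>})) euclidean (\<lambda>x. \<Lambda> (F (fst x)))"
        using continuous_map_compose[OF continuous_map_fst continuous_map_from_subtopology[OF continuous_proj_F[OF pd(2)]]]
        by (simp add: o_def)
      have "continuous_map (top_of_set {-\<delta><..<\<delta>}) euclidean (\<lambda>t. t *\<^sub>R \<Lambda> e)"
        by (auto intro: continuous_intros)
      from continuous_map_compose[OF continuous_map_snd this]
      show "continuous_map (prod_topology (subtopology M U) (top_of_set {-\<delta><..<\<delta>})) euclidean (\<lambda>x. snd x *\<^sub>R \<Lambda> e)"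
        unfolding o_def .
    qed
    then have "continuous_map (prod_topology (subtopology M U) (top_of_set {-\<delta><..<\<delta>})) (top_of_set W) (\<lambda>x. \<Lambda> (F (fst x)) + snd x *\<^sub>R \<Lambda> e)"
      using seg Uq(1) by (auto simp: continuous_map_in_subtopology abs_less_iff)
    from continuous_map_compose[OF this pd(6)] show ?thesis
      by (simp add: \<phi>_def o_def case_prod_unfold)
  qed
  moreover have "\<phi> (q, 0) = q" if "q \<in> U" for q using Uq(2)[OF that] by (simp add: \<phi>_def)
  moreover have "F (\<phi> (q, t)) = F q + t *\<^sub>R e" if "q \<in> U" "t \<in> {-\<delta><..<\<delta>}" for q t
  proof -
    have "\<bar>t\<bar> < \<delta>" using that(2) by auto
    from line[OF Uq(1)[OF that(1)] this] show ?thesis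
      using Uq(2)[OF that(1)] by (simp add: \<phi>_def D_def)
  qed
  moreover have "inj_on F U" using inj_on_subset[OF patch_inj[OF patch]] bW by (simp add: U_def image_mono)
  moreover have "p \<in> U" using y r(1) by (auto simp: U_def)
  ultimately show ?thesis using U \<delta> by blast
qed

text \<open>
  Locally \<open>g\<close> is \<open>\<sigma> \<circ> \<Lambda> \<circ> F \<circ> g\<close>. Therefore smoothness of a continuous map into \<open>M\<close> can be read off in the
  ambient space, where the flow of a constant vector field is a translation.
\<close>
lemma smooth_lift:
  fixes S :: "'x::real_normed_vector set"
  assumes S: "subspace S" "openin (top_of_set S) V" and g: "continuous_map (top_of_set V) M g"
    and Fg: "smooth_on S V (F \<circ> g)" and c: "c \<in> A"
  shows "smooth_on S {x \<in> V. g x \<in> fst c} (snd c \<circ> g)"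
proof (rule smooth_on_local[OF S(1)])
  have pre: "openin (top_of_set S) {x \<in> V. g x \<in> T}" if "openin M T" for T
    using openin_continuous_map_preimage[OF g that] S(2) by (auto intro: openin_trans)
  fix x assume x: "x \<in> {x \<in> V. g x \<in> fst c}"
  then obtain \<Lambda> W \<sigma> where patch: "patch c \<Lambda> W \<sigma>" and xW: "g x \<in> \<sigma> ` W" using patch_at[OF c, of "g x"] by blast
  note pd = patchD[OF patch]
  define V1 where "V1 = {x \<in> V. g x \<in> \<sigma> ` W}"
  have V1: "openin (top_of_set S) V1" unfolding V1_def by (rule pre[OF pd(5)])
  have "smooth_on S V1 (\<lambda>x. (snd c \<circ> \<sigma>) (\<Lambda> ((F \<circ> g) x)))"
  proof (rule smooth_on_compose[OF S(1) V1 pd(3) _ pd(7)])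
    show "(\<lambda>x. \<Lambda> ((F \<circ> g) x)) ` V1 \<subseteq> W" using pd(11) by (auto simp: V1_def)
    show "smooth_on S V1 (\<lambda>x. \<Lambda> ((F \<circ> g) x))"
      by (rule smooth_on_linear_outer[OF patch_bounded_linear[OF patch] smooth_on_subset[OF Fg]]) (auto simp: V1_def)
  qed
  then have "smooth_on S V1 (snd c \<circ> g)"
    by (rule smooth_on_cong[OF S(1) V1, rotated]) (use pd(12) in \<open>auto simp: V1_def\<close>)
  then show "\<exists>U. openin (top_of_set S) U \<and> x \<in> U \<and> U \<subseteq> {x \<in> V. g x \<in> fst c} \<and> smooth_on S U (snd c \<circ> g)"
    using V1 x xW pd(4) by (intro exI[of _ V1]) (auto simp: V1_def)
qed

end

context proper_lambda_hypersurface
begin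

lemma tangent_flow:
  assumes "\<And>q. q \<in> topspace M \<Longrightarrow> N q \<bullet> e = 0"
  shows "proper_local_flow M F e"
  by unfold_locales
    (use Hausdorff continuous_F compact_sublevel tangent_line_box[OF assms] in auto)

text \<open>
  With constant normal, \<open>F\<close> maps into a hyperplane, every direction of which is tangent to \<open>M\<close> everywhere.
  Starting at one point and following the flows of the vectors of an orthonormal frame one after the other
  gives a continuous section of \<open>F\<close> over the hyperplane. Its image is open and closed, hence all of \<open>M\<close>.
\<close>
lemma flat_imp_hyperplane:
  assumes flat: "\<And>p q. p \<in> topspace M \<Longrightarrow> q \<in> topspace M \<Longrightarrow> N p = N q"
  shows "is_hyperplane M F"
proof -
  obtain p0 where p0: "p0 \<in> topspace M" using nonempty by blast
  define \<nu> where "\<nu> = N p0"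
  have N: "N p = \<nu>" if "p \<in> topspace M" for p using flat[OF that p0] by (simp add: \<nu>_def)
  have height: "F p \<bullet> \<nu> = F p0 \<bullet> \<nu>" if "p \<in> topspace M" for p
  proof (rule constant_of_zero_differential[OF _ _ that p0])
    fix c assume c: "c \<in> A"
    have "smooth_on UNIV (snd c ` fst c) (\<lambda>x. (F \<circ> chart_inv c) x \<bullet> \<nu>)"
      by (rule smooth_on_linear_outer[OF bounded_linear_inner_left chart_facts(4)[OF c]])
    then show "smooth_on UNIV (snd c ` fst c) ((\<lambda>p. F p \<bullet> \<nu>) \<circ> chart_inv c)" by (simp add: o_def)
    fix p v assume p: "p \<in> fst c"
    have V: "openin (top_of_set UNIV) (snd c ` fst c)" using chart_facts(2)[OF c] by simp
    have "differential c (\<lambda>p. F p \<bullet> \<nu>) p v = dderiv (\<lambda>x. (F \<circ> chart_inv c) x \<bullet> \<nu>) v (snd c p)"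
      by (simp add: differential_eq o_def)
    also have "\<dots> = differential c F p v \<bullet> \<nu>"
      unfolding differential_eq
      by (rule dderiv_linear_outer[OF bounded_linear_inner_left subspace_UNIV V chart_facts(4)[OF c] UNIV_I])
        (use p in blast)
    also have "\<dots> = 0" using differential_normal[OF c p] N[of p] p fst_chart_subset[OF c] by auto
    finally show "differential c (\<lambda>p. F p \<bullet> \<nu>) p v = 0" .
  qed
  define H where "H = {x. \<nu> \<bullet> x = \<nu> \<bullet> F p0}"
  have FH: "F p \<in> H" if "p \<in> topspace M" for p using height[OF that] by (simp add: H_def inner_commute)
  obtain u :: "'n \<Rightarrow> 'e" where frame: "\<And>i j. u i \<bullet> u j = (if i = j then 1 else 0)" "\<And>i. u i \<bullet> \<nu> = 0"
    "\<And>w. w = (w \<bullet> \<nu>) *\<^sub>R \<nu> + (\<Sum>i\<in>UNIV. (w \<bullet> u i) *\<^sub>R u i)"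
    using orthonormal_frame[OF p0] by (metis \<nu>_def)
  \<comment> \<open>lift the hyperplane along the frame directions, one after the other\<close>
  have lift: "\<exists>s. continuous_map euclidean M s \<and> s 0 = p0 \<and> (\<forall>x. F (s x) = F p0 + (\<Sum>i\<in>I. (x \<bullet> u i) *\<^sub>R u i))"
    if "finite I" for I
    using that
  proof (induction I rule: finite_induct)
    case empty
    then show ?case using p0 by (intro exI[of _ "\<lambda>x. p0"]) auto
  next
    case (insert i I)
    then obtain s where s: "continuous_map euclidean M s" "s 0 = p0"
      "\<And>x. F (s x) = F p0 + (\<Sum>i\<in>I. (x \<bullet> u i) *\<^sub>R u i)" by blast
    interpret fl: proper_local_flow M F "u i"
      by (rule tangent_flow) (use N frame(2) in \<open>simp add: inner_commute\<close>)
    define s' where "s' x = fl.flow (s x) (x \<bullet> u i)" for x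
    have sM: "s x \<in> topspace M" for x using s(1) by (auto simp: continuous_map_def)
    have "continuous_map euclidean (prod_topology M euclideanreal) (\<lambda>x. (s x, x \<bullet> u i))"
      by (intro continuous_map_pairedI s(1)) (auto intro: continuous_intros)
    from continuous_map_compose[OF this fl.flow_continuous]
    have "continuous_map euclidean M s'" by (simp add: s'_def[abs_def] o_def)
    moreover have "s' 0 = p0" using fl.flow_0[OF p0] s(2) by (simp add: s'_def)
    moreover have "F (s' x) = F p0 + (\<Sum>i\<in>insert i I. (x \<bullet> u i) *\<^sub>R u i)" for x
      using insert.hyps s(3)[of x] fl.F_flow[OF sM] by (simp add: s'_def algebra_simps)
    ultimately show ?case by blast
  qed
  obtain s0 where s0: "continuous_map euclidean M s0" "s0 0 = p0"
    "\<And>x. F (s0 x) = F p0 + (\<Sum>i\<in>UNIV. (x \<bullet> u i) *\<^sub>R u i)" using lift[of UNIV] by auto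
  define s where "s y = s0 (y - F p0)" for y
  have "continuous_map euclidean euclidean (\<lambda>y. y - F p0)" by (auto intro: continuous_intros)
  from continuous_map_compose[OF this s0(1)] have cs: "continuous_map euclidean M s" by (simp add: s_def[abs_def] o_def)
  have Fs: "F (s y) = y" if "y \<in> H" for y
  proof -
    have "(y - F p0) \<bullet> \<nu> = 0" using that by (simp add: H_def inner_diff_right inner_commute[of _ \<nu>])
    then have "(\<Sum>i\<in>UNIV. ((y - F p0) \<bullet> u i) *\<^sub>R u i) = y - F p0" using frame(3)[of "y - F p0"] by simp
    then show ?thesis using s0(3)[of "y - F p0"] by (simp add: s_def)
  qed
  have csF: "continuous_map M M (\<lambda>p. s (F p))"
    using continuous_map_compose[OF continuous_F cs] by (simp add: o_def)
  have sF: "s (F p) = p" if "p \<in> topspace M" for p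
  proof (rule connected_space_propagate[OF connected, of "\<lambda>p. s (F p) = p", OF _ _ p0 _ that])
    have "closedin M {p \<in> topspace M. s (F p) = id p}"
      by (rule closedin_continuous_maps_eq[OF Hausdorff csF continuous_map_id])
    then show "closedin M {p \<in> topspace M. s (F p) = p}" by simp
    show "s (F p0) = p0" using s0(2) by (simp add: s_def)
    fix p assume p: "p \<in> topspace M" "s (F p) = p"
    obtain c where c: "c \<in> A" "p \<in> fst c" using chart_at[OF p(1)] .
    obtain \<Lambda> W \<sigma> where patch: "patch c \<Lambda> W \<sigma>" and pW: "p \<in> \<sigma> ` W" using patch_at[OF c] .
    define T where "T = {q \<in> topspace M. s (F q) \<in> \<sigma> ` W} \<inter> \<sigma> ` W"
    have "openin M T"
      unfolding T_def by (intro openin_Int patchD(5)[OF patch] openin_continuous_map_preimage[OF csF])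
    moreover have "s (F q) = q" if "q \<in> T" for q
    proof -
      have q: "q \<in> topspace M" "s (F q) \<in> \<sigma> ` W" "q \<in> \<sigma> ` W" using that by (auto simp: T_def)
      have "F (s (F q)) = F q" by (rule Fs[OF FH[OF q(1)]])
      then show ?thesis using inj_onD[OF patch_inj[OF patch] _ q(2,3)] by blast
    qed
    moreover have "p \<in> T" using p pW by (simp add: T_def)
    ultimately show "\<exists>U. openin M U \<and> p \<in> U \<and> (\<forall>q\<in>U. s (F q) = q)" by blast
  qed
  have "homeomorphic_maps M (top_of_set H) F s"
    unfolding homeomorphic_maps_def
  proof (intro conjI ballI)
    show "continuous_map M (top_of_set H) F" using continuous_F FH by (auto simp: continuous_map_in_subtopology)
    show "continuous_map (top_of_set H) M s" by (rule continuous_map_from_subtopology[OF cs])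
  qed (use sF Fs in auto)
  then have "homeomorphic_map M (top_of_set H) F" using homeomorphic_map_maps by blast
  moreover have "\<nu> \<noteq> 0" using norm_N[OF p0] by (auto simp: \<nu>_def)
  ultimately show ?thesis unfolding is_hyperplane_def H_def by blast
qed

end

section \<open>The horizontal slice of a vertical hypersurface\<close>

lemma hyperplane_projection:
  fixes a b :: "'a::euclidean_space"
  assumes "a \<noteq> 0" "b \<noteq> 0"
  obtains ell where "linear ell" "\<And>x. b \<bullet> ell x = 0" "\<And>x. a \<bullet> x = 0 \<Longrightarrow> ell x = 0 \<Longrightarrow> x = 0"
proof -
  have "dim {x. a \<bullet> x = 0} = dim {x. b \<bullet> x = 0}"
    using dim_hyperplane[OF assms(1)] dim_hyperplane[OF assms(2)] by simp
  from subspace_isomorphism[OF subspace_hyperplane subspace_hyperplane this]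
  obtain f where f: "linear f" "f ` {x. a \<bullet> x = 0} = {x. b \<bullet> x = 0}" "inj_on f {x. a \<bullet> x = 0}" by blast
  define \<pi> where "\<pi> x = x - ((a \<bullet> x) / (a \<bullet> a)) *\<^sub>R a" for x
  have lin: "linear \<pi>"
    by (rule linearI) (simp_all add: \<pi>_def inner_add_right add_divide_distrib scaleR_add_left algebra_simps)
  have \<pi>: "a \<bullet> \<pi> x = 0" for x using assms(1) by (simp add: \<pi>_def inner_diff_right)
  show ?thesis
  proof (rule that[of "\<lambda>x. f (\<pi> x)"])
    show "linear (\<lambda>x. f (\<pi> x))" using linear_compose[OF lin f(1)] by (simp add: o_def)
    show "b \<bullet> f (\<pi> x) = 0" for x using f(2) \<pi>[of x] by blast
    fix x assume x: "a \<bullet> x = 0" "f (\<pi> x) = 0"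
    have "\<pi> x = x" using x(1) by (simp add: \<pi>_def)
    then have "f x = f 0" using x(2) linear_0[OF f(1)] by simp
    then show "x = 0" using inj_onD[OF f(3), of x 0] x(1) by simp
  qed
qed

text \<open>
  The case of a vanishing angle function: the last axis is tangent everywhere. The coordinate \<open>k\<close> is an
  arbitrary choice, which singles out a hyperplane of \<open>real^'n\<close> as the model space of the slice at height 0.
\<close>
locale vertical_hypersurface = proper_lambda_hypersurface M A F N lam
  for M :: "'p topology" and A :: "('p, real^'n) chart set" and F N :: "'p \<Rightarrow> (real^'n) \<times> real" and lam :: real +
  fixes k :: 'n
  assumes vertical: "p \<in> topspace M \<Longrightarrow> snd (N p) = 0"
begin

abbreviation up :: "(real^'n) \<times> real" where "up \<equiv> (0, 1)"

sublocale vflow: proper_local_flow M F up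
  by (rule tangent_flow) (simp add: vertical inner_prod_def)

definition slice :: "'p set" where "slice = {p \<in> topspace M. snd (F p) = 0}"
definition slice_top :: "'p topology" where "slice_top = subtopology M slice"
definition slice_space :: "(real^'n) set" where "slice_space = {x. axis k 1 \<bullet> x = 0}"
definition drop :: "'p \<Rightarrow> 'p" where "drop p = vflow.flow p (- snd (F p))"
definition slice_F :: "'p \<Rightarrow> real^'n" where "slice_F = fst \<circ> F"
definition slice_N :: "'p \<Rightarrow> real^'n" where "slice_N = fst \<circ> N"

text \<open>
  Charts of the slice come from patches for which \<open>\<Lambda>\<close> sends the last axis to the \<open>k\<close>-th one and the
  horizontal space to the model hyperplane. Then the \<open>k\<close>-th coordinate in the patch is the height, and the
  slice is the hyperplane in these coordinates. The coordinate map is the restriction of a linear map of the ambient space, which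
  makes the changes of coordinates smooth.
\<close>
definition slice_patch :: "('p, real^'n) chart \<Rightarrow> ((real^'n) \<times> real \<Rightarrow> real^'n) \<Rightarrow> (real^'n \<Rightarrow> real^'n) \<Rightarrow>
    (real^'n) set \<Rightarrow> (real^'n \<Rightarrow> 'p) \<Rightarrow> ('p, real^'n) chart \<Rightarrow> bool" where
  "slice_patch c \<Lambda> ell W \<sigma> c' \<longleftrightarrow> patch c \<Lambda> W \<sigma> \<and> linear ell \<and> range ell \<subseteq> slice_space \<and>
     (\<forall>x t. \<Lambda> (x, t) = ell x + t *\<^sub>R axis k 1) \<and> c' = (slice \<inter> \<sigma> ` W, \<lambda>q. ell (slice_F q))"

definition slice_atlas :: "('p, real^'n) chart set" where
  "slice_atlas = {c'. \<exists>c \<Lambda> ell W \<sigma>. slice_patch c \<Lambda> ell W \<sigma> c'}"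

lemma slice_top_space [simp]: "topspace slice_top = slice"
  by (auto simp: slice_top_def slice_def)

lemma slice_subset: "slice \<subseteq> topspace M"
  by (auto simp: slice_def)

lemma F_flow_fst_snd:
  assumes "p \<in> topspace M"
  shows "fst (F (vflow.flow p t)) = fst (F p)" "snd (F (vflow.flow p t)) = snd (F p) + t"
  using vflow.F_flow[OF assms, of t] by simp_all

lemma drop_in_slice: "p \<in> topspace M \<Longrightarrow> drop p \<in> slice"
  using F_flow_fst_snd vflow.flow_in by (simp add: drop_def slice_def)

lemma drop_slice: "p \<in> slice \<Longrightarrow> drop p = p"
  using vflow.flow_0 by (simp add: drop_def slice_def)

lemma continuous_height: "continuous_map M euclideanreal (\<lambda>p. snd (F p))"
  using continuous_map_compose[OF continuous_F, of euclideanreal snd] by (simp add: o_def continuous_on_snd)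

lemma continuous_drop: "continuous_map M slice_top drop"
proof -
  have "continuous_map M (prod_topology M euclideanreal) (\<lambda>p. (p, - snd (F p)))"
    by (intro continuous_map_pairedI continuous_map_minus continuous_height) simp
  from continuous_map_compose[OF this vflow.flow_continuous]
  have "continuous_map M M drop" by (simp add: drop_def[abs_def] o_def)
  then show ?thesis using drop_in_slice by (auto simp: slice_top_def continuous_map_in_subtopology)
qed

lemma slice_connected: "connected_space slice_top"
proof -
  have "drop ` topspace M = slice"
  proof (intro equalityI subsetI)
    fix q assume "q \<in> slice"
    then show "q \<in> drop ` topspace M"
      using drop_slice[of q] slice_subset by (intro image_eqI[of _ _ q]) auto
  qed (use drop_in_slice in blast)
  moreover have "connectedin slice_top (drop ` topspace M)"
    using connectedin_continuous_map_image[OF continuous_drop] connected connectedin_topspace by blast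
  ultimately show ?thesis by (simp flip: connectedin_topspace)
qed

lemma slice_nonempty: "slice \<noteq> {}"
  using nonempty drop_in_slice by blast

lemma splitting_homeomorphism:
  "homeomorphic_maps (prod_topology slice_top euclideanreal) M (\<lambda>(q, t). vflow.flow q t) (\<lambda>p. (drop p, snd (F p)))"
  unfolding homeomorphic_maps_def
proof (intro conjI ballI)
  have "continuous_map (prod_topology slice_top euclideanreal) (prod_topology M euclideanreal) (\<lambda>x. (fst x, snd x))"
    using continuous_map_into_fulltopology[OF continuous_map_fst[of slice_top euclideanreal, unfolded slice_top_def]]
    by (intro continuous_map_pairedI continuous_map_snd) (simp add: slice_top_def)
  from continuous_map_compose[OF this vflow.flow_continuous]
  show "continuous_map (prod_topology slice_top euclideanreal) M (\<lambda>(q, t). vflow.flow q t)"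
    by (simp add: o_def)
  show "continuous_map M (prod_topology slice_top euclideanreal) (\<lambda>p. (drop p, snd (F p)))"
    by (intro continuous_map_pairedI continuous_drop continuous_height)
qed (use slice_subset in \<open>auto simp: drop_def vflow.flow_add F_flow_fst_snd vflow.flow_0 slice_def\<close>)

lemma slice_patchD:
  assumes "slice_patch c \<Lambda> ell W \<sigma> c'"
  shows "patch c \<Lambda> W \<sigma>" "linear ell" "ell x \<in> slice_space" "\<Lambda> (x, t) = ell x + t *\<^sub>R axis k 1"
    "fst c' = slice \<inter> \<sigma> ` W" "snd c' = (\<lambda>q. ell (slice_F q))"
  using assms by (auto simp: slice_patch_def)

lemma slice_space_facts:
  "subspace slice_space" "dim slice_space + 1 = CARD('n)" "axis k 1 \<notin> slice_space" "x \<in> slice_space \<longleftrightarrow> x $ k = 0"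
proof -
  show "subspace slice_space" unfolding slice_space_def by (rule subspace_hyperplane)
  have "(axis k 1 :: real^'n) \<noteq> 0" by (simp add: axis_eq_0_iff)
  from dim_hyperplane[OF this] show "dim slice_space + 1 = CARD('n)" by (simp add: slice_space_def)
  show "axis k 1 \<notin> slice_space" by (simp add: slice_space_def inner_axis_axis)
  show "x \<in> slice_space \<longleftrightarrow> x $ k = 0" by (simp add: slice_space_def inner_axis')
qed

context
  fixes c \<Lambda> ell W \<sigma> c'
  assumes sp: "slice_patch c \<Lambda> ell W \<sigma> c'"
begin

lemmas spD = slice_patchD[OF sp]
lemmas ppD = patchD[OF spD(1)]

abbreviation "Ws \<equiv> slice_space \<inter> W"

lemma Ws_open: "openin (top_of_set slice_space) Ws"
  using ppD(3) by (simp add: openin_open_Int)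

lemma slice_coord: "q \<in> slice \<Longrightarrow> \<Lambda> (F q) = snd c' q"
proof -
  assume q: "q \<in> slice"
  have "\<Lambda> (F q) = ell (fst (F q)) + snd (F q) *\<^sub>R axis k 1"
    using spD(4)[of "fst (F q)" "snd (F q)"] by (simp only: prod.collapse)
  then show "\<Lambda> (F q) = snd c' q" using q by (simp add: spD(6) slice_def slice_F_def)
qed

lemma snd_F_coord: "snd (F q) = \<Lambda> (F q) $ k"
  using spD(4)[of "fst (F q)" "snd (F q)"] spD(3)[of "fst (F q)"]
  by (simp add: slice_space_facts(4) axis_def)

lemma sigma_slice: "y \<in> Ws \<Longrightarrow> \<sigma> y \<in> slice"
  using snd_F_coord[of "\<sigma> y"] ppD(8,9)[of y] by (simp add: slice_def slice_space_facts(4))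

lemma slice_image: "snd c' ` fst c' = Ws"
proof
  show "snd c' ` fst c' \<subseteq> Ws"
  proof
    fix y assume "y \<in> snd c' ` fst c'"
    then obtain q where q: "q \<in> slice" "q \<in> \<sigma> ` W" "y = snd c' q" by (auto simp: spD(5))
    have "y \<in> W" using ppD(11)[OF q(2)] slice_coord[OF q(1)] q(3) by simp
    moreover have "y \<in> slice_space" using spD(3) q(3) by (simp add: spD(6))
    ultimately show "y \<in> Ws" by simp
  qed
  show "Ws \<subseteq> snd c' ` fst c'"
  proof
    fix y assume y: "y \<in> Ws"
    then have "snd c' (\<sigma> y) = y" using slice_coord[OF sigma_slice[OF y]] ppD(8) by simp
    then show "y \<in> snd c' ` fst c'" using sigma_slice[OF y] y spD(5) by (metis IntD2 IntI image_eqI)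
  qed
qed

lemma slice_sigma:
  "y \<in> Ws \<Longrightarrow> \<sigma> y \<in> fst c'" "y \<in> Ws \<Longrightarrow> snd c' (\<sigma> y) = y" "q \<in> fst c' \<Longrightarrow> \<sigma> (snd c' q) = q" "q \<in> fst c' \<Longrightarrow> snd c' q \<in> Ws"
proof -
  show "y \<in> Ws \<Longrightarrow> \<sigma> y \<in> fst c'" using sigma_slice by (auto simp: spD(5))
  show "y \<in> Ws \<Longrightarrow> snd c' (\<sigma> y) = y" using slice_coord[OF sigma_slice] ppD(8) by simp
  show "q \<in> fst c' \<Longrightarrow> \<sigma> (snd c' q) = q" using slice_coord[of q] ppD(12)[of q] by (simp add: spD(5))
  show "q \<in> fst c' \<Longrightarrow> snd c' q \<in> Ws" using slice_image by blast
qed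

lemma slice_chart_inv: "y \<in> Ws \<Longrightarrow> chart_inv c' y = \<sigma> y"
proof -
  assume y: "y \<in> Ws"
  have "inj_on (snd c') (fst c')" by (rule inj_onI) (metis slice_sigma(3))
  then show "chart_inv c' y = \<sigma> y"
    unfolding chart_inv_def using slice_sigma(1,2)[OF y] by (metis inv_into_f_f)
qed

lemma continuous_sigma_slice: "continuous_map (top_of_set Ws) slice_top \<sigma>"
  using continuous_map_from_subtopology_mono[OF ppD(6), of Ws] sigma_slice
  by (auto simp: slice_top_def continuous_map_in_subtopology)

lemma slice_is_chart: "is_chart slice_space slice_top c'"
  unfolding is_chart_def
proof (intro conjI)
  show "openin slice_top (fst c')"
    unfolding slice_top_def spD(5) using openin_subtopology_Int2[OF ppD(5), of slice] by (simp add: Int_commute)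
  show "openin (top_of_set slice_space) (snd c' ` fst c')" unfolding slice_image by (rule Ws_open)
  have "homeomorphic_maps (subtopology slice_top (fst c')) (top_of_set Ws) (snd c') \<sigma>"
    unfolding homeomorphic_maps_def
  proof (intro conjI ballI)
    have "continuous_map (subtopology slice_top (fst c')) euclidean (\<lambda>q. \<Lambda> (F q))"
      unfolding slice_top_def by (intro continuous_map_from_subtopology continuous_proj_F ppD(2))
    then have "continuous_map (subtopology slice_top (fst c')) euclidean (snd c')"
      by (rule continuous_map_eq) (use slice_coord in auto)
    then show "continuous_map (subtopology slice_top (fst c')) (top_of_set Ws) (snd c')"
      using slice_sigma(4) by (auto simp: continuous_map_in_subtopology)
    show "continuous_map (top_of_set Ws) (subtopology slice_top (fst c')) \<sigma>"
      using continuous_sigma_slice slice_sigma(1) by (auto simp: continuous_map_in_subtopology)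
  qed (use slice_sigma in auto)
  then show "homeomorphic_map (subtopology slice_top (fst c')) (top_of_set (snd c' ` fst c')) (snd c')"
    unfolding slice_image using homeomorphic_map_maps by blast
qed

lemma slice_smooth:
  assumes "smooth_on UNIV W (f \<circ> \<sigma>)"
  shows "smooth_on slice_space Ws (f \<circ> \<sigma>)" "smooth_on slice_space Ws (f \<circ> chart_inv c')"
proof -
  show *: "smooth_on slice_space Ws (f \<circ> \<sigma>)" by (rule smooth_on_subset[OF assms]) auto
  show "smooth_on slice_space Ws (f \<circ> chart_inv c')"
    by (rule smooth_on_cong[OF slice_space_facts(1) Ws_open _ *]) (simp add: slice_chart_inv)
qed

lemma smooth_slice_FN: "smooth_on UNIV W (slice_F \<circ> \<sigma>)" "smooth_on UNIV W (slice_N \<circ> \<sigma>)"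
  using smooth_on_linear_outer[OF bounded_linear_fst patch_smooth(1)[OF spD(1)]]
    smooth_on_linear_outer[OF bounded_linear_fst patch_smooth(2)[OF spD(1)]]
  by (simp_all add: slice_F_def slice_N_def o_def)

lemma slice_differential:
  assumes y: "y \<in> Ws" and v: "v \<in> slice_space"
  shows "differential c' f (\<sigma> y) v = dderiv (f \<circ> \<sigma>) v y"
proof -
  have "differential c' f (\<sigma> y) v = dderiv (f \<circ> chart_inv c') v y"
    by (simp add: differential_def dderiv_def slice_sigma(2)[OF y])
  also have "\<dots> = dderiv (f \<circ> \<sigma>) v y"
    by (rule dderiv_cong[OF slice_space_facts(1) Ws_open y v]) (simp add: slice_chart_inv)
  finally show ?thesis .
qed

lemma dderiv_slice_F:
  assumes y: "y \<in> W"
  shows "dderiv (slice_F \<circ> \<sigma>) v y = fst (dderiv (F \<circ> \<sigma>) v y)"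
    and "dderiv (slice_N \<circ> \<sigma>) v y = fst (dderiv (N \<circ> \<sigma>) v y)"
    and "snd (dderiv (N \<circ> \<sigma>) v y) = 0"
    and "v \<in> slice_space \<Longrightarrow> snd (dderiv (F \<circ> \<sigma>) v y) = 0"
proof -
  note o = subspace_UNIV ppD(10)
  show "dderiv (slice_F \<circ> \<sigma>) v y = fst (dderiv (F \<circ> \<sigma>) v y)"
    using dderiv_linear_outer[OF bounded_linear_fst o patch_smooth(1)[OF spD(1)] UNIV_I y] by (simp add: slice_F_def o_def)
  show "dderiv (slice_N \<circ> \<sigma>) v y = fst (dderiv (N \<circ> \<sigma>) v y)"
    using dderiv_linear_outer[OF bounded_linear_fst o patch_smooth(2)[OF spD(1)] UNIV_I y] by (simp add: slice_N_def o_def)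
  have "snd (dderiv (N \<circ> \<sigma>) v y) = dderiv (\<lambda>y. snd ((N \<circ> \<sigma>) y)) v y"
    using dderiv_linear_outer[OF bounded_linear_snd o patch_smooth(2)[OF spD(1)] UNIV_I y] by simp
  also have "\<dots> = dderiv (\<lambda>y. 0) v y"
    by (rule dderiv_cong[OF o y UNIV_I]) (use vertical ppD(9) in simp)
  finally show "snd (dderiv (N \<circ> \<sigma>) v y) = 0" by simp
  assume v: "v \<in> slice_space"
  let ?z = "dderiv (F \<circ> \<sigma>) v y"
  have "\<Lambda> ?z $ k = snd ?z"
    using spD(4)[of "fst ?z" "snd ?z"] spD(3)[of "fst ?z"] by (simp add: slice_space_facts(4) axis_def)
  then show "snd ?z = 0" using patch_dderiv_proj[OF spD(1) y] v by (simp add: slice_space_facts(4))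
qed

lemma slice_differential_F:
  assumes "y \<in> Ws" "v \<in> slice_space"
  shows "differential c' slice_F (\<sigma> y) v = fst (dderiv (F \<circ> \<sigma>) v y)"
    "dderiv (F \<circ> \<sigma>) v y = (differential c' slice_F (\<sigma> y) v, 0)"
  using slice_differential[OF assms, of slice_F] dderiv_slice_F(1,4)[of y v] assms by (auto simp: prod_eq_iff)

lemma slice_normal:
  assumes y: "y \<in> Ws" and v: "v \<in> slice_space"
  shows "dderiv (slice_F \<circ> \<sigma>) v y \<bullet> slice_N (\<sigma> y) = 0"
proof -
  have yW: "y \<in> W" using y by simp
  have "dderiv (F \<circ> \<sigma>) v y \<bullet> N (\<sigma> y) = 0" by (rule patch_dderiv_normal[OF spD(1) yW])
  then show ?thesis
    using vertical[OF ppD(9)[OF yW]] by (simp add: inner_prod_def slice_N_def dderiv_slice_F(1)[OF yW])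
qed

lemma slice_second_fundamental_form:
  assumes y: "y \<in> Ws" and v: "v \<in> slice_space"
  shows "second_fundamental_form c' slice_F slice_N (\<sigma> y) v v = - (dderiv (N \<circ> \<sigma>) v y \<bullet> dderiv (F \<circ> \<sigma>) v y)"
proof -
  note o = slice_space_facts(1) Ws_open
  define D where "D = slice_F \<circ> \<sigma>"
  define n where "n = slice_N \<circ> \<sigma>"
  have yW: "y \<in> W" using y by simp
  have smD: "smooth_on slice_space Ws D" and smn: "smooth_on slice_space Ws n"
    using slice_smooth(1)[OF smooth_slice_FN(1)] slice_smooth(1)[OF smooth_slice_FN(2)] by (simp_all add: D_def n_def)
  have smDv: "smooth_on slice_space Ws (dderiv D v)" by (rule smooth_on_dderiv[OF o smD v])
  have "second_fundamental_form c' slice_F slice_N (\<sigma> y) v v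
      = differential c' (\<lambda>q. differential c' slice_F q v) (\<sigma> y) v \<bullet> slice_N (\<sigma> y)"
    by (simp add: second_fundamental_form_def)
  also have "differential c' (\<lambda>q. differential c' slice_F q v) (\<sigma> y) v = dderiv ((\<lambda>q. differential c' slice_F q v) \<circ> \<sigma>) v y"
    by (rule slice_differential[OF y v])
  also have "\<dots> = dderiv (dderiv D v) v y"
    by (rule dderiv_cong[OF o y v]) (simp add: slice_differential[OF _ v] D_def)
  also have "slice_N (\<sigma> y) = n y" by (simp add: n_def)
  finally have 1: "second_fundamental_form c' slice_F slice_N (\<sigma> y) v v = dderiv (dderiv D v) v y \<bullet> n y" .
  have "dderiv (\<lambda>y. dderiv D v y \<bullet> n y) v y = dderiv (\<lambda>y. 0) v y"
    by (rule dderiv_cong[OF o y v]) (use slice_normal[OF _ v] in \<open>simp add: D_def n_def\<close>)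
  then have 2: "dderiv (dderiv D v) v y \<bullet> n y = - (dderiv D v y \<bullet> dderiv n v y)"
    using dderiv_inner[OF o smDv smn v y] by simp
  show ?thesis
    unfolding 1 2 using dderiv_slice_F[OF yW, of v] v by (simp add: D_def n_def inner_prod_def inner_commute)
qed

text \<open>
  Adding the vertical direction to an orthonormal basis of the tangent space of the slice gives one for the
  hypersurface. The normal field is horizontal, so the vertical direction contributes nothing to the trace.
\<close>
lemma slice_mean_curvature:
  assumes y: "y \<in> Ws" and B: "orthonormal_tangent_basis slice_space c' slice_F (\<sigma> y) B"
  shows "mean_curvature c' B slice_F slice_N (\<sigma> y) + (1/2) * (slice_F (\<sigma> y) \<bullet> slice_N (\<sigma> y)) = lam"
proof -
  have yW: "y \<in> W" using y by simp
  have B1: "B \<subseteq> slice_space" "finite B" "card B = dim slice_space"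
    and B2: "\<And>v w. v \<in> B \<Longrightarrow> w \<in> B \<Longrightarrow> induced_metric c' slice_F (\<sigma> y) v w = (if v = w then 1 else 0)"
    using B by (auto simp: orthonormal_tangent_basis_def)
  define u where "u v = dderiv (F \<circ> \<sigma>) v y" for v
  define b where "b = (axis k 1 :: real^'n)"
  have Lup: "\<Lambda> up = b" using spD(4)[of 0 1] linear_0[OF spD(2)] by (simp add: b_def)
  have ub: "u b = up"
    using patch_tangent[OF spD(1) yW, of up] vertical[OF ppD(9)[OF yW]] by (simp add: u_def Lup inner_prod_def)
  have bB: "b \<notin> B" using B1(1) slice_space_facts(3) by (auto simp: b_def)
  have uB: "u v = (differential c' slice_F (\<sigma> y) v, 0)" if "v \<in> B" for v
    using slice_differential_F(2)[OF y, of v] that B1(1) by (auto simp: u_def)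
  have on: "u v \<bullet> u w = (if v = w then 1 else 0)" if "v \<in> insert b B" "w \<in> insert b B" for v w
    using that B2 bB by (auto simp: ub uB inner_prod_def induced_metric_def)
  have "(\<Sum>v\<in>insert b B. dderiv (N \<circ> \<sigma>) (\<Lambda> (u v)) y \<bullet> u v) = (\<Sum>i\<in>UNIV. \<Lambda> (dderiv (N \<circ> \<sigma>) (axis i 1) y) $ i)"
  proof (rule patch_trace[OF spD(1) yW _ _ on])
    show "card (insert b B) = CARD('n)" using B1 bB slice_space_facts(2) by simp
    show "u v \<bullet> N (\<sigma> y) = 0" for v unfolding u_def by (rule patch_dderiv_normal[OF spD(1) yW])
  qed (use B1 in auto)
  also have "\<dots> = (1/2) * (F (\<sigma> y) \<bullet> N (\<sigma> y)) - lam"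
    using patch_mean_curvature[OF spD(1) cwmc yW] by simp
  also have "(\<Sum>v\<in>insert b B. dderiv (N \<circ> \<sigma>) (\<Lambda> (u v)) y \<bullet> u v) = (\<Sum>v\<in>B. dderiv (N \<circ> \<sigma>) v y \<bullet> u v)"
  proof -
    have "dderiv (N \<circ> \<sigma>) (\<Lambda> (u b)) y \<bullet> u b = 0"
      unfolding ub Lup by (simp add: inner_prod_def dderiv_slice_F(3)[OF yW])
    moreover have "\<Lambda> (u v) = v" for v unfolding u_def by (rule patch_dderiv_proj[OF spD(1) yW])
    ultimately show ?thesis using B1(2) bB by simp
  qed
  finally have "mean_curvature c' B slice_F slice_N (\<sigma> y) = lam - (1/2) * (F (\<sigma> y) \<bullet> N (\<sigma> y))"
    unfolding mean_curvature_def using slice_second_fundamental_form[OF y] B1(1)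
    by (simp add: u_def sum_negf subset_iff)
  moreover have "F (\<sigma> y) \<bullet> N (\<sigma> y) = slice_F (\<sigma> y) \<bullet> slice_N (\<sigma> y)"
    using vertical[OF ppD(9)[OF yW]] by (simp add: inner_prod_def slice_F_def slice_N_def)
  ultimately show ?thesis by simp
qed

end

text \<open>
  At a point of the slice the normal is horizontal, and any isomorphism from its orthogonal complement in
  \<open>real^'n\<close> to the model hyperplane yields a projection \<open>\<Lambda>\<close> that is injective on the tangent space.
\<close>
lemma slice_chart_at:
  assumes p: "p \<in> slice"
  obtains c \<Lambda> ell W \<sigma> c' where "slice_patch c \<Lambda> ell W \<sigma> c'" "p \<in> fst c'"
proof -
  have pM: "p \<in> topspace M" using p slice_subset by blast
  obtain c where c: "c \<in> A" "p \<in> fst c" using chart_at[OF pM] .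
  have sN: "snd (N p) = 0" by (rule vertical[OF pM])
  then have nz: "fst (N p) \<noteq> 0" using norm_N[OF pM] by (metis norm_zero prod.collapse zero_neq_one zero_prod_def)
  have "(axis k 1 :: real^'n) \<noteq> 0" by (simp add: axis_eq_0_iff)
  then obtain ell :: "real^'n \<Rightarrow> real^'n" where ell: "linear ell" "\<And>x. axis k 1 \<bullet> ell x = 0" "\<And>x. fst (N p) \<bullet> x = 0 \<Longrightarrow> ell x = 0 \<Longrightarrow> x = 0"
    by (rule hyperplane_projection[OF nz]) blast
  define \<Lambda> where "\<Lambda> z = ell (fst z) + snd z *\<^sub>R axis k 1" for z :: "(real^'n) \<times> real"
  have lin: "linear \<Lambda>"
    by (rule linearI) (simp_all add: \<Lambda>_def linear_add[OF ell(1)] linear_scale[OF ell(1)] scaleR_add_left scaleR_add_right)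
  have "z = 0" if "z \<bullet> N p = 0" "\<Lambda> z = 0" for z
  proof -
    have "axis k 1 \<bullet> \<Lambda> z = snd z" by (simp add: \<Lambda>_def inner_add_right ell(2) inner_axis_axis)
    then have "snd z = 0" using that(2) by simp
    moreover have "fst z = 0"
      using that ell(3)[of "fst z"] sN \<open>snd z = 0\<close> by (simp add: \<Lambda>_def inner_prod_def inner_commute)
    ultimately show ?thesis by (simp add: prod_eq_iff)
  qed
  then obtain W \<sigma> where patch: "patch c \<Lambda> W \<sigma>" and pW: "p \<in> \<sigma> ` W" using patch_exists[OF c lin] by metis
  have "slice_patch c \<Lambda> ell W \<sigma> (slice \<inter> \<sigma> ` W, \<lambda>q. ell (slice_F q))"
    using patch ell by (auto simp: slice_patch_def slice_space_def \<Lambda>_def)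
  then show ?thesis using that p pW by fastforce
qed

lemma slice_atlasE:
  assumes "c' \<in> slice_atlas"
  obtains c \<Lambda> ell W \<sigma> where "slice_patch c \<Lambda> ell W \<sigma> c'"
  using assms by (auto simp: slice_atlas_def)

lemma slice_hypersurface: "hypersurface slice_space slice_top slice_atlas slice_F slice_N"
  unfolding hypersurface_def
proof (intro conjI)
  show "smooth_manifold slice_space slice_top slice_atlas"
    unfolding smooth_manifold_def smooth_atlas_def
  proof (intro conjI ballI)
    show "subspace slice_space" by (rule slice_space_facts)
    show "Hausdorff_space slice_top" unfolding slice_top_def by (rule Hausdorff_space_subtopology[OF Hausdorff])
    have "second_countable M" using hypersurface by (simp add: hypersurface_def smooth_manifold_def)
    then show "second_countable slice_top" unfolding slice_top_def by (rule second_countable_subtopology)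
    show "is_chart slice_space slice_top c'" if "c' \<in> slice_atlas" for c'
      by (rule slice_atlasE[OF that]) (rule slice_is_chart)
    show "(\<Union>c'\<in>slice_atlas. fst c') = topspace slice_top"
    proof
      show "(\<Union>c'\<in>slice_atlas. fst c') \<subseteq> topspace slice_top"
      proof
        fix q assume "q \<in> (\<Union>c'\<in>slice_atlas. fst c')"
        then obtain c' where c': "c' \<in> slice_atlas" "q \<in> fst c'" by blast
        from c'(1) obtain c \<Lambda> ell W \<sigma> where "slice_patch c \<Lambda> ell W \<sigma> c'" by (rule slice_atlasE)
        from slice_patchD(5)[OF this] c'(2) show "q \<in> topspace slice_top" by simp
      qed
      show "topspace slice_top \<subseteq> (\<Union>c'\<in>slice_atlas. fst c')"
      proof
        fix p assume "p \<in> topspace slice_top"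
        then have "p \<in> slice" by simp
        then obtain c \<Lambda> ell W \<sigma> c' where "slice_patch c \<Lambda> ell W \<sigma> c'" "p \<in> fst c'" by (rule slice_chart_at)
        then show "p \<in> (\<Union>c'\<in>slice_atlas. fst c')" unfolding slice_atlas_def by blast
      qed
    qed
    fix c1 c2 assume c1: "c1 \<in> slice_atlas" and c2: "c2 \<in> slice_atlas"
    from c1 obtain c \<Lambda> ell W \<sigma> where 1: "slice_patch c \<Lambda> ell W \<sigma> c1" by (rule slice_atlasE)
    from c2 obtain c' \<Lambda>' ell' W' \<sigma>' where 2: "slice_patch c' \<Lambda>' ell' W' \<sigma>' c2" by (rule slice_atlasE)
    have "bounded_linear ell'" using slice_patchD(2)[OF 2] by (simp add: linear_conv_bounded_linear)
    then have "smooth_on slice_space (slice_space \<inter> W) (\<lambda>y. ell' ((slice_F \<circ> chart_inv c1) y))"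
      by (rule smooth_on_linear_outer[OF _ slice_smooth(2)[OF 1 smooth_slice_FN(1)[OF 1]]])
    then have "smooth_on slice_space (slice_space \<inter> W) (snd c2 \<circ> chart_inv c1)"
      by (simp add: slice_patchD(6)[OF 2] o_def)
    then show "smooth_on slice_space (snd c1 ` (fst c1 \<inter> fst c2)) (snd c2 \<circ> chart_inv c1)"
      by (rule smooth_on_subset) (use slice_image[OF 1] in auto)
  qed
  show "dim slice_space + 1 = DIM(real^'n)" using slice_space_facts(2) by simp
  show "topspace slice_top \<noteq> {}" using slice_nonempty by simp
  show "connected_space slice_top" by (rule slice_connected)
  show "immersion slice_space slice_atlas slice_F"
    unfolding immersion_def smooth_vector_map_def
  proof (intro conjI ballI)
    fix c1 assume "c1 \<in> slice_atlas"
    then obtain c \<Lambda> ell W \<sigma> where 1: "slice_patch c \<Lambda> ell W \<sigma> c1" by (rule slice_atlasE)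
    note pd = patchD[OF slice_patchD(1)[OF 1]]
    show "smooth_on slice_space (snd c1 ` fst c1) (slice_F \<circ> chart_inv c1)"
      unfolding slice_image[OF 1] by (rule slice_smooth(2)[OF 1 smooth_slice_FN(1)[OF 1]])
    fix q assume q: "q \<in> fst c1"
    define y where "y = snd c1 q"
    have y: "y \<in> slice_space \<inter> W" "\<sigma> y = q" using slice_sigma(3,4)[OF 1 q] by (simp_all add: y_def)
    show "inj_on (differential c1 slice_F q) slice_space"
    proof (rule inj_onI)
      fix v w assume vw: "v \<in> slice_space" "w \<in> slice_space" "differential c1 slice_F q v = differential c1 slice_F q w"
      have "dderiv (F \<circ> \<sigma>) v y = dderiv (F \<circ> \<sigma>) w y"
        using slice_differential_F(2)[OF 1 y(1)] vw y(2) by simp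
      then show "v = w" using patch_dderiv_proj[OF slice_patchD(1)[OF 1]] y(1) by (metis IntD2)
    qed
  qed
  show "unit_normal_field slice_space slice_atlas slice_F slice_N"
    unfolding unit_normal_field_def smooth_vector_map_def
  proof (intro conjI ballI)
    fix c1 assume "c1 \<in> slice_atlas"
    then obtain c \<Lambda> ell W \<sigma> where 1: "slice_patch c \<Lambda> ell W \<sigma> c1" by (rule slice_atlasE)
    show "smooth_on slice_space (snd c1 ` fst c1) (slice_N \<circ> chart_inv c1)"
      unfolding slice_image[OF 1] by (rule slice_smooth(2)[OF 1 smooth_slice_FN(2)[OF 1]])
    fix q assume q: "q \<in> fst c1"
    then have qM: "q \<in> topspace M" using slice_patchD(5)[OF 1] slice_subset by blast
    show "norm (slice_N q) = 1"
      using norm_N[OF qM] vertical[OF qM] by (simp add: slice_N_def norm_prod_def)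
    define y where "y = snd c1 q"
    have y: "y \<in> slice_space \<inter> W" "\<sigma> y = q" using slice_sigma(3,4)[OF 1 q] by (simp_all add: y_def)
    fix v assume v: "v \<in> slice_space"
    show "differential c1 slice_F q v \<bullet> slice_N q = 0"
      using slice_normal[OF 1 y(1) v] slice_differential[OF 1 y(1) v, of slice_F] y(2) by simp
  qed
qed

lemma slice_cwmc: "constant_weighted_mean_curvature slice_space slice_atlas slice_F slice_N lam"
  unfolding constant_weighted_mean_curvature_def
proof (intro ballI allI impI)
  fix c1 q B assume c1: "c1 \<in> slice_atlas" and q: "q \<in> fst c1" and B: "orthonormal_tangent_basis slice_space c1 slice_F q B"
  from c1 obtain c \<Lambda> ell W \<sigma> where 1: "slice_patch c \<Lambda> ell W \<sigma> c1" by (rule slice_atlasE)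
  define y where "y = snd c1 q"
  have y: "y \<in> slice_space \<inter> W" "\<sigma> y = q" using slice_sigma(3,4)[OF 1 q] by (simp_all add: y_def)
  show "mean_curvature c1 B slice_F slice_N q + (1/2) * (slice_F q \<bullet> slice_N q) = lam"
    using slice_mean_curvature[OF 1 y(1)] B y(2) by simp
qed

end

section \<open>The splitting\<close>

context vertical_hypersurface
begin

definition unfold_line :: "'p \<times> real \<Rightarrow> 'p" where
  "unfold_line = (\<lambda>(q, t). vflow.flow q t)"

lemma F_unfold_line:
  assumes "q \<in> slice"
  shows "F (unfold_line (q, t)) = map_prod slice_F id (q, t)"
  using assms F_flow_fst_snd[of q t] slice_subset
  by (auto simp: unfold_line_def slice_F_def slice_def prod_eq_iff)

context
  fixes c \<Lambda> ell W \<sigma> c'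
  assumes sp: "slice_patch c \<Lambda> ell W \<sigma> c'"
begin

lemmas spD' = slice_patchD[OF sp]

abbreviation "cyl \<equiv> (fst c' \<times> (UNIV :: real set), map_prod (snd c') (id :: real \<Rightarrow> real))"

lemma cyl_image: "snd cyl ` fst cyl = (slice_space \<inter> W) \<times> UNIV"
proof -
  have "snd cyl ` fst cyl = (snd c' ` fst c') \<times> UNIV" by force
  then show ?thesis by (simp add: slice_image[OF sp])
qed

lemma cyl_open: "openin (top_of_set (slice_space \<times> (UNIV :: real set))) ((slice_space \<inter> W) \<times> UNIV)"
  using Ws_open[OF sp] openin_Times[of slice_space "slice_space \<inter> W" "UNIV :: real set" UNIV] by simp

lemma cyl_subspace: "subspace (slice_space \<times> (UNIV :: real set))"
  by (rule subspace_Times[OF slice_space_facts(1) subspace_UNIV])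

lemma cyl_chart_inv:
  assumes "y \<in> slice_space \<inter> W"
  shows "chart_inv cyl (y, t) = (\<sigma> y, t)"
proof -
  have inj: "inj_on (snd cyl) (fst cyl)"
    by (rule inj_onI) (auto, metis slice_sigma(3)[OF sp])
  have "(\<sigma> y, t) \<in> fst cyl" "snd cyl (\<sigma> y, t) = (y, t)"
    using slice_sigma(1,2)[OF sp assms] by auto
  then show ?thesis unfolding chart_inv_def using inv_into_f_f[OF inj, of "(\<sigma> y, t)"] by simp
qed

lemma smooth_cyl:
  fixes h :: "real^'n \<Rightarrow> 'c::real_normed_vector"
  shows "smooth_on slice_space (slice_space \<inter> W) h \<Longrightarrow> smooth_on (slice_space \<times> (UNIV :: real set)) ((slice_space \<inter> W) \<times> UNIV) (\<lambda>z. h (fst z))"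
  by (rule smooth_on_linear_inner[of fst]) (auto intro: continuous_intros linear_fst)

lemma smooth_product_immersion:
  "smooth_on (slice_space \<times> (UNIV :: real set)) ((slice_space \<inter> W) \<times> UNIV) (\<lambda>z. (slice_F (\<sigma> (fst z)), snd z))"
  using smooth_cyl[OF slice_smooth(1)[OF sp smooth_slice_FN(1)[OF sp]]]
  by (intro smooth_on_Pair smooth_on_bounded_linear[OF bounded_linear_snd]) (simp add: o_def)

text \<open>
  In the ambient space the map is \<open>(q, t) \<mapsto> (slice_F q, t)\<close>, which is smooth; it is continuous because the
  flow is, so it is smooth as a map into \<open>M\<close>.
\<close>
lemma smooth_unfold_line_chart:
  assumes "c1 \<in> A"
  shows "smooth_on (slice_space \<times> UNIV) (snd cyl ` {p \<in> fst cyl. unfold_line p \<in> fst c1}) (snd c1 \<circ> unfold_line \<circ> chart_inv cyl)"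
proof -
  define V where "V = (slice_space \<inter> W) \<times> (UNIV :: real set)"
  note V = cyl_subspace cyl_open[folded V_def]
  define g where "g z = unfold_line (\<sigma> (fst z), snd z)" for z
  have inv: "chart_inv cyl z = (\<sigma> (fst z), snd z)" if "z \<in> V" for z
    using that cyl_chart_inv[of "fst z" "snd z"] by (simp add: V_def mem_Times_iff)
  have "continuous_map (top_of_set V) slice_top (\<lambda>z. \<sigma> (fst z))"
  proof -
    have "continuous_map (top_of_set V) (top_of_set (slice_space \<inter> W)) fst"
      by (auto simp: V_def intro: continuous_intros)
    from continuous_map_compose[OF this continuous_sigma_slice[OF sp]] show ?thesis by (simp add: o_def)
  qed
  then have "continuous_map (top_of_set V) (prod_topology slice_top euclideanreal) (\<lambda>z. (\<sigma> (fst z), snd z))"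
    by (intro continuous_map_pairedI) (auto intro: continuous_intros)
  moreover have "continuous_map (prod_topology slice_top euclideanreal) M unfold_line"
    using splitting_homeomorphism by (simp add: unfold_line_def homeomorphic_maps_def)
  ultimately have "continuous_map (top_of_set V) M (unfold_line \<circ> (\<lambda>z. (\<sigma> (fst z), snd z)))"
    by (rule continuous_map_compose)
  then have g: "continuous_map (top_of_set V) M g" by (simp add: g_def[abs_def] o_def)
  have "(slice_F (\<sigma> (fst z)), snd z) = (F \<circ> g) z" if "z \<in> V" for z
    using that sigma_slice[OF sp, of "fst z"] F_unfold_line by (auto simp: V_def g_def)
  then have Fg: "smooth_on (slice_space \<times> UNIV) V (F \<circ> g)"
    by (rule smooth_on_cong[OF V _ smooth_product_immersion[folded V_def]])
  have sm: "smooth_on (slice_space \<times> UNIV) {z \<in> V. g z \<in> fst c1} (snd c1 \<circ> g)"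
    by (rule smooth_lift[OF V g Fg assms])
  have eq: "snd cyl ` {p \<in> fst cyl. unfold_line p \<in> fst c1} = {z \<in> V. g z \<in> fst c1}"
  proof
    show "snd cyl ` {p \<in> fst cyl. unfold_line p \<in> fst c1} \<subseteq> {z \<in> V. g z \<in> fst c1}"
      using slice_sigma(3,4)[OF sp] by (auto simp: V_def g_def)
    show "{z \<in> V. g z \<in> fst c1} \<subseteq> snd cyl ` {p \<in> fst cyl. unfold_line p \<in> fst c1}"
    proof
      fix z assume z: "z \<in> {z \<in> V. g z \<in> fst c1}"
      then have "fst z \<in> slice_space \<inter> W" by (auto simp: V_def)
      from slice_sigma(1,2)[OF sp this] z
      show "z \<in> snd cyl ` {p \<in> fst cyl. unfold_line p \<in> fst c1}"
        by (intro image_eqI[of _ _ "(\<sigma> (fst z), snd z)"]) (auto simp: g_def)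
    qed
  qed
  have op: "openin (top_of_set (slice_space \<times> (UNIV :: real set))) {z \<in> V. g z \<in> fst c1}"
    using openin_continuous_map_preimage[OF g chart_facts(1)[OF assms]] V(2) by (auto intro: openin_trans)
  show ?thesis
    unfolding eq by (rule smooth_on_cong[OF V(1) op _ sm]) (simp add: g_def inv)
qed

lemma unfold_line_isometry:
  assumes p: "p \<in> fst cyl" and vw: "v \<in> slice_space \<times> UNIV" "w \<in> slice_space \<times> UNIV"
  shows "induced_metric cyl (F \<circ> unfold_line) p v w = induced_metric cyl (map_prod slice_F id) p v w"
proof -
  have "differential cyl (F \<circ> unfold_line) p v = differential cyl (map_prod slice_F id) p v" if v: "v \<in> slice_space \<times> UNIV" for v
  proof -
    have "snd cyl p \<in> (slice_space \<inter> W) \<times> UNIV" using p cyl_image by blast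
    from dderiv_cong[OF cyl_subspace cyl_open this v, of "(F \<circ> unfold_line) \<circ> chart_inv cyl" "map_prod slice_F id \<circ> chart_inv cyl"]
    show ?thesis
      using sigma_slice[OF sp] F_unfold_line cyl_chart_inv
      by (auto simp: differential_def dderiv_def simp del: map_prod_simp)
  qed
  then show ?thesis using vw by (simp add: induced_metric_def)
qed

text \<open>
  The flow does not change the horizontal coordinates, so in the charts of the slice the inverse map is
  the restriction of a linear map of the ambient space.
\<close>
lemma smooth_fold_chart:
  assumes "c1 \<in> A"
  shows "smooth_on UNIV (snd c1 ` {p \<in> fst c1. (drop p, snd (F p)) \<in> fst cyl})
    (snd cyl \<circ> (\<lambda>p. (drop p, snd (F p))) \<circ> chart_inv c1)"
proof -
  have V: "openin (top_of_set UNIV) (snd c1 ` fst c1)" using chart_facts(2)[OF assms] by simp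
  have "smooth_on UNIV (snd c1 ` fst c1) (\<lambda>x. (ell (fst ((F \<circ> chart_inv c1) x)), snd ((F \<circ> chart_inv c1) x)))"
  proof (rule smooth_on_Pair)
    have "bounded_linear ell" using spD'(2) by (simp add: linear_conv_bounded_linear)
    from smooth_on_linear_outer[OF bounded_linear_compose[OF this bounded_linear_fst] chart_facts(4)[OF assms]]
    show "smooth_on UNIV (snd c1 ` fst c1) (\<lambda>x. ell (fst ((F \<circ> chart_inv c1) x)))" .
    show "smooth_on UNIV (snd c1 ` fst c1) (\<lambda>x. snd ((F \<circ> chart_inv c1) x))"
      by (rule smooth_on_linear_outer[OF bounded_linear_snd chart_facts(4)[OF assms]])
  qed
  then have "smooth_on UNIV (snd c1 ` fst c1) (snd cyl \<circ> (\<lambda>p. (drop p, snd (F p))) \<circ> chart_inv c1)"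
  proof (rule smooth_on_cong[OF subspace_UNIV V, rotated])
    fix x assume "x \<in> snd c1 ` fst c1"
    then have "chart_inv c1 x \<in> topspace M" using chart_inv_simps(2)[OF assms] fst_chart_subset[OF assms] by blast
    then show "(ell (fst ((F \<circ> chart_inv c1) x)), snd ((F \<circ> chart_inv c1) x)) = (snd cyl \<circ> (\<lambda>p. (drop p, snd (F p))) \<circ> chart_inv c1) x"
      by (simp add: spD'(6) slice_F_def drop_def F_flow_fst_snd)
  qed
  then show ?thesis by (rule smooth_on_subset) auto
qed

end

lemma line_atlasE:
  assumes "d \<in> line_product_atlas slice_atlas"
  obtains c \<Lambda> ell W \<sigma> c' where "slice_patch c \<Lambda> ell W \<sigma> c'" "d = (fst c' \<times> UNIV, map_prod (snd c') id)"
  using assms by (auto simp: line_product_atlas_def elim!: slice_atlasE)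

lemma splits: "splits_off_vertical_line UNIV M A F slice_space slice_top slice_atlas slice_F"
  unfolding splits_off_vertical_line_def
proof (intro exI[of _ unfold_line] conjI ballI allI)
  show "F (unfold_line (q, t)) = (slice_F q, t)" if "q \<in> topspace slice_top" for q t
    using F_unfold_line[of q t] that by simp
  have homeo: "homeomorphic_maps (prod_topology slice_top euclideanreal) M unfold_line (\<lambda>p. (drop p, snd (F p)))"
    using splitting_homeomorphism by (simp add: unfold_line_def)
  show "riemannian_isometry (slice_space \<times> UNIV) (prod_topology slice_top euclideanreal)
     (line_product_atlas slice_atlas) (map_prod slice_F id) UNIV M A F unfold_line"
    unfolding riemannian_isometry_def diffeomorphism_def smooth_manifold_map_def
  proof (intro conjI exI[of _ "\<lambda>p. (drop p, snd (F p))"] ballI)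
    show "homeomorphic_maps (prod_topology slice_top euclideanreal) M unfold_line (\<lambda>p. (drop p, snd (F p)))"
      by (rule homeo)
    show "continuous_map (prod_topology slice_top euclideanreal) M unfold_line"
      "continuous_map M (prod_topology slice_top euclideanreal) (\<lambda>p. (drop p, snd (F p)))"
      using homeo by (auto simp: homeomorphic_maps_def)
    fix d assume "d \<in> line_product_atlas slice_atlas"
    then obtain c \<Lambda> ell W \<sigma> c' where 1: "slice_patch c \<Lambda> ell W \<sigma> c'" "d = (fst c' \<times> UNIV, map_prod (snd c') id)"
      by (rule line_atlasE)
    show "smooth_on (slice_space \<times> UNIV) (snd d ` {p \<in> fst d. unfold_line p \<in> fst c1}) (snd c1 \<circ> unfold_line \<circ> chart_inv d)" if "c1 \<in> A" for c1
      unfolding 1(2) by (rule smooth_unfold_line_chart[OF 1(1) that])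
    show "smooth_on UNIV (snd c1 ` {p \<in> fst c1. (drop p, snd (F p)) \<in> fst d}) (snd d \<circ> (\<lambda>p. (drop p, snd (F p))) \<circ> chart_inv c1)" if "c1 \<in> A" for c1
      unfolding 1(2) by (rule smooth_fold_chart[OF 1(1) that])
    show "induced_metric d (F \<circ> unfold_line) p v w = induced_metric d (map_prod slice_F id) p v w"
      if "p \<in> fst d" "v \<in> slice_space \<times> UNIV" "w \<in> slice_space \<times> UNIV" for p v w
      using unfold_line_isometry[OF 1(1)] that unfolding 1(2) by blast
  qed
qed

end

theorem theorem1:
  fixes M :: "'p topology"
    and A :: "('p, real ^ 'n) chart set"
    and F N :: "'p \<Rightarrow> (real ^ 'n) \<times> real"
    and lam :: real
  assumes "hypersurface UNIV M A F N"
    and "complete_hypersurface M F"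
    and "proper_map M euclidean F"
    and "constant_weighted_mean_curvature UNIV A F N lam"
    and "N ` topspace M \<subseteq> {x \<in> sphere 0 1. snd x \<ge> 0}"
  shows "is_hyperplane M F \<or>
    (\<exists>(S' :: (real ^ 'n) set) (M' :: 'p topology) A' (F' :: 'p \<Rightarrow> real ^ 'n) N'.
       hypersurface S' M' A' F' N' \<and>
       constant_weighted_mean_curvature S' A' F' N' lam \<and>
       splits_off_vertical_line UNIV M A F S' M' A' F')"
proof -
  interpret proper_lambda_hypersurface M A F N lam
    by unfold_locales (rule assms)+
  have "0 \<le> N p \<bullet> (0, 1)" if "p \<in> topspace M" for p
    using assms(5) that by (auto simp: inner_prod_def)
  then obtain m where m: "0 \<le> m" "\<And>p. p \<in> topspace M \<Longrightarrow> N p \<bullet> (0, 1) = m"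
    using angle_constant by blast
  show ?thesis
  proof (cases "m = 0")
    case False
    then have "is_hyperplane M F"
      using flat_imp_hyperplane flat_of_positive_angle[OF _ m(2)] m(1) by (metis order_le_less)
    then show ?thesis ..
  next
    case True
    interpret vertical_hypersurface M A F N lam k for k :: 'n
      by unfold_locales (use m(2) True in \<open>simp add: inner_prod_def\<close>)
    show ?thesis
      using slice_hypersurface slice_cwmc splits by blast
  qed
qed

end
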